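(* Let $g=\{g_R\}_{R\in\mathcal{D}\otimes\mathcal{D}}$ be a dyadic distribution and let $\pi_g(f):=\sum_{R\in\mathcal{D}\otimes\mathcal{D}} g_R\langle f\rangle_R h_R$. Then: (I) for all $0<p,q,r<\infty$ with $\frac1q=\frac1p+\frac1r$, \[\|\pi_g\|_{H_d^p(\mathbb{R}\otimes\mathbb{R})\to\dot H_d^q(\mathbb{R}\otimes\mathbb{R})}\simeq \|g\|_{\dot H_d^r(\mathbb{R}\otimes\mathbb{R})};\] (II) for all $0<p<\infty$, \[\|\pi_g\|_{H_d^p(\mathbb{R}\otimes\mathbb{R})\to\dot H_d^p(\mathbb{R}\otimes\mathbb{R})}\simeq \|g\|_{BMO_d(\mathbb{R}\otimes\mathbb{R})},\] where $\simeq$ means two-sided inequalities with constants depending only on the exponents (in particular independent of $g$; both sides may be infinite simultaneously).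
   Context: $\mathcal{D}$ is the set of dyadic intervals of $\mathbb{R}$ and $\mathcal{D}\otimes\mathcal{D}$ the set of dyadic rectangles $R=I\times J$, $I,J\in\mathcal{D}$. For a dyadic interval $I$, $h_I$ is the $L^2$-normalized Haar function of $I$, and $h_R:=h_I\otimes h_J$. A dyadic distribution is a family of real numbers $\{f_R\}_{R\in\mathcal{D}\otimes\mathcal{D}}$, written formally $f=\sum_R f_Rh_R$; its dyadic square function is $S_d(f)=(\sum_R f_R^2\chi_R/|R|)^{1/2}$. $\langle f\rangle_R=|R|^{-1}\int_R f$. The bi-parameter dyadic maximal function of $f\in L^1_{loc}(\mathbb{R}^2)$ is $M_d(f)(x)=\sup_{x\in R\in\mathcal{D}\otimes\mathcal{D}}|\langle f\rangle_R|$. $H_d^p(\mathbb{R}\otimes\mathbb{R})$ is the completion of the space of locally integrable $f$ with $\|f\|_{H^p_d}:=\|M_d f\|_{L^p(\mathbb{R}^2)}<\infty$. $\dot H_d^q(\mathbb{R}\otimes\mathbb{R})$ is the space of dyadic distributions $f$ with $\|f\|_{\dot H^q_d}:=\|S_d(f)\|_{L^q(\mathbb{R}^2)}<\infty$. $\pi_g(f)$ is the dyadic distribution with coefficients $g_R\langle f\rangle_R$, and the operator norm is the supremum of $\|\pi_g f\|_{\dot H^q_d}$ over locally integrable $f$ with $\|f\|_{H^p_d}\le 1$. $\|g\|_{BMO_d(\mathbb{R}\otimes\mathbb{R})}:=\sup_\Omega\big(|\Omega|^{-1}\sum_{R\in\mathcal{D}\otimes\mathcal{D},\,R\subseteq\Omega}g_R^2\big)^{1/2}$,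 the supremum over all open sets $\Omega\subset\mathbb{R}^2$ of finite positive measure. *)

theory Defs
  imports "HOL-Analysis.Analysis"
begin

type_synonym dint = "int \<times> int"
type_synonym drect = "dint \<times> dint"

definition dyadic_interval :: "dint \<Rightarrow> real set" where
  "dyadic_interval I = {real_of_int (snd I) * 2 powr (- real_of_int (fst I)) ..<
                        (real_of_int (snd I) + 1) * 2 powr (- real_of_int (fst I))}"

definition rect :: "drect \<Rightarrow> (real \<times> real) set" where
  "rect R = dyadic_interval (fst R) \<times> dyadic_interval (snd R)"

definition rect_measure :: "drect \<Rightarrow> real" where
  "rect_measure R = 2 powr (- real_of_int (fst (fst R))) * 2 powr (- real_of_int (fst (snd R)))"

definition epowr :: "ennreal \<Rightarrow> real \<Rightarrow> ennreal" where
  "epowr x a = (if x = \<infinity> then \<infinity> else ennreal (enn2real x powr a))"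

definition avg :: "(real \<times> real \<Rightarrow> real) \<Rightarrow> drect \<Rightarrow> real" where
  "avg f R = (LINT x:rect R|lborel. f x) / rect_measure R"

definition locally_integrable :: "(real \<times> real \<Rightarrow> real) \<Rightarrow> bool" where
  "locally_integrable f \<longleftrightarrow> (\<forall>K. compact K \<longrightarrow> set_integrable lborel K f)"

definition max_d :: "(real \<times> real \<Rightarrow> real) \<Rightarrow> real \<times> real \<Rightarrow> ennreal" where
  "max_d f x = (SUP R \<in> {R. x \<in> rect R}. ennreal \<bar>avg f R\<bar>)"

definition Lp_enorm :: "real \<Rightarrow> (real \<times> real \<Rightarrow> ennreal) \<Rightarrow> ennreal" where
  "Lp_enorm p F = epowr (\<integral>\<^sup>+ x. epowr (F x) p \<partial>lborel) (1 / p)"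

definition Hp_norm :: "real \<Rightarrow> (real \<times> real \<Rightarrow> real) \<Rightarrow> ennreal" where
  "Hp_norm p f = Lp_enorm p (max_d f)"

definition sq_fun :: "(drect \<Rightarrow> real) \<Rightarrow> real \<times> real \<Rightarrow> ennreal" where
  "sq_fun f x = epowr (\<Sum>\<^sub>\<infinity>R\<in>UNIV. ennreal ((f R)\<^sup>2 * indicator (rect R) x / rect_measure R)) (1/2)"

definition Hdot_norm :: "real \<Rightarrow> (drect \<Rightarrow> real) \<Rightarrow> ennreal" where
  "Hdot_norm q f = Lp_enorm q (sq_fun f)"

definition paraprod :: "(drect \<Rightarrow> real) \<Rightarrow> (real \<times> real \<Rightarrow> real) \<Rightarrow> drect \<Rightarrow> real" where
  "paraprod g f R = g R * avg f R"

definition paraprod_opnorm :: "real \<Rightarrow> real \<Rightarrow> (drect \<Rightarrow> real) \<Rightarrow> ennreal" where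
  "paraprod_opnorm p q g =
     (SUP f \<in> {f. locally_integrable f \<and> Hp_norm p f \<le> 1}. Hdot_norm q (paraprod g f))"

definition BMO_norm :: "(drect \<Rightarrow> real) \<Rightarrow> ennreal" where
  "BMO_norm g = (SUP \<Omega> \<in> {\<Omega>. open \<Omega> \<and> 0 < emeasure lborel \<Omega> \<and> emeasure lborel \<Omega> < \<infinity>}.
      epowr ((\<Sum>\<^sub>\<infinity>R\<in>{R. rect R \<subseteq> \<Omega>}. ennreal ((g R)\<^sup>2)) / emeasure lborel \<Omega>) (1/2))"

end

theory Submission
  imports Defs
begin

text \<open>
  The upper bounds come from the pointwise inequality \<open>S(\<pi>\<^sub>g f) \<le> M f \<cdot> S g\<close> and Hoelder, respectively
  from the Carleson embedding for families satisfying the BMO packing condition.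

  For the lower bounds, \<open>\<pi>\<^sub>g\<close> is tested on functions whose averages are bounded below on the
  rectangles half contained in a given set \<open>\<Omega>\<close>. If \<open>p > 1\<close>, the indicator of \<open>\<Omega>\<close> does this, since the
  strong maximal function is bounded on \<open>L\<^sup>p\<close>. If \<open>p \<le> 1\<close>, its maximal function decays too slowly, and
  the indicator is replaced by a projection onto Haar functions of rectangles contained in an
  enlargement of \<open>\<Omega>\<close> of comparable measure: a stopping time is run on every slice in the second
  variable and then, in the first variable, on each resulting Haar coefficient separately. The
  maximal function of this projection vanishes off the enlargement, and its \<open>L\<^sup>2\<close> distance to the
  indicator is so small that only rectangles inside a small exceptional set are lost.

  The BMO bound follows by testing on a set where the packing constant of a finite part of \<open>g\<close> is
  attained, the bound by the square function by testing on all its level sets simultaneously, with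
  averaging over signs if \<open>p \<le> 1\<close>.
\<close>

section \<open>Powers of extended reals and dyadic intervals\<close>

text \<open>In one variable the maximal intervals of high density are disjoint, and a function
  differs from its projection by averages over them, which are small because the parent intervals
  have low density. In the plane maximal rectangles overlap and no such decomposition exists; this
  is why one-dimensional stopping times are iterated. Projections help for p \<le> 1 through
  cancellation: the average of a Haar function over a rectangle vanishes unless the rectangle lies
  inside its support. Averages of an indicator decay only like the reciprocal of the area, and the
  p-th power of this is not integrable at infinity.

  The lower bounds close by absorption: the quantity to be estimated reappears on the right with a
  factor 1/2. This is legitimate only for finite quantities, so everything is proved for finite
  families of rectangles, with constants independent of the family. For the square function the test
  functions imitate S(g)^(r/p), where S(g) belongs to the finite family; the exponents match because
  q (r/p + 1) = r.\<close>

abbreviation pint :: "real \<Rightarrow> ('a::euclidean_space \<Rightarrow> ennreal) \<Rightarrow> ennreal" where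
  "pint s h \<equiv> \<integral>\<^sup>+x. epowr (h x) s \<partial>lborel"

lemma epowr_0 [simp]: "epowr 0 a = 0"
  by (simp add: epowr_def)

lemma epowr_top [simp]: "epowr top a = top"
  by (simp add: epowr_def)

lemma epowr_ennreal: "0 \<le> x \<Longrightarrow> epowr (ennreal x) a = ennreal (x powr a)"
  by (simp add: epowr_def)

lemma epowr_one [simp]: "epowr x 1 = x"
  by (cases x) (auto simp: epowr_ennreal)

lemma epowr_1 [simp]: "epowr 1 a = 1"
  using epowr_ennreal[of 1 a] by simp

lemma epowr_mono: "x \<le> y \<Longrightarrow> 0 \<le> a \<Longrightarrow> epowr x a \<le> epowr y a"
  by (cases x; cases y) (auto simp: epowr_ennreal top_unique intro!: ennreal_leI powr_mono2)

text \<open>The conventions \<open>0 powr a = 0\<close> and \<open>epowr top a = top\<close> for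
  every exponent, zero and negative ones included, together with \<open>0 * top = 0\<close>, make
  this and the next two laws unconditional.\<close>

lemma epowr_mult: "epowr (x * y) a = epowr x a * epowr y a"
proof (cases x; cases y)
  fix r s assume "0 \<le> r" "x = ennreal r" "0 \<le> s" "y = ennreal s"
  then show ?thesis by (simp add: epowr_ennreal flip: ennreal_mult) (simp add: epowr_ennreal powr_mult)
qed (auto simp: epowr_ennreal ennreal_mult_top ennreal_top_mult ennreal_mult_eq_top_iff)

lemma epowr_epowr: "epowr (epowr x a) b = epowr x (a * b)"
  by (cases x) (auto simp: epowr_ennreal powr_powr)

lemma epowr_add: "epowr x (a + b) = epowr x a * epowr x b"
  by (cases x) (auto simp: epowr_ennreal powr_add ennreal_mult)

lemma epowr_inverse [simp]:
  "0 < a \<Longrightarrow> epowr (epowr x a) (1 / a) = x"  "0 < a \<Longrightarrow> epowr (epowr x (1 / a)) a = x"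
  by (simp_all add: epowr_epowr)

text \<open>The Galois form of monotonicity. It also yields commutation with suprema without any
  continuity argument.\<close>

lemma epowr_le_iff: "0 < a \<Longrightarrow> epowr x a \<le> y \<longleftrightarrow> x \<le> epowr y (1 / a)"
  using epowr_mono[of "epowr x a" y "1 / a"] epowr_mono[of x "epowr y (1 / a)" a] by auto

lemma epowr_SUP: "0 < a \<Longrightarrow> epowr (SUP i\<in>I. X i) a = (SUP i\<in>I. epowr (X i) a)"
  by (intro antisym) (auto simp: epowr_le_iff intro!: SUP_least SUP_upper epowr_mono, metis SUP_upper epowr_le_iff)

lemma measurable_epowr [measurable]:
  assumes [measurable]: "f \<in> borel_measurable M"
  shows "(\<lambda>x. epowr (f x) a) \<in> borel_measurable M"
  unfolding epowr_def by measurable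

lemma epowr_eq_0_iff [simp]: "epowr x a = 0 \<longleftrightarrow> x = 0"
  by (cases x) (auto simp: epowr_ennreal)

lemma epowr_eq_top_iff [simp]: "epowr x a = top \<longleftrightarrow> x = top"
  by (cases x) (auto simp: epowr_ennreal)

lemma epowr_less_top_iff [simp]: "epowr x a < top \<longleftrightarrow> x < top"
  by (simp add: less_top[symmetric])

text \<open>Young's inequality without the factors \<open>1 / a\<close> and \<open>1 / b\<close>; it replaces Hoelder throughout.\<close>

lemma epowr_young:
  assumes "0 < a" "0 < b" "1 / a + 1 / b = (1::real)"
  shows "x * y \<le> epowr x a + epowr y b"
proof -
  \<comment> \<open>Each factor is at most a power of \<open>t\<close> and the exponents add up to
    1, so the product is at most the larger of the two terms.\<close>
  define t where "t = max (epowr x a) (epowr y b)"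
  have "x * y \<le> epowr t (1 / a) * epowr t (1 / b)"
    using assms by (intro mult_mono) (auto simp: epowr_le_iff[symmetric] t_def)
  also have "\<dots> = t" by (simp add: assms flip: epowr_add)
  also have "\<dots> \<le> epowr x a + epowr y b" by (auto simp: t_def)
  finally show ?thesis .
qed

section \<open>Dyadic intervals and rectangles as level sets\<close>

definition lev :: "int \<Rightarrow> real \<Rightarrow> int" where
  "lev n x = \<lfloor>x * 2 powr real_of_int n\<rfloor>"

text \<open>\<open>lev n x\<close> is the index of the interval of length \<open>2 powr - n\<close>
  around \<open>x\<close>; larger \<open>n\<close> means finer. Membership becomes an equation
  between integers, and nesting becomes integer division.\<close>

lemma mem_dyadic_interval: "x \<in> dyadic_interval I \<longleftrightarrow> lev (fst I) x = snd I"
proof -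
  have *: "2 powr (- real_of_int n) = inverse (2 powr real_of_int n)" for n
    by (simp add: powr_minus)
  have p: "(2::real) powr real_of_int n > 0" for n by simp
  show ?thesis
    unfolding dyadic_interval_def lev_def floor_eq_iff * using p[of "fst I"]
    by (auto simp: field_simps)
qed

text \<open>The floor of a quotient by a positive integer is the integer quotient of the
  floor.\<close>

lemma lev_coarser:
  assumes "m \<le> n" shows "lev m x = lev n x div 2 ^ nat (n - m)"
proof -
  have "(2::real) powr m = 2 powr n / 2 ^ nat (n - m)"
    using assms by (simp add: powr_diff flip: powr_realpow)
  then have "lev m x = \<lfloor>x * 2 powr n / real_of_int (2 ^ nat (n - m))\<rfloor>"
    by (simp add: lev_def)
  then show ?thesis
    unfolding lev_def by (subst floor_divide_real_eq_div[symmetric]) auto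
qed

lemma lev_eq_coarser: "lev n x = lev n y \<Longrightarrow> m \<le> n \<Longrightarrow> lev m x = lev m y"
  by (simp add: lev_coarser[of m n])

lemma dyadic_interval_measurable [measurable]: "dyadic_interval I \<in> sets borel"
  by (simp add: dyadic_interval_def)

lemma emeasure_dyadic_interval: "emeasure lborel (dyadic_interval I) = ennreal (2 powr - real_of_int (fst I))"
  by (simp add: dyadic_interval_def algebra_simps)

lemma measure_dyadic_interval: "measure lborel (dyadic_interval I) = 2 powr - real_of_int (fst I)"
  by (simp add: measure_def emeasure_dyadic_interval)

lemma dyadic_interval_subset:
  assumes "x \<in> dyadic_interval I" "x \<in> dyadic_interval J" "fst J \<le> fst I"
  shows "dyadic_interval I \<subseteq> dyadic_interval J"
proof
  fix y assume "y \<in> dyadic_interval I"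
  then have "lev (fst I) y = lev (fst I) x" using assms by (simp add: mem_dyadic_interval)
  then have "lev (fst J) y = lev (fst J) x" using assms(3) by (rule lev_eq_coarser)
  then show "y \<in> dyadic_interval J" using assms by (simp add: mem_dyadic_interval)
qed

lemma dyadic_interval_nonempty: "dyadic_interval I \<noteq> {}"
proof -
  have "emeasure lborel (dyadic_interval I) \<noteq> 0"
    by (simp add: emeasure_dyadic_interval)
  then show ?thesis by auto
qed

lemma dyadic_interval_mono_level:
  assumes "dyadic_interval I \<subseteq> dyadic_interval J" shows "fst J \<le> fst I"
proof -
  have "emeasure lborel (dyadic_interval I) \<le> emeasure lborel (dyadic_interval J)"
    using assms by (intro emeasure_mono) auto
  then show ?thesis by (simp add: emeasure_dyadic_interval)
qed

lemma lev_measurable [measurable]: "lev n \<in> borel \<rightarrow>\<^sub>M count_space UNIV"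
  unfolding lev_def by measurable

lemma mem_rect: "x \<in> rect R \<longleftrightarrow> fst x \<in> dyadic_interval (fst R) \<and> snd x \<in> dyadic_interval (snd R)"
  by (cases x) (simp add: rect_def)

lemma rect_measurable [measurable]: "rect R \<in> sets borel"
  unfolding rect_def by (intro borel_Times) auto

lemma rect_measure_pos [simp]: "0 < rect_measure R" "0 \<le> rect_measure R" "rect_measure R \<noteq> 0"
  by (simp_all add: rect_measure_def less_imp_le)

lemma emeasure_rect: "emeasure lborel (rect R) = ennreal (rect_measure R)"
proof -
  have "emeasure lborel (rect R) = emeasure (lborel \<Otimes>\<^sub>M lborel) (rect R)"
    by (simp only: lborel_prod)
  also have "\<dots> = ennreal (rect_measure R)"
    unfolding rect_def rect_measure_def
    by (subst lborel.emeasure_pair_measure_Times) (simp_all add: emeasure_dyadic_interval ennreal_mult)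
  finally show ?thesis .
qed

lemma measure_rect: "measure lborel (rect R) = rect_measure R"
  by (simp add: measure_def emeasure_rect)

section \<open>Dyadic maximal functions\<close>

definition dmax :: "(real \<Rightarrow> ennreal) \<Rightarrow> real \<Rightarrow> ennreal" where
  "dmax h x = (SUP I\<in>{I. x \<in> dyadic_interval I}.
     (\<integral>\<^sup>+y\<in>dyadic_interval I. h y \<partial>lborel) / ennreal (2 powr - real_of_int (fst I)))"

abbreviation ravg :: "(real \<times> real \<Rightarrow> ennreal) \<Rightarrow> drect \<Rightarrow> ennreal" where
  "ravg h R \<equiv> (\<integral>\<^sup>+y\<in>rect R. h y \<partial>lborel) / ennreal (rect_measure R)"

text \<open>The strong dyadic maximal function. Applied to the absolute value of a signed
  \<open>f\<close> it dominates \<open>max_d f\<close>; cancellation is visible only to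
  \<open>max_d\<close>.\<close>

definition smax :: "(real \<times> real \<Rightarrow> ennreal) \<Rightarrow> real \<times> real \<Rightarrow> ennreal" where
  "smax h x = (SUP R\<in>{R. x \<in> rect R}. ravg h R)"

text \<open>The index set no longer depends on \<open>x\<close>, so that for countable index types
  measurability is automatic.\<close>

lemma SUP_indicator_mult:
  fixes v :: "'i \<Rightarrow> ennreal"
  shows "(SUP i\<in>{i. x \<in> A i}. v i) = (SUP i. indicator (A i) x * v i)"
proof (rule antisym)
  show "(SUP i\<in>{i. x \<in> A i}. v i) \<le> (SUP i. indicator (A i) x * v i)"
  proof (rule SUP_least)
    fix i assume "i \<in> {i. x \<in> A i}"
    then have "v i = indicator (A i) x * v i" by simp
    also have "\<dots> \<le> (SUP i. indicator (A i) x * v i)" by (rule SUP_upper) simp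
    finally show "v i \<le> (SUP i. indicator (A i) x * v i)" .
  qed
  show "(SUP i. indicator (A i) x * v i) \<le> (SUP i\<in>{i. x \<in> A i}. v i)"
    by (rule SUP_least) (auto simp: indicator_def intro: SUP_upper)
qed

lemma dmax_measurable [measurable]: "dmax h \<in> borel_measurable borel"
  unfolding dmax_def SUP_indicator_mult by measurable

lemma smax_measurable [measurable]: "smax h \<in> borel_measurable borel"
  unfolding smax_def SUP_indicator_mult by measurable

lemma dmax_measurable_param [measurable]:
  assumes [measurable]: "(\<lambda>(x, y). h x y) \<in> borel_measurable (M \<Otimes>\<^sub>M borel)" "g \<in> borel_measurable M"
  shows "(\<lambda>x. dmax (h x) (g x)) \<in> borel_measurable M"
  unfolding dmax_def SUP_indicator_mult by measurable

section \<open>Weak and strong type inequalities in one variable\<close>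

lemma finite_dyadic_disjoint_cover:
  assumes "finite G"
  obtains M where "M \<subseteq> G" "disjoint_family_on dyadic_interval M"
    "(\<Union>I\<in>M. dyadic_interval I) = (\<Union>I\<in>G. dyadic_interval I)"
proof
  \<comment> \<open>The maximal members. Dyadic intervals that meet are nested, so these are
    disjoint, and the coarsest member around a point is maximal.\<close>
  define M where "M = {I\<in>G. \<forall>J\<in>G. dyadic_interval I \<subseteq> dyadic_interval J \<longrightarrow> I = J}"
  show "M \<subseteq> G" by (auto simp: M_def)
  show "disjoint_family_on dyadic_interval M"
  unfolding disjoint_family_on_def
  proof (intro ballI impI)
    fix I J assume IJ: "I \<in> M" "J \<in> M" "I \<noteq> J"
    show "dyadic_interval I \<inter> dyadic_interval J = {}"
    proof (rule ccontr)
      assume "dyadic_interval I \<inter> dyadic_interval J \<noteq> {}"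
      then obtain x where x: "x \<in> dyadic_interval I" "x \<in> dyadic_interval J" by blast
      have "dyadic_interval I \<subseteq> dyadic_interval J \<or> dyadic_interval J \<subseteq> dyadic_interval I"
        using x dyadic_interval_subset by (meson linear)
      with IJ show False by (auto simp: M_def)
    qed
  qed
  show "(\<Union>I\<in>M. dyadic_interval I) = (\<Union>I\<in>G. dyadic_interval I)"
  proof
    show "(\<Union>I\<in>M. dyadic_interval I) \<subseteq> (\<Union>I\<in>G. dyadic_interval I)" by (auto simp: M_def)
    show "(\<Union>I\<in>G. dyadic_interval I) \<subseteq> (\<Union>I\<in>M. dyadic_interval I)"
    proof
      fix x assume "x \<in> (\<Union>I\<in>G. dyadic_interval I)"
      then have ne: "fst ` {I\<in>G. x \<in> dyadic_interval I} \<noteq> {}" and fin: "finite (fst ` {I\<in>G. x \<in> dyadic_interval I})"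
        using assms by auto
      from Min_in[OF fin ne] obtain J where J: "J \<in> G" "x \<in> dyadic_interval J"
        and J_Min: "fst J = Min (fst ` {I\<in>G. x \<in> dyadic_interval I})"
        by auto
      have min: "fst J \<le> fst I" if "I \<in> G" "x \<in> dyadic_interval I" for I
        unfolding J_Min using that by (intro Min_le fin) auto
      have "J \<in> M"
        unfolding M_def
      proof (intro CollectI conjI ballI impI J)
        fix K assume K: "K \<in> G" "dyadic_interval J \<subseteq> dyadic_interval K"
        then have xK: "x \<in> dyadic_interval K" using J by auto
        have "fst J = fst K" using min[OF K(1) xK] dyadic_interval_mono_level[OF K(2)] by simp
        then show "J = K" using xK J by (auto simp: mem_dyadic_interval prod_eq_iff)
      qed
      then show "x \<in> (\<Union>I\<in>M. dyadic_interval I)" using J by auto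
    qed
  qed
qed

lemma sum_indicator_disjoint_le_1:
  assumes "finite M" "disjoint_family_on A M"
  shows "(\<Sum>i\<in>M. indicator (A i) x) \<le> (1::ennreal)"
proof (cases "\<exists>i\<in>M. x \<in> A i")
  case True
  then obtain i where i: "i \<in> M" "x \<in> A i" by blast
  have "(\<Sum>j\<in>M. indicator (A j) x) = (\<Sum>j\<in>M. if j = i then 1 else 0 :: ennreal)"
    using i assms(2) by (intro sum.cong) (auto simp: disjoint_family_on_def indicator_def)
  then show ?thesis using i assms(1) by simp
qed auto

text \<open>The maximal intervals are disjoint and cover the same set, so no constant is lost to
  overlaps.\<close>

lemma dyadic_weak_type_finite:
  assumes "finite G" and [measurable]: "h \<in> borel_measurable borel"
    and le: "\<And>I. I \<in> G \<Longrightarrow> c * emeasure lborel (dyadic_interval I) \<le> (\<integral>\<^sup>+y\<in>dyadic_interval I. h y \<partial>lborel)"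
  shows "c * emeasure lborel (\<Union>I\<in>G. dyadic_interval I) \<le> (\<integral>\<^sup>+y. h y \<partial>lborel)"
proof -
  obtain M where M: "M \<subseteq> G" "disjoint_family_on dyadic_interval M"
    "(\<Union>I\<in>M. dyadic_interval I) = (\<Union>I\<in>G. dyadic_interval I)"
    using finite_dyadic_disjoint_cover[OF assms(1)] .
  have fM: "finite M" using M(1) assms(1) finite_subset by blast
  have "c * emeasure lborel (\<Union>I\<in>G. dyadic_interval I) \<le> c * (\<Sum>I\<in>M. emeasure lborel (dyadic_interval I))"
    unfolding M(3)[symmetric] using fM by (intro mult_left_mono emeasure_subadditive_finite) auto
  also have "\<dots> \<le> (\<Sum>I\<in>M. \<integral>\<^sup>+y\<in>dyadic_interval I. h y \<partial>lborel)"
    using M(1) le by (auto simp: sum_distrib_left intro!: sum_mono)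
  also have "\<dots> = (\<integral>\<^sup>+y. h y * (\<Sum>I\<in>M. indicator (dyadic_interval I) y) \<partial>lborel)"
    by (subst nn_integral_sum[symmetric]) (auto simp: sum_distrib_left)
  also have "\<dots> \<le> (\<integral>\<^sup>+y. h y * 1 \<partial>lborel)"
    using fM M(2) by (intro nn_integral_mono mult_left_mono sum_indicator_disjoint_le_1) auto
  finally show ?thesis by simp
qed

text \<open>Exhaustion of the countable family along \<open>to_nat\<close>.\<close>

lemma dyadic_weak_type:
  assumes [measurable]: "h \<in> borel_measurable borel"
    and le: "\<And>I. I \<in> G \<Longrightarrow> c * emeasure lborel (dyadic_interval I) \<le> (\<integral>\<^sup>+y\<in>dyadic_interval I. h y \<partial>lborel)"
  shows "c * emeasure lborel (\<Union>I\<in>G. dyadic_interval I) \<le> (\<integral>\<^sup>+y. h y \<partial>lborel)"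
proof -
  define A where "A n = (\<Union>I\<in>{I\<in>G. to_nat I < n}. dyadic_interval I)" for n
  have fin: "finite {I\<in>G. to_nat I < n}" for n
    by (rule finite_subset[OF _ finite_vimageI[OF finite_lessThan[of n] inj_to_nat]]) auto
  have U: "(\<Union>I\<in>G. dyadic_interval I) = (\<Union>n. A n)"
    by (auto simp: A_def)
  have "emeasure lborel (\<Union>I\<in>G. dyadic_interval I) = (SUP n. emeasure lborel (A n))"
    unfolding U by (rule SUP_emeasure_incseq[symmetric]) (fastforce simp: A_def incseq_def)+
  then have "c * emeasure lborel (\<Union>I\<in>G. dyadic_interval I) = (SUP n. c * emeasure lborel (A n))"
    by (simp add: SUP_mult_left_ennreal)
  also have "\<dots> \<le> (\<integral>\<^sup>+y. h y \<partial>lborel)"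
    unfolding A_def by (intro SUP_least dyadic_weak_type_finite fin le) auto
  finally show ?thesis .
qed

text \<open>The layer cake formula, which together with Fubini turns bounds for superlevel sets into
  bounds for integrals of powers.\<close>

lemma nn_integral_powr_below:
  assumes \<rho>: "0 < \<rho>"
  shows "(\<integral>\<^sup>+l. ennreal (\<rho> * l powr (\<rho> - 1)) * indicator {l. 0 < l \<and> ennreal l < X} l \<partial>lborel) = epowr X \<rho>"
    (is "?I X = _")
proof -
  have finite_case: "(\<integral>\<^sup>+l. ennreal (\<rho> * l powr (\<rho> - 1)) * indicator {l. 0 < l \<and> ennreal l < ennreal b} l \<partial>lborel)
      = ennreal (b powr \<rho>)" if b: "0 \<le> b" for b
  proof -
    have "((\<lambda>x. x powr (\<rho> - 1)) has_integral (b powr \<rho> / \<rho>)) {0..b}"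
      using has_integral_powr_from_0[of "\<rho> - 1" b] \<rho> b by simp
    from has_integral_mult_right[OF this, of \<rho>]
    have "((\<lambda>x. \<rho> * x powr (\<rho> - 1)) has_integral b powr \<rho>) {0..b}"
      using \<rho> by simp
    from nn_integral_has_integral_lebesgue[OF _ this]
    have "(\<integral>\<^sup>+x. ennreal (indicator {0..b} x * (\<rho> * x powr (\<rho> - 1))) \<partial>lborel) = ennreal (b powr \<rho>)"
      using \<rho> by simp
    also have "(\<integral>\<^sup>+x. ennreal (indicator {0..b} x * (\<rho> * x powr (\<rho> - 1))) \<partial>lborel) =
      (\<integral>\<^sup>+l. ennreal (\<rho> * l powr (\<rho> - 1)) * indicator {l. 0 < l \<and> ennreal l < ennreal b} l \<partial>lborel)"
    proof (rule nn_integral_cong_AE)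
      have "AE x in lborel. x \<noteq> b" by (rule AE_lborel_singleton)
      then show "AE x in lborel. ennreal (indicator {0..b} x * (\<rho> * x powr (\<rho> - 1)))
         = ennreal (\<rho> * x powr (\<rho> - 1)) * indicator {l. 0 < l \<and> ennreal l < ennreal b} x"
      proof (eventually_elim)
        fix x assume "x \<noteq> b"
        then show "ennreal (indicator {0..b} x * (\<rho> * x powr (\<rho> - 1)))
         = ennreal (\<rho> * x powr (\<rho> - 1)) * indicator {l. 0 < l \<and> ennreal l < ennreal b} x"
          using b by (cases "x = 0") (auto simp: indicator_def ennreal_less_iff)
      qed
    qed
    finally show ?thesis .
  qed
  show ?thesis
  proof (cases X)
    case (real b)
    then show ?thesis using finite_case[of b] by (simp add: epowr_ennreal)
  next
    case top
    \<comment> \<open>The infinite value is reached from below, by the finite \<open>X\<close> whose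
      power is \<open>n\<close>.\<close>
    have "ennreal (real n) \<le> ?I top" for n
    proof -
      have "ennreal (real n) = ennreal ((real n powr (1 / \<rho>)) powr \<rho>)" using \<rho> by (simp add: powr_powr)
      also have "\<dots> = ?I (ennreal (real n powr (1 / \<rho>)))" by (rule finite_case[symmetric]) simp
      also have "\<dots> \<le> ?I top" by (intro nn_integral_mono mult_left_mono) (auto simp: indicator_def)
      finally show ?thesis .
    qed
    then have "(SUP n. of_nat n :: ennreal) \<le> ?I top"
      by (intro SUP_least) (simp add: ennreal_of_nat_eq_real_of_nat)
    then have "?I top = top" by (simp add: ennreal_SUP_of_nat_eq_top top_unique)
    then show ?thesis using top by simp
  qed
qed


lemma divide_le_ennreal_iff:
  assumes "0 < b" shows "x / ennreal b \<le> c \<longleftrightarrow> x \<le> c * ennreal b"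
proof -
  have *: "ennreal (1 / b) * ennreal b = 1" using assms by (simp flip: ennreal_mult)
  have d: "x / ennreal b = x * ennreal (1 / b)"
    using assms by (simp add: divide_ennreal_def inverse_ennreal divide_inverse)
  show ?thesis
    unfolding d using mult_right_mono[of "x * ennreal (1 / b)" c "ennreal b"]
      mult_right_mono[of x "c * ennreal b" "ennreal (1 / b)"] *
    by (auto simp: mult.assoc mult.commute[of "ennreal b"])
qed

lemma less_divide_ennreal_iff:
  "0 < b \<Longrightarrow> c < x / ennreal b \<longleftrightarrow> c * ennreal b < x"
  using divide_le_ennreal_iff[of b x c] by (simp add: not_le[symmetric])

text \<open>The part of \<open>h\<close> below height \<open>l / 2\<close> contributes at most
  \<open>l / 2\<close> to an average, so the part above is responsible for the rest. Keeping this
  truncation on the right makes the interpolation integral converge.\<close>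

lemma dmax_weak_type:
  assumes [measurable]: "h \<in> borel_measurable borel" and l: "0 < l"
  shows "ennreal l * emeasure lborel {x. ennreal l < dmax h x}
     \<le> 2 * (\<integral>\<^sup>+y. h y * indicator {y. ennreal l < 2 * h y} y \<partial>lborel)"
proof -
  define h1 where "h1 y = h y * indicator {y. ennreal l < 2 * h y} y" for y
  have [measurable]: "h1 \<in> borel_measurable borel" unfolding h1_def by measurable
  define G where "G = {I. ennreal l * ennreal (2 powr - real_of_int (fst I)) < (\<integral>\<^sup>+y\<in>dyadic_interval I. h y \<partial>lborel)}"
  have sub: "{x. ennreal l < dmax h x} = (\<Union>I\<in>G. dyadic_interval I)"
    by (auto simp: dmax_def less_SUP_iff G_def less_divide_ennreal_iff simp del: split_paired_Ex split_paired_All)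
  have "ennreal (l / 2) * emeasure lborel (\<Union>I\<in>G. dyadic_interval I) \<le> (\<integral>\<^sup>+y. h1 y \<partial>lborel)"
  proof (rule dyadic_weak_type)
    fix I assume I: "I \<in> G"
    let ?m = "ennreal (2 powr - real_of_int (fst I))"
    have half: "h y \<le> h1 y + ennreal (l / 2)" for y
    proof (cases "ennreal l < 2 * h y")
      case False
      then have "2 * h y \<le> 2 * ennreal (l / 2)" using l by (simp flip: ennreal_numeral ennreal_mult)
      then have "h y \<le> ennreal (l / 2)" by (subst (asm) ennreal_mult_le_mult_iff) auto
      then show ?thesis by (simp add: add_increasing)
    qed (simp add: h1_def)
    have "ennreal (l / 2) * ?m + ennreal (l / 2) * ?m = ennreal l * ?m"
      using l by (simp flip: ennreal_mult ennreal_plus)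
    also have "\<dots> \<le> (\<integral>\<^sup>+y\<in>dyadic_interval I. h y \<partial>lborel)" using I by (simp add: G_def)
    also have "\<dots> \<le> (\<integral>\<^sup>+y. h1 y * indicator (dyadic_interval I) y + ennreal (l / 2) * indicator (dyadic_interval I) y \<partial>lborel)"
      by (intro nn_integral_mono) (auto simp: indicator_def half)
    also have "\<dots> = ennreal (l / 2) * ?m + (\<integral>\<^sup>+y\<in>dyadic_interval I. h1 y \<partial>lborel)"
      by (subst nn_integral_add) (auto simp: nn_integral_cmult_indicator emeasure_dyadic_interval add.commute)
    finally have "ennreal (l / 2) * ?m = top \<or> ennreal (l / 2) * ?m \<le> (\<integral>\<^sup>+y\<in>dyadic_interval I. h1 y \<partial>lborel)"
      by (simp only: ennreal_add_left_cancel_le infinity_ennreal_def)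
    then have "ennreal (l / 2) * ?m \<le> (\<integral>\<^sup>+y\<in>dyadic_interval I. h1 y \<partial>lborel)"
      by (simp add: ennreal_mult_eq_top_iff)
    then show "ennreal (l / 2) * emeasure lborel (dyadic_interval I) \<le> (\<integral>\<^sup>+y\<in>dyadic_interval I. h1 y \<partial>lborel)"
      by (simp add: emeasure_dyadic_interval)
  qed simp
  then have "2 * (ennreal (l / 2) * emeasure lborel {x. ennreal l < dmax h x}) \<le> 2 * (\<integral>\<^sup>+y. h1 y \<partial>lborel)"
    unfolding sub by (rule mult_left_mono) simp
  moreover have "2 * (ennreal (l / 2) * e) = ennreal l * e" for e
    using l by (simp flip: mult.assoc ennreal_numeral ennreal_mult)
  ultimately show ?thesis by (simp add: h1_def)
qed

text \<open>Marcinkiewicz interpolation. After exchanging the integrals,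
  \<open>l powr (s - 2)\<close> is integrated over \<open>0 < l < 2 * h y\<close>, which converges
  at 0 because \<open>1 < s\<close>. The constant is the product of \<open>2 * s / (s - 1)\<close>
  and \<open>2 powr (s - 1)\<close>.\<close>

lemma dmax_strong_type:
  assumes [measurable]: "h \<in> borel_measurable borel" and s: "1 < s"
  shows "pint s (dmax h) \<le> ennreal (2 powr s * s / (s - 1)) * pint s h"
proof -
  define w where "w l = ennreal (s * l powr (s - 1))" for l
  have [measurable]: "w \<in> borel_measurable borel" unfolding w_def by measurable
  have "pint s (dmax h)
      = (\<integral>\<^sup>+x. \<integral>\<^sup>+l. w l * indicator {l. 0 < l \<and> ennreal l < dmax h x} l \<partial>lborel \<partial>lborel)"
    unfolding w_def using s by (subst nn_integral_powr_below) auto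
  also have "\<dots> = (\<integral>\<^sup>+l. \<integral>\<^sup>+x. w l * indicator {l. 0 < l \<and> ennreal l < dmax h x} l \<partial>lborel \<partial>lborel)"
    by (rule lborel_pair.Fubini'[symmetric]) measurable
  also have "\<dots> = (\<integral>\<^sup>+l. w l * indicator {0<..} l * emeasure lborel {x. ennreal l < dmax h x} \<partial>lborel)"
  proof (intro nn_integral_cong)
    fix l :: real
    have "(\<integral>\<^sup>+x. w l * indicator {l. 0 < l \<and> ennreal l < dmax h x} l \<partial>lborel)
      = (\<integral>\<^sup>+x. (w l * indicator {0<..} l) * indicator {x. ennreal l < dmax h x} x \<partial>lborel)"
      by (intro nn_integral_cong) (auto simp: indicator_def)
    then show "(\<integral>\<^sup>+x. w l * indicator {l. 0 < l \<and> ennreal l < dmax h x} l \<partial>lborel)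
      = w l * indicator {0<..} l * emeasure lborel {x. ennreal l < dmax h x}"
      by (subst (asm) nn_integral_cmult_indicator) auto
  qed
  also have "\<dots> \<le> (\<integral>\<^sup>+l. \<integral>\<^sup>+y. ennreal (2 * s / (s - 1)) * (h y * (ennreal ((s - 1) * l powr (s - 1 - 1)) * indicator {l. 0 < l \<and> ennreal l < 2 * h y} l)) \<partial>lborel \<partial>lborel)"
  proof (intro nn_integral_mono)
    fix l :: real
    show "w l * indicator {0<..} l * emeasure lborel {x. ennreal l < dmax h x} \<le>
      (\<integral>\<^sup>+y. ennreal (2 * s / (s - 1)) * (h y * (ennreal ((s - 1) * l powr (s - 1 - 1)) * indicator {l. 0 < l \<and> ennreal l < 2 * h y} l)) \<partial>lborel)"
    proof (cases "0 < l")
      case True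
      have w: "w l = ennreal (s * l powr (s - 1 - 1)) * ennreal l"
        unfolding w_def using True s powr_add[of l "s - 1 - 1" 1] by (simp flip: ennreal_mult)
      have c: "ennreal (s * l powr (s - 1 - 1)) * 2 = ennreal (2 * s / (s - 1)) * ennreal ((s - 1) * l powr (s - 1 - 1))"
        using s by (simp flip: ennreal_mult ennreal_numeral)
      have "w l * indicator {0<..} l * emeasure lborel {x. ennreal l < dmax h x}
        = ennreal (s * l powr (s - 1 - 1)) * (ennreal l * emeasure lborel {x. ennreal l < dmax h x})"
        using True by (simp add: w mult.assoc)
      also have "\<dots> \<le> ennreal (s * l powr (s - 1 - 1)) * (2 * (\<integral>\<^sup>+y. h y * indicator {y. ennreal l < 2 * h y} y \<partial>lborel))"
        by (intro mult_left_mono dmax_weak_type True) auto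
      also have "\<dots> = (\<integral>\<^sup>+y. (ennreal (2 * s / (s - 1)) * ennreal ((s - 1) * l powr (s - 1 - 1))) * (h y * indicator {y. ennreal l < 2 * h y} y) \<partial>lborel)"
        unfolding c[symmetric] by (simp add: nn_integral_cmult mult.assoc)
      also have "\<dots> = (\<integral>\<^sup>+y. ennreal (2 * s / (s - 1)) * (h y * (ennreal ((s - 1) * l powr (s - 1 - 1)) * indicator {l. 0 < l \<and> ennreal l < 2 * h y} l)) \<partial>lborel)"
        using True by (intro nn_integral_cong) (auto simp: indicator_def ac_simps)
      finally show ?thesis .
    qed simp
  qed
  also have "\<dots> = (\<integral>\<^sup>+y. \<integral>\<^sup>+l. ennreal (2 * s / (s - 1)) * (h y * (ennreal ((s - 1) * l powr (s - 1 - 1)) * indicator {l. 0 < l \<and> ennreal l < 2 * h y} l)) \<partial>lborel \<partial>lborel)"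
    by (rule lborel_pair.Fubini') measurable
  also have "\<dots> = (\<integral>\<^sup>+y. ennreal (2 * s / (s - 1)) * (h y * epowr (2 * h y) (s - 1)) \<partial>lborel)"
  proof (intro nn_integral_cong)
    fix y
    show "(\<integral>\<^sup>+l. ennreal (2 * s / (s - 1)) * (h y * (ennreal ((s - 1) * l powr (s - 1 - 1)) * indicator {l. 0 < l \<and> ennreal l < 2 * h y} l)) \<partial>lborel)
      = ennreal (2 * s / (s - 1)) * (h y * epowr (2 * h y) (s - 1))"
      using s by (subst nn_integral_cmult, measurable, subst nn_integral_cmult, measurable) (simp only: nn_integral_powr_below diff_gt_0_iff_gt)
  qed
  also have "\<dots> = (\<integral>\<^sup>+y. ennreal (2 powr s * s / (s - 1)) * epowr (h y) s \<partial>lborel)"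
  proof (intro nn_integral_cong)
    fix y
    have 1: "epowr (2 * h y) (s - 1) = ennreal (2 powr (s - 1)) * epowr (h y) (s - 1)"
      using epowr_ennreal[of 2 "s - 1"] by (simp add: epowr_mult)
    have 2: "h y * epowr (h y) (s - 1) = epowr (h y) s"
      using epowr_add[of "h y" 1 "s - 1"] by simp
    have 3: "ennreal (2 * s / (s - 1)) * ennreal (2 powr (s - 1)) = ennreal (2 powr s * s / (s - 1))"
      using s powr_add[of 2 1 "s - 1"] by (simp flip: ennreal_mult)
    show "ennreal (2 * s / (s - 1)) * (h y * epowr (2 * h y) (s - 1)) = ennreal (2 powr s * s / (s - 1)) * epowr (h y) s"
      unfolding 1 2[symmetric] 3[symmetric] by (simp only: mult.assoc mult.left_commute)
  qed
  also have "\<dots> = ennreal (2 powr s * s / (s - 1)) * pint s h"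
    by (rule nn_integral_cmult) simp
  finally show ?thesis .
qed


section \<open>Passage to the strong maximal function\<close>

lemma nn_integral_rect:
  assumes [measurable]: "h \<in> borel_measurable borel"
  shows "(\<integral>\<^sup>+y\<in>rect R. h y \<partial>lborel) =
    (\<integral>\<^sup>+y1\<in>dyadic_interval (fst R). (\<integral>\<^sup>+y2\<in>dyadic_interval (snd R). h (y1, y2) \<partial>lborel) \<partial>lborel)"
proof -
  have [measurable]: "h \<in> borel_measurable (borel \<Otimes>\<^sub>M borel)" by (simp add: borel_prod)
  have "(\<integral>\<^sup>+y\<in>rect R. h y \<partial>lborel) = (\<integral>\<^sup>+y. h y * (indicator (dyadic_interval (fst R)) (fst y) * indicator (dyadic_interval (snd R)) (snd y)) \<partial>(lborel \<Otimes>\<^sub>M lborel))"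
    unfolding lborel_prod by (intro nn_integral_cong) (auto simp: indicator_def mem_rect)
  also have "\<dots> = (\<integral>\<^sup>+y1. \<integral>\<^sup>+y2. h (y1, y2) * (indicator (dyadic_interval (fst R)) y1 * indicator (dyadic_interval (snd R)) y2) \<partial>lborel \<partial>lborel)"
    by (subst lborel.nn_integral_fst[symmetric]) auto
  also have "\<dots> = (\<integral>\<^sup>+y1. \<integral>\<^sup>+y2. indicator (dyadic_interval (fst R)) y1 * (h (y1, y2) * indicator (dyadic_interval (snd R)) y2) \<partial>lborel \<partial>lborel)"
    by (simp add: ac_simps)
  also have "\<dots> = (\<integral>\<^sup>+y1\<in>dyadic_interval (fst R). (\<integral>\<^sup>+y2\<in>dyadic_interval (snd R). h (y1, y2) \<partial>lborel) \<partial>lborel)"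
    by (subst nn_integral_cmult) (auto simp: ac_simps)
  finally show ?thesis .
qed

lemma divide_mult_ennreal:
  "0 < a \<Longrightarrow> 0 < b \<Longrightarrow> x / ennreal (a * b) = x / ennreal b / ennreal a"
  unfolding divide_ennreal_def
  by (subst inverse_ennreal, simp)+ (simp add: ennreal_mult mult.assoc mult.commute[of "ennreal (inverse a)"])

text \<open>An average over a rectangle is an average over one side of averages over the other; the
  inner ones are replaced by their supremum.\<close>

lemma smax_le_dmax_dmax:
  assumes [measurable]: "h \<in> borel_measurable borel"
  shows "smax h x \<le> dmax (\<lambda>y1. dmax (\<lambda>y2. h (y1, y2)) (snd x)) (fst x)"
  unfolding smax_def
proof (rule SUP_least)
  fix R assume "R \<in> {R. x \<in> rect R}"
  then have x: "fst x \<in> dyadic_interval (fst R)" "snd x \<in> dyadic_interval (snd R)" by (auto simp: mem_rect)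
  have [measurable]: "h \<in> borel_measurable (borel \<Otimes>\<^sub>M borel)" by (simp add: borel_prod)
  let ?a = "2 powr - real_of_int (fst (fst R))" and ?b = "2 powr - real_of_int (fst (snd R))"
  have "ravg h R
    = (\<integral>\<^sup>+y1\<in>dyadic_interval (fst R). ((\<integral>\<^sup>+y2\<in>dyadic_interval (snd R). h (y1, y2) \<partial>lborel) / ennreal ?b) \<partial>lborel) / ennreal ?a"
    unfolding rect_measure_def nn_integral_rect[OF assms]
  proof (subst divide_mult_ennreal, simp, simp, rule arg_cong[where f="\<lambda>x. x / ennreal ?a"])
    have "(\<integral>\<^sup>+y1\<in>dyadic_interval (fst R). ((\<integral>\<^sup>+y2\<in>dyadic_interval (snd R). h (y1, y2) \<partial>lborel) / ennreal ?b) \<partial>lborel)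
      = (\<integral>\<^sup>+y1. (\<integral>\<^sup>+y2\<in>dyadic_interval (snd R). h (y1, y2) \<partial>lborel) * indicator (dyadic_interval (fst R)) y1 / ennreal ?b \<partial>lborel)"
      by (intro nn_integral_cong) (simp only: divide_ennreal_def ac_simps)
    also have "\<dots> = (\<integral>\<^sup>+y1\<in>dyadic_interval (fst R). (\<integral>\<^sup>+y2\<in>dyadic_interval (snd R). h (y1, y2) \<partial>lborel) \<partial>lborel) / ennreal ?b"
      by (rule nn_integral_divide) measurable
    finally show "(\<integral>\<^sup>+y1\<in>dyadic_interval (fst R). (\<integral>\<^sup>+y2\<in>dyadic_interval (snd R). h (y1, y2) \<partial>lborel) \<partial>lborel) / ennreal ?b
      = (\<integral>\<^sup>+y1\<in>dyadic_interval (fst R). ((\<integral>\<^sup>+y2\<in>dyadic_interval (snd R). h (y1, y2) \<partial>lborel) / ennreal ?b) \<partial>lborel)" ..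
  qed
  also have "\<dots> \<le> (\<integral>\<^sup>+y1\<in>dyadic_interval (fst R). dmax (\<lambda>y2. h (y1, y2)) (snd x) \<partial>lborel) / ennreal ?a"
    unfolding dmax_def using x
    by (intro divide_right_mono_ennreal nn_integral_mono mult_right_mono SUP_upper) auto
  also have "\<dots> \<le> dmax (\<lambda>y1. dmax (\<lambda>y2. h (y1, y2)) (snd x)) (fst x)"
    using x by (subst dmax_def[of _ "fst x"]) (intro SUP_upper, auto)
  finally show "ravg h R \<le> dmax (\<lambda>y1. dmax (\<lambda>y2. h (y1, y2)) (snd x)) (fst x)" .
qed

text \<open>The one-variable bound is used twice through Fubini. The iterated maximal function
  itself, and not only \<open>smax\<close>, has to be estimated because it is what controls where
  the stopping projection has nonzero averages.\<close>

lemma dmax_dmax_strong_type: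
  assumes [measurable]: "h \<in> borel_measurable borel" and s: "1 < s"
  shows "(\<integral>\<^sup>+x. epowr (dmax (\<lambda>y1. dmax (\<lambda>y2. h (y1, y2)) (snd x)) (fst x)) s \<partial>lborel)
    \<le> ennreal ((2 powr s * s / (s - 1))\<^sup>2) * pint s h"
proof -
  let ?C = "ennreal (2 powr s * s / (s - 1))"
  have [measurable]: "h \<in> borel_measurable (borel \<Otimes>\<^sub>M borel)" by (simp add: borel_prod)
  have h2 [measurable]: "(\<lambda>y2. h (y1, y2)) \<in> borel_measurable borel" for y1 by measurable
  have "(\<integral>\<^sup>+x. epowr (dmax (\<lambda>y1. dmax (\<lambda>y2. h (y1, y2)) (snd x)) (fst x)) s \<partial>lborel)
    = (\<integral>\<^sup>+x. epowr (dmax (\<lambda>y1. dmax (\<lambda>y2. h (y1, y2)) (snd x)) (fst x)) s \<partial>(lborel \<Otimes>\<^sub>M lborel))"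
    by (simp only: lborel_prod)
  also have "\<dots> = (\<integral>\<^sup>+x2. \<integral>\<^sup>+x1. epowr (dmax (\<lambda>y1. dmax (\<lambda>y2. h (y1, y2)) x2) x1) s \<partial>lborel \<partial>lborel)"
    by (subst lborel_pair.nn_integral_snd[symmetric]) (auto simp: split_beta)
  also have "\<dots> \<le> (\<integral>\<^sup>+x2. ?C * (\<integral>\<^sup>+x1. epowr (dmax (\<lambda>y2. h (x1, y2)) x2) s \<partial>lborel) \<partial>lborel)"
    by (intro nn_integral_mono dmax_strong_type s) measurable
  also have "\<dots> = ?C * (\<integral>\<^sup>+x2. \<integral>\<^sup>+x1. epowr (dmax (\<lambda>y2. h (x1, y2)) x2) s \<partial>lborel \<partial>lborel)"
    by (subst nn_integral_cmult) auto
  also have "\<dots> = ?C * (\<integral>\<^sup>+x1. \<integral>\<^sup>+x2. epowr (dmax (\<lambda>y2. h (x1, y2)) x2) s \<partial>lborel \<partial>lborel)"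
    by (subst lborel_pair.Fubini') auto
  also have "\<dots> \<le> ?C * (\<integral>\<^sup>+x1. ?C * (\<integral>\<^sup>+x2. epowr (h (x1, x2)) s \<partial>lborel) \<partial>lborel)"
    by (intro mult_left_mono nn_integral_mono dmax_strong_type s) auto
  also have "\<dots> = ?C * (?C * (\<integral>\<^sup>+x1. \<integral>\<^sup>+x2. epowr (h (x1, x2)) s \<partial>lborel \<partial>lborel))"
    by (subst nn_integral_cmult) auto
  also have "(\<integral>\<^sup>+x1. \<integral>\<^sup>+x2. epowr (h (x1, x2)) s \<partial>lborel \<partial>lborel) = (\<integral>\<^sup>+x. epowr (h x) s \<partial>(lborel \<Otimes>\<^sub>M lborel))"
    by (subst lborel.nn_integral_fst[symmetric]) auto
  also have "\<dots> = pint s h" by (simp only: lborel_prod)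
  also have "?C * (?C * pint s h) = ennreal ((2 powr s * s / (s - 1))\<^sup>2) * pint s h"
    using s by (simp only: power2_eq_square) (subst ennreal_mult, simp_all add: mult.assoc)
  finally show ?thesis .
qed

lemma smax_strong_type:
  assumes [measurable]: "h \<in> borel_measurable borel" and s: "1 < s"
  shows "pint s (smax h) \<le> ennreal ((2 powr s * s / (s - 1))\<^sup>2) * pint s h"
proof -
  have "pint s (smax h) \<le> (\<integral>\<^sup>+x. epowr (dmax (\<lambda>y1. dmax (\<lambda>y2. h (y1, y2)) (snd x)) (fst x)) s \<partial>lborel)"
    using s by (intro nn_integral_mono epowr_mono smax_le_dmax_dmax) auto
  also have "\<dots> \<le> ennreal ((2 powr s * s / (s - 1))\<^sup>2) * pint s h"
    by (rule dmax_dmax_strong_type[OF assms])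
  finally show ?thesis .
qed

section \<open>Sums over rectangles and the Carleson embedding\<close>

text \<open>For \<open>w R = (g R)\<^sup>2\<close> this is the square of the square function of the
  finite family \<open>F\<close>; integrals of its powers therefore carry half of the
  exponent.\<close>

definition rsum :: "drect set \<Rightarrow> (drect \<Rightarrow> real) \<Rightarrow> real \<times> real \<Rightarrow> real" where
  "rsum F w x = (\<Sum>R\<in>F. w R * indicator (rect R) x / rect_measure R)"

abbreviation rint :: "drect set \<Rightarrow> (drect \<Rightarrow> real) \<Rightarrow> real \<Rightarrow> ennreal" where
  "rint F w s \<equiv> \<integral>\<^sup>+x. ennreal (rsum F w x powr s) \<partial>lborel"

lemma rsum_measurable [measurable]: "rsum F w \<in> borel_measurable borel"
  unfolding rsum_def by measurable

lemma rsum_nonneg: "(\<And>R. R \<in> F \<Longrightarrow> 0 \<le> w R) \<Longrightarrow> 0 \<le> rsum F w x"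
  unfolding rsum_def by (intro sum_nonneg) (auto simp: indicator_def less_imp_le)

lemma rsum_mono:
  assumes "finite F" "F' \<subseteq> F" "\<And>R. R \<in> F' \<Longrightarrow> w' R \<le> w R" "\<And>R. R \<in> F \<Longrightarrow> 0 \<le> w R"
  shows "rsum F' w' x \<le> rsum F w x"
proof -
  have "rsum F' w' x \<le> rsum F' w x"
    unfolding rsum_def using assms(3) by (intro sum_mono divide_right_mono mult_right_mono) (auto simp: less_imp_le)
  also have "\<dots> \<le> rsum F w x"
    unfolding rsum_def using assms by (intro sum_mono2) (auto simp: indicator_def less_imp_le)
  finally show ?thesis .
qed

lemma rsum_le_sum:
  assumes "finite F" "\<And>R. R \<in> F \<Longrightarrow> 0 \<le> w R"
  shows "rsum F w x \<le> (\<Sum>R\<in>F. w R / rect_measure R) * indicator (\<Union>R\<in>F. rect R) x"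
proof (cases "x \<in> (\<Union>R\<in>F. rect R)")
  case True
  then show ?thesis
    unfolding rsum_def using assms by (auto simp: indicator_def less_imp_le intro!: sum_mono)
next
  case False
  then show ?thesis unfolding rsum_def by (simp add: indicator_def)
qed

lemma emeasure_Union_rect_finite: "finite F \<Longrightarrow> emeasure lborel (\<Union>R\<in>F. rect R) < top"
  by (rule le_less_trans[OF emeasure_subadditive_finite]) (auto simp: emeasure_rect ennreal_sum_less_top)

text \<open>The function is bounded and lives on a set of finite measure. This finiteness licenses
  every absorption below that involves integrals of \<open>rsum\<close>.\<close>

lemma rsum_powr_finite:
  assumes "finite F" "\<And>R. R \<in> F \<Longrightarrow> 0 \<le> w R" "0 < s"
  shows "rint F w s < top"
proof -
  define b where "b = (\<Sum>R\<in>F. w R / rect_measure R)"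
  have "0 \<le> b" unfolding b_def using assms by (auto intro!: sum_nonneg)
  have "rint F w s \<le> (\<integral>\<^sup>+x. ennreal (b powr s) * indicator (\<Union>R\<in>F. rect R) x \<partial>lborel)"
  proof (intro nn_integral_mono)
    fix x
    have "rsum F w x powr s \<le> (b * indicator (\<Union>R\<in>F. rect R) x) powr s"
      unfolding b_def using assms by (intro powr_mono2 rsum_nonneg rsum_le_sum) auto
    then have "ennreal (rsum F w x powr s) \<le> ennreal ((b * indicator (\<Union>R\<in>F. rect R) x) powr s)"
      by (rule ennreal_leI)
    also have "\<dots> = ennreal (b powr s) * indicator (\<Union>R\<in>F. rect R) x"
      by (simp add: indicator_def)
    finally show "ennreal (rsum F w x powr s) \<le> ennreal (b powr s) * indicator (\<Union>R\<in>F. rect R) x" .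
  qed
  also have "\<dots> = ennreal (b powr s) * emeasure lborel (\<Union>R\<in>F. rect R)"
    using assms(1) by (subst nn_integral_cmult_indicator) (auto intro!: sets.finite_UN)
  also have "\<dots> < top"
    using emeasure_Union_rect_finite[OF assms(1)] by (simp add: ennreal_mult_less_top)
  finally show ?thesis .
qed

text \<open>Pairing with \<open>rsum\<close> sees only the averages of \<open>h\<close>; this is the
  basis for estimating norms of \<open>rsum\<close> by duality.\<close>

lemma nn_integral_rsum_mult:
  assumes "\<And>R. R \<in> F \<Longrightarrow> 0 \<le> w R" and [measurable]: "h \<in> borel_measurable borel"
  shows "(\<integral>\<^sup>+x. ennreal (rsum F w x) * h x \<partial>lborel) =
    (\<Sum>R\<in>F. ennreal (w R) * ravg h R)"
proof -
  have "ennreal (rsum F w x) * h x = (\<Sum>R\<in>F. ennreal (w R / rect_measure R) * (h x * indicator (rect R) x))" for x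
  proof -
    have "ennreal (rsum F w x) = (\<Sum>R\<in>F. ennreal (w R / rect_measure R) * indicator (rect R) x)"
    proof -
      have "ennreal (rsum F w x) = (\<Sum>R\<in>F. ennreal (w R * indicator (rect R) x / rect_measure R))"
        unfolding rsum_def using assms(1) by (intro sum_ennreal[symmetric]) (simp add: less_imp_le)
      also have "\<dots> = (\<Sum>R\<in>F. ennreal (w R / rect_measure R) * indicator (rect R) x)"
        by (intro sum.cong refl) (simp add: indicator_def)
      finally show ?thesis .
    qed
    then show ?thesis by (simp add: sum_distrib_left sum_distrib_right ac_simps)
  qed
  then have "(\<integral>\<^sup>+x. ennreal (rsum F w x) * h x \<partial>lborel) =
    (\<Sum>R\<in>F. ennreal (w R / rect_measure R) * (\<integral>\<^sup>+x\<in>rect R. h x \<partial>lborel))"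
    by (simp add: nn_integral_sum nn_integral_cmult)
  also have "\<dots> = (\<Sum>R\<in>F. ennreal (w R) * ravg h R)"
  proof (intro sum.cong refl)
    fix R assume "R \<in> F"
    then have "0 \<le> w R" using assms by simp
    then show "ennreal (w R / rect_measure R) * (\<integral>\<^sup>+x\<in>rect R. h x \<partial>lborel)
        = ennreal (w R) * ravg h R"
      by (subst divide_ennreal[symmetric]) (auto simp: divide_ennreal_def mult.assoc mult.commute)
  qed
  finally show ?thesis .
qed

lemma nn_integral_rsum:
  assumes "\<And>R. R \<in> F \<Longrightarrow> 0 \<le> w R"
  shows "(\<integral>\<^sup>+x. ennreal (rsum F w x) \<partial>lborel) = ennreal (\<Sum>R\<in>F. w R)"
proof -
  have 1: "ennreal (rect_measure R) / ennreal (rect_measure R) = 1" for R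
    by (simp add: divide_ennreal)
  show ?thesis
    using nn_integral_rsum_mult[of F w "\<lambda>_. 1"] assms
    by (simp add: emeasure_rect 1)
qed

lemma avg_le_smax: "x \<in> rect R \<Longrightarrow> ravg h R \<le> smax h x"
  unfolding smax_def by (rule SUP_upper) auto

text \<open>Layer cake in the height \<open>l\<close>: the rectangles with \<open>\<theta> R\<close>
  above \<open>l\<close> lie in the set where \<Theta> exceeds \<open>l\<close>, so the packing
  condition for this subfamily bounds their weight by \<open>K\<close> times the measure of that
  set.\<close>

lemma carleson_embedding:
  fixes \<theta> :: "drect \<Rightarrow> ennreal"
  assumes F: "finite F" and w: "\<And>R. R \<in> F \<Longrightarrow> 0 \<le> w R"
    and packing: "\<And>F'. F' \<subseteq> F \<Longrightarrow> ennreal (\<Sum>R\<in>F'. w R) \<le> K * emeasure lborel (\<Union>R\<in>F'. rect R)"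
    and [measurable]: "\<Theta> \<in> borel_measurable borel"
    and le: "\<And>R x. R \<in> F \<Longrightarrow> x \<in> rect R \<Longrightarrow> \<theta> R \<le> \<Theta> x"
  shows "(\<Sum>R\<in>F. ennreal (w R) * \<theta> R) \<le> K * (\<integral>\<^sup>+x. \<Theta> x \<partial>lborel)"
proof -
  have layer: "(\<integral>\<^sup>+l. indicator {l. 0 < l \<and> ennreal l < X} l \<partial>lborel) = X" for X
  proof -
    have "(\<integral>\<^sup>+l. indicator {l. 0 < l \<and> ennreal l < X} l \<partial>lborel)
      = (\<integral>\<^sup>+l. ennreal (1 * l powr (1 - 1)) * indicator {l. 0 < l \<and> ennreal l < X} l \<partial>lborel)"
      by (intro nn_integral_cong) (auto simp: indicator_def)
    then show ?thesis using nn_integral_powr_below[of 1 X] by simp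
  qed
  let ?F = "\<lambda>l. {R\<in>F. ennreal l < \<theta> R}"
  have "(\<Sum>R\<in>F. ennreal (w R) * \<theta> R) = (\<integral>\<^sup>+l. (\<Sum>R\<in>F. ennreal (w R) * indicator {l. 0 < l \<and> ennreal l < \<theta> R} l) \<partial>lborel)"
    by (subst nn_integral_sum) (simp_all add: nn_integral_cmult layer)
  also have "\<dots> \<le> (\<integral>\<^sup>+l. \<integral>\<^sup>+x. K * indicator {l. 0 < l \<and> ennreal l < \<Theta> x} l \<partial>lborel \<partial>lborel)"
  proof (intro nn_integral_mono)
    fix l :: real
    show "(\<Sum>R\<in>F. ennreal (w R) * indicator {l. 0 < l \<and> ennreal l < \<theta> R} l) \<le> (\<integral>\<^sup>+x. K * indicator {l. 0 < l \<and> ennreal l < \<Theta> x} l \<partial>lborel)"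
    proof (cases "0 < l")
      case True
      have "(\<Sum>R\<in>F. ennreal (w R) * indicator {l. 0 < l \<and> ennreal l < \<theta> R} l) = (\<Sum>R\<in>F. if ennreal l < \<theta> R then ennreal (w R) else 0)"
        using True by (intro sum.cong) (auto simp: indicator_def)
      also have "\<dots> = (\<Sum>R\<in>?F l. ennreal (w R))" using F by (rule sum.inter_filter[symmetric])
      also have "\<dots> = ennreal (\<Sum>R\<in>?F l. w R)" using w by (intro sum_ennreal) auto
      also have "\<dots> \<le> K * emeasure lborel (\<Union>R\<in>?F l. rect R)" by (rule packing) auto
      also have "\<dots> \<le> K * emeasure lborel {x. ennreal l < \<Theta> x}"
        using le by (intro mult_left_mono emeasure_mono) (auto intro: less_le_trans)
      also have "\<dots> = (\<integral>\<^sup>+x. K * indicator {x. ennreal l < \<Theta> x} x \<partial>lborel)"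
        by (subst nn_integral_cmult_indicator) auto
      also have "\<dots> = (\<integral>\<^sup>+x. K * indicator {l. 0 < l \<and> ennreal l < \<Theta> x} l \<partial>lborel)"
        using True by (intro nn_integral_cong) (auto simp: indicator_def)
      finally show ?thesis .
    qed auto
  qed
  also have "\<dots> = (\<integral>\<^sup>+x. \<integral>\<^sup>+l. K * indicator {l. 0 < l \<and> ennreal l < \<Theta> x} l \<partial>lborel \<partial>lborel)"
    by (rule pair_sigma_finite.Fubini') (auto intro!: pair_sigma_finite.intro lborel.sigma_finite_measure_axioms)
  also have "\<dots> = K * (\<integral>\<^sup>+x. \<Theta> x \<partial>lborel)"
    by (simp add: nn_integral_cmult layer)
  finally show ?thesis .
qed

text \<open>For \<open>A = top\<close> the first hypothesis holds whatever \<open>B\<close> is;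
  finiteness makes it legitimate to subtract half of \<open>A\<close>.\<close>

lemma ennreal_absorb_half:
  assumes "A \<le> B + ennreal (1 / 2) * A" "A < top" shows "A \<le> 2 * B"
proof (cases B)
  case (real b)
  obtain a where a: "0 \<le> a" "A = ennreal a" using assms(2) by (cases A) auto
  have "ennreal a \<le> ennreal b + ennreal (1 / 2 * a)"
    using assms(1) real a ennreal_mult[of "1 / 2" a] by simp
  then have "ennreal a \<le> ennreal (b + 1 / 2 * a)"
    using real a by simp
  then have "a \<le> b + 1 / 2 * a" using real a by (subst (asm) ennreal_le_iff) auto
  then have "a \<le> 2 * b" by simp
  then show ?thesis using real a by (simp add: ennreal_leI flip: ennreal_numeral ennreal_mult)
qed (simp add: ennreal_mult_top)

lemma smax_one_le: "smax (\<lambda>_. 1) x \<le> 1"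
  unfolding smax_def by (rule SUP_least) (simp add: emeasure_rect divide_ennreal)

text \<open>
  The hypothesis is used with \<open>h = (rsum F w)\<^bsup>s - 1\<^esup>\<close>; the maximal function is bounded on the dual
  exponent, so that a multiple of the left-hand side appears on the right and can be absorbed. This
  is where the finiteness of \<open>F\<close> matters.
\<close>

lemma rsum_duality:
  assumes "1 \<le> s"
  obtains C :: real where "0 < C"
    "\<And>F w K. finite F \<Longrightarrow> (\<And>R. R \<in> F \<Longrightarrow> 0 \<le> w R) \<Longrightarrow> K \<in> borel_measurable borel \<Longrightarrow>
      (\<And>h. h \<in> borel_measurable borel \<Longrightarrow>
        (\<Sum>R\<in>F. ennreal (w R) * ravg h R) \<le> (\<integral>\<^sup>+x. K x * smax h x \<partial>lborel)) \<Longrightarrow>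
      rint F w s \<le> ennreal C * pint s K"
proof (cases "s = 1")
  case True
  show ?thesis
  proof (rule that[of 1])
    fix F w and K :: "real \<times> real \<Rightarrow> ennreal"
    assume F: "finite F" and w: "\<And>R. R \<in> F \<Longrightarrow> 0 \<le> w R" and [measurable]: "K \<in> borel_measurable borel"
      and *: "\<And>h. h \<in> borel_measurable borel \<Longrightarrow>
        (\<Sum>R\<in>F. ennreal (w R) * ravg h R) \<le> (\<integral>\<^sup>+x. K x * smax h x \<partial>lborel)"
    \<comment> \<open>For \<open>s = 1\<close> the dual exponent is infinite, and the constant 1 is
      the test function.\<close>
    have "rint F w s = (\<integral>\<^sup>+x. ennreal (rsum F w x) * 1 \<partial>lborel)"
      using True w by (simp add: rsum_nonneg)
    also have "\<dots> = (\<Sum>R\<in>F. ennreal (w R) * ((\<integral>\<^sup>+x\<in>rect R. 1 \<partial>lborel) / ennreal (rect_measure R)))"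
      using w by (intro nn_integral_rsum_mult) auto
    also have "\<dots> \<le> (\<integral>\<^sup>+x. K x * smax (\<lambda>_. 1) x \<partial>lborel)"
      by (rule *) simp
    also have "\<dots> \<le> (\<integral>\<^sup>+x. K x * 1 \<partial>lborel)"
      by (intro nn_integral_mono mult_left_mono smax_one_le) auto
    finally show "rint F w s \<le> ennreal 1 * pint s K"
      using True by simp
  qed simp
next
  case False
  with assms have s: "1 < s" by simp
  \<comment> \<open>The dual exponent; \<open>(s - 1) * s' = s\<close> turns the norm of the test
    function back into the left-hand side.\<close>
  define s' where "s' = s / (s - 1)"
  have s': "1 < s'" "1 / s + 1 / s' = 1" "(s - 1) * s' = s"
    using s by (auto simp: s'_def field_simps)
  define D where "D = (2 powr s' * s' / (s' - 1))\<^sup>2"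
  have D: "0 < D" using s'(1) by (auto simp: D_def)
  \<comment> \<open>The weight in Young's inequality, chosen so that \<open>\<eta> powr s'\<close>
    times the maximal constant \<open>D\<close> is 1/2.\<close>
  define \<eta> where "\<eta> = (1 / (2 * D)) powr (1 / s')"
  have \<eta>: "0 < \<eta>" "\<eta> powr s' = 1 / (2 * D)"
    using D s'(1) by (auto simp: \<eta>_def powr_powr)
  show ?thesis
  proof (rule that[of "2 * (1 / \<eta>) powr s"])
    fix F w and K :: "real \<times> real \<Rightarrow> ennreal"
    assume F: "finite F" and w: "\<And>R. R \<in> F \<Longrightarrow> 0 \<le> w R" and [measurable]: "K \<in> borel_measurable borel"
      and *: "\<And>h. h \<in> borel_measurable borel \<Longrightarrow>
        (\<Sum>R\<in>F. ennreal (w R) * ravg h R) \<le> (\<integral>\<^sup>+x. K x * smax h x \<partial>lborel)"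
    define h where "h x = ennreal (rsum F w x powr (s - 1))" for x
    have [measurable]: "h \<in> borel_measurable borel" unfolding h_def by measurable
    let ?A = "rint F w s"
    have nn: "0 \<le> rsum F w x" for x using w by (rule rsum_nonneg)
    have "?A = (\<integral>\<^sup>+x. ennreal (rsum F w x) * h x \<partial>lborel)"
    proof (intro nn_integral_cong)
      fix x
      have "rsum F w x powr s = rsum F w x * rsum F w x powr (s - 1)"
        using nn[of x] s powr_add[of "rsum F w x" 1 "s - 1"] by (cases "rsum F w x = 0") auto
      then show "ennreal (rsum F w x powr s) = ennreal (rsum F w x) * h x"
        unfolding h_def by (simp add: ennreal_mult nn)
    qed
    also have "\<dots> \<le> (\<integral>\<^sup>+x. K x * smax h x \<partial>lborel)"
      using w by (subst nn_integral_rsum_mult) (auto intro!: *)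
    also have "\<dots> \<le> (\<integral>\<^sup>+x. ennreal ((1 / \<eta>) powr s) * epowr (K x) s + ennreal (\<eta> powr s') * epowr (smax h x) s' \<partial>lborel)"
    proof (intro nn_integral_mono)
      fix x
      have "ennreal (1 / \<eta>) * ennreal \<eta> = 1" using \<eta> by (simp flip: ennreal_mult)
      then have "K x * smax h x = (ennreal (1 / \<eta>) * ennreal \<eta>) * (K x * smax h x)"
        by simp
      also have "\<dots> = (ennreal (1 / \<eta>) * K x) * (ennreal \<eta> * smax h x)"
        by (simp only: ac_simps)
      also have "\<dots> \<le> epowr (ennreal (1 / \<eta>) * K x) s + epowr (ennreal \<eta> * smax h x) s'"
        using s s' by (intro epowr_young) auto
      finally show "K x * smax h x \<le> ennreal ((1 / \<eta>) powr s) * epowr (K x) s + ennreal (\<eta> powr s') * epowr (smax h x) s'"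
        using \<eta>(1) by (simp add: epowr_mult epowr_ennreal)
    qed
    also have "\<dots> = ennreal ((1 / \<eta>) powr s) * pint s K + ennreal (\<eta> powr s') * pint s' (smax h)"
      by (simp add: nn_integral_add nn_integral_cmult)
    also have "\<dots> \<le> ennreal ((1 / \<eta>) powr s) * pint s K + ennreal (\<eta> powr s') * (ennreal D * pint s' h)"
      unfolding D_def using s' by (intro add_left_mono mult_left_mono smax_strong_type) auto
    also have "pint s' h = ?A"
      unfolding h_def using s'(3) by (simp add: epowr_ennreal powr_powr)
    also have "ennreal (\<eta> powr s') * (ennreal D * ?A) = ennreal (1 / 2) * ?A"
      using D by (simp add: \<eta>(2) mult.assoc[symmetric] flip: ennreal_mult)
    finally have "?A \<le> 2 * (ennreal ((1 / \<eta>) powr s) * pint s K)"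
      using F w s by (intro ennreal_absorb_half rsum_powr_finite) auto
    then show "?A \<le> ennreal (2 * (1 / \<eta>) powr s) * pint s K"
      by (simp add: ennreal_mult mult.assoc)
  qed (use \<eta> in simp)
qed

section \<open>The signed maximal function\<close>

lemma max_d_measurable [measurable]: "max_d f \<in> borel_measurable borel"
  unfolding max_d_def SUP_indicator_mult by measurable

lemma abs_avg_le: "ennreal \<bar>avg f R\<bar> \<le> (\<integral>\<^sup>+y\<in>rect R. ennreal \<bar>f y\<bar> \<partial>lborel) / ennreal (rect_measure R)"
proof -
  have "ennreal \<bar>LINT x:rect R|lborel. f x\<bar> \<le> (\<integral>\<^sup>+y\<in>rect R. ennreal \<bar>f y\<bar> \<partial>lborel)"
  proof (cases "set_integrable lborel (rect R) f")
    case True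
    then have "ennreal (norm (LINT x|lborel. indicator (rect R) x *\<^sub>R f x)) \<le> (\<integral>\<^sup>+x. ennreal (norm (indicator (rect R) x *\<^sub>R f x)) \<partial>lborel)"
      unfolding set_integrable_def by (rule integral_norm_bound_ennreal)
    also have "\<dots> = (\<integral>\<^sup>+y\<in>rect R. ennreal \<bar>f y\<bar> \<partial>lborel)"
      by (intro nn_integral_cong) (auto simp: indicator_def)
    finally show ?thesis by (simp add: set_lebesgue_integral_def)
  next
    \<comment> \<open>A non-integrable function has Bochner integral 0 by default, hence average
      0.\<close>
    case False
    then show ?thesis
      by (simp add: set_lebesgue_integral_def set_integrable_def not_integrable_integral_eq)
  qed
  then have "ennreal \<bar>LINT x:rect R|lborel. f x\<bar> / ennreal (rect_measure R) \<le> (\<integral>\<^sup>+y\<in>rect R. ennreal \<bar>f y\<bar> \<partial>lborel) / ennreal (rect_measure R)"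
    by (rule divide_right_mono_ennreal)
  then show ?thesis by (simp add: avg_def divide_ennreal)
qed

lemma max_d_le_smax: "max_d f x \<le> smax (\<lambda>y. ennreal \<bar>f y\<bar>) x"
  unfolding max_d_def smax_def by (intro SUP_mono' abs_avg_le)

lemma abs_avg_le_max_d: "x \<in> rect R \<Longrightarrow> ennreal \<bar>avg f R\<bar> \<le> max_d f x"
  unfolding max_d_def by (rule SUP_upper) auto

section \<open>Upper bounds\<close>

lemma infsum_ennreal_SUP:
  fixes f :: "'i \<Rightarrow> ennreal"
  shows "infsum f A = (SUP F\<in>{F. finite F \<and> F \<subseteq> A}. sum f F)"
  by (rule nonneg_infsum_complete) simp

lemma sum_ennreal_rsum:
  assumes "\<And>R. R \<in> F \<Longrightarrow> 0 \<le> w R"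
  shows "(\<Sum>R\<in>F. ennreal (w R * indicator (rect R) x / rect_measure R)) = ennreal (rsum F w x)"
  unfolding rsum_def using assms by (intro sum_ennreal) (simp add: less_imp_le)

lemma sq_fun_powr:
  assumes "0 < q"
  shows "epowr (sq_fun f x) q = (SUP F\<in>{F. finite F}. ennreal (rsum F (\<lambda>R. (f R)\<^sup>2) x powr (q / 2)))"
proof -
  have "epowr (sq_fun f x) q = epowr (SUP F\<in>{F. finite F}. ennreal (rsum F (\<lambda>R. (f R)\<^sup>2) x)) (q / 2)"
    using sum_ennreal_rsum[of _ "\<lambda>R. (f R)\<^sup>2" x] by (simp add: sq_fun_def epowr_epowr infsum_ennreal_SUP)
  also have "\<dots> = (SUP F\<in>{F. finite F}. ennreal (rsum F (\<lambda>R. (f R)\<^sup>2) x powr (q / 2)))"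
    using assms by (subst epowr_SUP) (auto simp: epowr_ennreal rsum_nonneg)
  finally show ?thesis .
qed

lemma nn_integral_sq_fun_ge:
  assumes "0 < q" "finite F"
  shows "rint F (\<lambda>R. (f R)\<^sup>2) (q / 2) \<le> pint q (sq_fun f)"
  unfolding sq_fun_powr[OF assms(1)] using assms(2) by (intro nn_integral_mono SUP_upper) auto

text \<open>The square function is a supremum over all finite families, while monotone convergence
  needs an increasing sequence; the initial segments \<open>G n\<close> of an enumeration are
  cofinal.\<close>

lemma nn_integral_sq_fun_le:
  assumes q: "0 < q" and le: "\<And>F. finite F \<Longrightarrow> rint F (\<lambda>R. (f R)\<^sup>2) (q / 2) \<le> B"
  shows "pint q (sq_fun f) \<le> B"
proof -
  define G where "G n = {R :: drect. to_nat R < n}" for n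
  have fin: "finite (G n)" for n
    unfolding G_def by (rule finite_subset[OF _ finite_vimageI[OF finite_lessThan[of n] inj_to_nat]]) auto
  have mono: "rsum F (\<lambda>R. (f R)\<^sup>2) x powr (q / 2) \<le> rsum F' (\<lambda>R. (f R)\<^sup>2) x powr (q / 2)"
    if "finite F'" "F \<subseteq> F'" for F F' x
    using that q by (intro powr_mono2 rsum_nonneg rsum_mono) auto
  have "epowr (sq_fun f x) q = (SUP n. ennreal (rsum (G n) (\<lambda>R. (f R)\<^sup>2) x powr (q / 2)))" for x
    unfolding sq_fun_powr[OF q]
  proof (rule antisym)
    show "(SUP F\<in>{F. finite F}. ennreal (rsum F (\<lambda>R. (f R)\<^sup>2) x powr (q / 2)))
      \<le> (SUP n. ennreal (rsum (G n) (\<lambda>R. (f R)\<^sup>2) x powr (q / 2)))"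
    proof (rule SUP_least)
      fix F :: "drect set" assume "F \<in> {F. finite F}"
      then obtain n where "\<forall>R\<in>F. to_nat R < n"
        using finite_nat_set_iff_bounded[of "to_nat ` F"] by auto
      then have "F \<subseteq> G n" by (auto simp: G_def)
      then show "ennreal (rsum F (\<lambda>R. (f R)\<^sup>2) x powr (q / 2)) \<le> (SUP n. ennreal (rsum (G n) (\<lambda>R. (f R)\<^sup>2) x powr (q / 2)))"
        by (intro SUP_upper2[of n] ennreal_leI mono fin) auto
    qed
    show "(SUP n. ennreal (rsum (G n) (\<lambda>R. (f R)\<^sup>2) x powr (q / 2)))
      \<le> (SUP F\<in>{F. finite F}. ennreal (rsum F (\<lambda>R. (f R)\<^sup>2) x powr (q / 2)))"
      by (intro SUP_least SUP_upper2[of "G _"]) (auto simp: fin)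
  qed
  then have "pint q (sq_fun f) = (\<integral>\<^sup>+x. (SUP n. ennreal (rsum (G n) (\<lambda>R. (f R)\<^sup>2) x powr (q / 2))) \<partial>lborel)"
    by simp
  also have "\<dots> = (SUP n. \<integral>\<^sup>+x. ennreal (rsum (G n) (\<lambda>R. (f R)\<^sup>2) x powr (q / 2)) \<partial>lborel)"
  proof (rule nn_integral_monotone_convergence_SUP)
    show "incseq (\<lambda>n x. ennreal (rsum (G n) (\<lambda>R. (f R)\<^sup>2) x powr (q / 2)))"
      by (intro incseq_SucI le_funI ennreal_leI mono fin) (auto simp: G_def)
  qed measurable
  also have "\<dots> \<le> B" by (intro SUP_least le fin)
  finally show ?thesis .
qed

lemma sq_fun_measurable [measurable]: "sq_fun f \<in> borel_measurable borel"
proof -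
  have "sq_fun f = (\<lambda>x. SUP F\<in>{F. finite F}. ennreal (rsum F (\<lambda>R. (f R)\<^sup>2) x powr (1 / 2)))"
    using sq_fun_powr[of 1 f] by auto
  moreover have "countable {F :: drect set. finite F}" by (rule countable_Collect_finite)
  ultimately show ?thesis by simp
qed

lemma Hp_norm_le_1_iff: "0 < p \<Longrightarrow> Hp_norm p f \<le> 1 \<longleftrightarrow> pint p (max_d f) \<le> 1"
  by (simp add: Hp_norm_def Lp_enorm_def epowr_le_iff)

lemma Hdot_norm_le_iff: "0 < q \<Longrightarrow> Hdot_norm q f \<le> B \<longleftrightarrow> pint q (sq_fun f) \<le> epowr B q"
  by (simp add: Hdot_norm_def Lp_enorm_def epowr_le_iff)

lemma sq_fun_paraprod_le: "sq_fun (paraprod g f) x \<le> max_d f x * sq_fun g x"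
proof -
  have *: "sq_fun h x \<le> B \<longleftrightarrow> (\<Sum>\<^sub>\<infinity>R\<in>UNIV. ennreal ((h R)\<^sup>2 * indicator (rect R) x / rect_measure R)) \<le> epowr B 2" for h B
    by (simp add: sq_fun_def epowr_le_iff)
  have sq: "epowr (sq_fun g x) 2 = (\<Sum>\<^sub>\<infinity>R\<in>UNIV. ennreal ((g R)\<^sup>2 * indicator (rect R) x / rect_measure R))"
    by (simp add: sq_fun_def epowr_epowr)
  show ?thesis
    unfolding * epowr_mult sq infsum_ennreal_SUP[of "\<lambda>R. ennreal ((paraprod g f R)\<^sup>2 * indicator (rect R) x / rect_measure R)"]
  proof (rule SUP_least)
    fix F :: "drect set" assume "F \<in> {F. finite F \<and> F \<subseteq> UNIV}"
    then have F: "finite F" by simp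
    have "(\<Sum>R\<in>F. ennreal ((paraprod g f R)\<^sup>2 * indicator (rect R) x / rect_measure R))
       \<le> (\<Sum>R\<in>F. epowr (max_d f x) 2 * ennreal ((g R)\<^sup>2 * indicator (rect R) x / rect_measure R))"
    proof (rule sum_mono)
      fix R assume "R \<in> F"
      show "ennreal ((paraprod g f R)\<^sup>2 * indicator (rect R) x / rect_measure R)
        \<le> epowr (max_d f x) 2 * ennreal ((g R)\<^sup>2 * indicator (rect R) x / rect_measure R)"
      proof (cases "x \<in> rect R")
        case True
        have "(paraprod g f R)\<^sup>2 * indicator (rect R) x / rect_measure R = (avg f R)\<^sup>2 * ((g R)\<^sup>2 * indicator (rect R) x / rect_measure R)"
          by (simp add: paraprod_def power_mult_distrib)
        then have "ennreal ((paraprod g f R)\<^sup>2 * indicator (rect R) x / rect_measure R)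
          = ennreal ((avg f R)\<^sup>2) * ennreal ((g R)\<^sup>2 * indicator (rect R) x / rect_measure R)"
          by (simp only:) (rule ennreal_mult', simp)
        also have "ennreal ((avg f R)\<^sup>2) = epowr (ennreal \<bar>avg f R\<bar>) 2"
          by (simp add: epowr_ennreal)
        also have "\<dots> \<le> epowr (max_d f x) 2" using True by (intro epowr_mono abs_avg_le_max_d) auto
        finally show ?thesis by (simp add: mult_right_mono)
      qed simp
    qed
    also have "\<dots> \<le> epowr (max_d f x) 2 * (\<Sum>\<^sub>\<infinity>R\<in>UNIV. ennreal ((g R)\<^sup>2 * indicator (rect R) x / rect_measure R))"
      unfolding sum_distrib_left[symmetric] infsum_ennreal_SUP using F by (intro mult_left_mono SUP_upper) auto
    finally show "(\<Sum>R\<in>F. ennreal ((paraprod g f R)\<^sup>2 * indicator (rect R) x / rect_measure R))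
      \<le> epowr (max_d f x) 2 * (\<Sum>\<^sub>\<infinity>R\<in>UNIV. ennreal ((g R)\<^sup>2 * indicator (rect R) x / rect_measure R))" .
  qed
qed

lemma paraprod_opnorm_le_Hdot:
  assumes "0 < p" "0 < q" "0 < r" and pqr: "1 / q = 1 / p + 1 / r"
  shows "paraprod_opnorm p q g \<le> ennreal (2 powr (1 / q)) * Hdot_norm r g"
  unfolding paraprod_opnorm_def
proof (rule SUP_least)
  fix f assume "f \<in> {f. locally_integrable f \<and> Hp_norm p f \<le> 1}"
  then have M: "pint p (max_d f) \<le> 1"
    using Hp_norm_le_1_iff[OF assms(1)] by simp
  define G where "G = pint r (sq_fun g)"
  have H: "Hdot_norm r g = epowr G (1 / r)" by (simp add: Hdot_norm_def Lp_enorm_def G_def)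
  have rhs: "epowr (ennreal (2 powr (1 / q)) * Hdot_norm r g) q = 2 * epowr G (q / r)"
    using assms(2) by (simp add: H epowr_mult epowr_ennreal epowr_epowr powr_powr)
  have "pint q (sq_fun (paraprod g f)) \<le> (\<integral>\<^sup>+x. epowr (max_d f x) q * epowr (sq_fun g x) q \<partial>lborel)"
    unfolding epowr_mult[symmetric] using assms by (intro nn_integral_mono epowr_mono sq_fun_paraprod_le) auto
  also have "\<dots> \<le> 2 * epowr G (q / r)"
  proof (cases G)
    case top
    then show ?thesis by (simp add: ennreal_mult_top)
  next
    case (real b)
    show ?thesis
    proof (cases "b = 0")
      \<comment> \<open>Here \<open>sq_fun g\<close> vanishes almost everywhere, and
        \<open>0 * top = 0\<close> settles the points where \<open>max_d f\<close> is
        infinite.\<close>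
      case True
      then have "AE x in lborel. epowr (sq_fun g x) r = 0"
        using real by (auto simp: G_def nn_integral_0_iff_AE)
      then have "(\<integral>\<^sup>+x. epowr (max_d f x) q * epowr (sq_fun g x) q \<partial>lborel) = (\<integral>\<^sup>+x. 0 \<partial>(lborel :: (real \<times> real) measure))"
        by (intro nn_integral_cong_AE) auto
      then show ?thesis by simp
    next
      case False
      with real have b: "0 < b" by simp
      \<comment> \<open>The \<open>r\<close>-norm of the square function. After normalization by it
        both terms of Young's inequality have integral at most 1, whence the factor 2.\<close>
      let ?l = "b powr (1 / r)"
      have ll: "ennreal (?l powr q) * ennreal ((1 / ?l) powr q) = 1"
        using b by (simp add: powr_divide flip: ennreal_mult)
      have "(\<integral>\<^sup>+x. epowr (max_d f x) q * epowr (sq_fun g x) q \<partial>lborel)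
        \<le> (\<integral>\<^sup>+x. ennreal (?l powr q) * (epowr (max_d f x) p + ennreal (1 / b) * epowr (sq_fun g x) r) \<partial>lborel)"
      proof (intro nn_integral_mono)
        fix x
        have "epowr (max_d f x) q * epowr (sq_fun g x) q = (ennreal (?l powr q) * ennreal ((1 / ?l) powr q)) * (epowr (max_d f x) q * epowr (sq_fun g x) q)"
          unfolding ll by simp
        also have "\<dots> = ennreal (?l powr q) * (epowr (max_d f x) q * epowr (ennreal (1 / ?l) * sq_fun g x) q)"
          by (simp add: epowr_mult epowr_ennreal ac_simps)
        also have "\<dots> \<le> ennreal (?l powr q) * (epowr (epowr (max_d f x) q) (p / q) + epowr (epowr (ennreal (1 / ?l) * sq_fun g x) q) (r / q))"
          using assms by (intro mult_left_mono epowr_young) (auto simp: field_simps)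
        also have "\<dots> = ennreal (?l powr q) * (epowr (max_d f x) p + ennreal (1 / b) * epowr (sq_fun g x) r)"
          using assms b by (simp add: epowr_epowr epowr_mult epowr_ennreal powr_divide powr_powr)
        finally show "epowr (max_d f x) q * epowr (sq_fun g x) q \<le> ennreal (?l powr q) * (epowr (max_d f x) p + ennreal (1 / b) * epowr (sq_fun g x) r)" .
      qed
      also have "\<dots> = ennreal (?l powr q) * (pint p (max_d f) + ennreal (1 / b) * G)"
        unfolding G_def by (simp add: nn_integral_cmult nn_integral_add)
      also have "\<dots> \<le> ennreal (?l powr q) * (1 + 1)"
        using b real by (intro mult_left_mono add_mono M) (auto simp flip: ennreal_mult)
      also have "\<dots> = 2 * epowr G (q / r)"
        using b real by (simp add: epowr_ennreal powr_powr mult.commute)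
      finally show ?thesis .
    qed
  qed
  finally show "Hdot_norm q (paraprod g f) \<le> ennreal (2 powr (1 / q)) * Hdot_norm r g"
    unfolding Hdot_norm_le_iff[OF assms(2)] rhs .
qed

text \<open>A finite union of half-open rectangles need not be open, whereas the supremum in
  \<open>BMO_norm\<close> runs over open sets; outer regularity supplies open supersets of almost
  the same measure.\<close>

lemma BMO_packing:
  assumes F: "finite F"
  shows "ennreal (\<Sum>R\<in>F. (g R)\<^sup>2) \<le> epowr (BMO_norm g) 2 * emeasure lborel (\<Union>R\<in>F. rect R)"
proof (cases "F = {}")
  case False
  let ?U = "\<Union>R\<in>F. rect R" and ?N = "epowr (BMO_norm g) 2"
  have [measurable]: "?U \<in> sets borel" using F by (intro sets.finite_UN) auto
  obtain R0 where "R0 \<in> F" using False by auto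
  have "0 < emeasure lborel (rect R0)" by (simp add: emeasure_rect)
  also have "\<dots> \<le> emeasure lborel ?U" using \<open>R0 \<in> F\<close> by (intro emeasure_mono) auto
  finally have pos: "0 < emeasure lborel ?U" .
  show ?thesis
  proof (cases ?N)
    case top
    then show ?thesis using pos by (simp add: ennreal_top_mult)
  next
    case (real n)
    show ?thesis
    proof (rule ennreal_le_epsilon)
      fix e :: real assume e: "0 < e"
      \<comment> \<open>The denominator \<open>n + 1\<close> is positive even if the norm is 0, and
        \<open>n * ?e \<le> e\<close>.\<close>
      let ?e = "e / (n + 1)"
      have "0 < ?e" using e real by simp
      then obtain \<Omega> where O: "open \<Omega>" "?U \<subseteq> \<Omega>" and small: "emeasure lborel (\<Omega> - ?U) < ennreal ?e"
        using outer_regular_lborel[of ?U ?e] by auto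
      have [measurable]: "\<Omega> \<in> sets borel" using O by simp
      have "emeasure lborel \<Omega> = emeasure lborel (?U \<union> (\<Omega> - ?U))" using O(2) by (simp add: Un_absorb1)
      also have "\<dots> \<le> emeasure lborel ?U + emeasure lborel (\<Omega> - ?U)"
        by (rule emeasure_subadditive) auto
      also have "\<dots> \<le> emeasure lborel ?U + ennreal ?e" using small by (intro add_left_mono) auto
      finally have meas: "emeasure lborel \<Omega> \<le> emeasure lborel ?U + ennreal ?e" .
      then have fin: "emeasure lborel \<Omega> < \<infinity>"
        by (rule le_less_trans) (use emeasure_Union_rect_finite[OF F] in \<open>simp add: less_top\<close>)
      have pos': "0 < emeasure lborel \<Omega>"
        using pos by (rule less_le_trans) (use O(2) in \<open>auto intro: emeasure_mono\<close>)
      let ?S = "\<Sum>\<^sub>\<infinity>R\<in>{R. rect R \<subseteq> \<Omega>}. ennreal ((g R)\<^sup>2)"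
      have "epowr (?S / emeasure lborel \<Omega>) (1/2) \<le> BMO_norm g"
        unfolding BMO_norm_def using O(1) fin pos' by (intro SUP_upper) auto
      then have div: "?S / emeasure lborel \<Omega> \<le> ?N" by (simp add: epowr_le_iff)
      obtain o' where o': "emeasure lborel \<Omega> = ennreal o'" "0 < o'"
        using fin pos' by (cases "emeasure lborel \<Omega>") auto
      have "ennreal (\<Sum>R\<in>F. (g R)\<^sup>2) = (\<Sum>R\<in>F. ennreal ((g R)\<^sup>2))" by simp
      also have "\<dots> \<le> ?S"
        unfolding infsum_ennreal_SUP using F O(2) by (intro SUP_upper) auto
      also have "\<dots> \<le> ?N * emeasure lborel \<Omega>"
        using div o' by (simp add: divide_le_ennreal_iff)
      also have "\<dots> \<le> ?N * (emeasure lborel ?U + ennreal ?e)" by (intro mult_left_mono meas) simp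
      also have "\<dots> = ?N * emeasure lborel ?U + ennreal (n * ?e)"
      proof -
        have "ennreal n * ennreal ?e = ennreal (n * ?e)" using real e by (intro ennreal_mult[symmetric]) auto
        then show ?thesis using real by (simp only: distrib_left)
      qed
      also have "\<dots> \<le> ?N * emeasure lborel ?U + ennreal e"
        using real e by (intro add_left_mono ennreal_leI) (simp add: field_simps)
      finally show "ennreal (\<Sum>R\<in>F. (g R)\<^sup>2) \<le> ?N * emeasure lborel ?U + ennreal e" .
    qed
  qed
qed simp

lemma BMO_norm_le:
  assumes "0 \<le> B" "\<And>F. finite F \<Longrightarrow> ennreal (\<Sum>R\<in>F. (g R)\<^sup>2) \<le> ennreal (B\<^sup>2) * emeasure lborel (\<Union>R\<in>F. rect R)"
  shows "BMO_norm g \<le> ennreal B"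
  unfolding BMO_norm_def
proof (rule SUP_least)
  fix \<Omega> :: "(real \<times> real) set"
  assume "\<Omega> \<in> {\<Omega>. open \<Omega> \<and> 0 < emeasure lborel \<Omega> \<and> emeasure lborel \<Omega> < \<infinity>}"
  then have O: "open \<Omega>" "0 < emeasure lborel \<Omega>" "emeasure lborel \<Omega> < \<infinity>" by auto
  then obtain o' where o': "emeasure lborel \<Omega> = ennreal o'" "0 < o'"
    by (cases "emeasure lborel \<Omega>") auto
  have "(\<Sum>\<^sub>\<infinity>R\<in>{R. rect R \<subseteq> \<Omega>}. ennreal ((g R)\<^sup>2)) \<le> ennreal (B\<^sup>2) * emeasure lborel \<Omega>"
    unfolding infsum_ennreal_SUP
  proof (rule SUP_least)
    fix F assume "F \<in> {F. finite F \<and> F \<subseteq> {R. rect R \<subseteq> \<Omega>}}"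
    then have F: "finite F" "(\<Union>R\<in>F. rect R) \<subseteq> \<Omega>" by auto
    have "(\<Sum>R\<in>F. ennreal ((g R)\<^sup>2)) \<le> ennreal (B\<^sup>2) * emeasure lborel (\<Union>R\<in>F. rect R)"
      using assms(2)[OF F(1)] by simp
    also have "\<dots> \<le> ennreal (B\<^sup>2) * emeasure lborel \<Omega>"
      using F(2) O(1) by (intro mult_left_mono emeasure_mono) auto
    finally show "(\<Sum>R\<in>F. ennreal ((g R)\<^sup>2)) \<le> ennreal (B\<^sup>2) * emeasure lborel \<Omega>" .
  qed
  then show "epowr ((\<Sum>\<^sub>\<infinity>R\<in>{R. rect R \<subseteq> \<Omega>}. ennreal ((g R)\<^sup>2)) / emeasure lborel \<Omega>) (1/2) \<le> ennreal B"
    using o' assms(1) by (simp add: epowr_le_iff divide_le_ennreal_iff epowr_ennreal)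
qed


text \<open>
  For \<open>p \<ge> 2\<close> this is duality. For \<open>p < 2\<close> the square function \<open>H\<close> of the family is interpolated:
  \<open>H m\<^bsup>p - 2\<^esup>\<close> is controlled by the packing condition because \<open>\<bar>a R\<bar> \<le> m\<close> on \<open>R\<close>, and
  \<open>H\<^bsup>p/2\<^esup> = (H m\<^bsup>p - 2\<^esup>)\<^bsup>p/2\<^esup> (m\<^sup>p)\<^bsup>1 - p/2\<^esup>\<close>.
\<close>

lemma carleson_powr:
  assumes "0 < p"
  obtains C :: real where "0 < C"
    "\<And>F w K a m. finite F \<Longrightarrow> (\<And>R. R \<in> F \<Longrightarrow> 0 \<le> w R) \<Longrightarrow> 0 < K \<Longrightarrow>
      (\<And>F'. F' \<subseteq> F \<Longrightarrow> ennreal (\<Sum>R\<in>F'. w R) \<le> ennreal K * emeasure lborel (\<Union>R\<in>F'. rect R)) \<Longrightarrow>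
      m \<in> borel_measurable borel \<Longrightarrow> (\<And>R x. R \<in> F \<Longrightarrow> x \<in> rect R \<Longrightarrow> ennreal \<bar>a R\<bar> \<le> m x) \<Longrightarrow>
      rint F (\<lambda>R. w R * (a R)\<^sup>2) (p / 2) \<le> ennreal (C * K powr (p / 2)) * pint p m"
proof (cases "2 \<le> p")
  case True
  then have "1 \<le> p / 2" by simp
  then obtain C :: real where C: "0 < C" and dual: "\<And>F w K. finite F \<Longrightarrow> (\<And>R. R \<in> F \<Longrightarrow> 0 \<le> w R) \<Longrightarrow> K \<in> borel_measurable borel \<Longrightarrow>
      (\<And>h. h \<in> borel_measurable borel \<Longrightarrow>
        (\<Sum>R\<in>F. ennreal (w R) * ravg h R) \<le> (\<integral>\<^sup>+x. K x * smax h x \<partial>lborel)) \<Longrightarrow>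
      rint F w (p / 2) \<le> ennreal C * pint (p / 2) K"
    using rsum_duality[of "p / 2"] by blast
  show ?thesis
  proof (rule that[OF C])
    fix F :: "drect set" and w a :: "drect \<Rightarrow> real" and K :: real and m :: "real \<times> real \<Rightarrow> ennreal"
    assume F: "finite F" and w: "\<And>R. R \<in> F \<Longrightarrow> 0 \<le> w R" and K: "0 < K"
      and packing: "\<And>F'. F' \<subseteq> F \<Longrightarrow> ennreal (\<Sum>R\<in>F'. w R) \<le> ennreal K * emeasure lborel (\<Union>R\<in>F'. rect R)"
      and [measurable]: "m \<in> borel_measurable borel" and m: "\<And>R x. R \<in> F \<Longrightarrow> x \<in> rect R \<Longrightarrow> ennreal \<bar>a R\<bar> \<le> m x"
    \<comment> \<open>The hypothesis of the duality lemma is Carleson's embedding with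
      \<open>epowr (m x) 2 * smax h x\<close> as the majorant.\<close>
    have "rint F (\<lambda>R. w R * (a R)\<^sup>2) (p / 2)
      \<le> ennreal C * (\<integral>\<^sup>+x. epowr (ennreal K * epowr (m x) 2) (p / 2) \<partial>lborel)"
    proof (rule dual[OF F])
      fix h :: "real \<times> real \<Rightarrow> ennreal" assume [measurable]: "h \<in> borel_measurable borel"
      have "(\<Sum>R\<in>F. ennreal (w R * (a R)\<^sup>2) * ravg h R)
         = (\<Sum>R\<in>F. ennreal (w R) * (epowr (ennreal \<bar>a R\<bar>) 2 * ravg h R))"
        using w by (intro sum.cong refl) (simp add: ennreal_mult epowr_ennreal mult.assoc)
      also have "\<dots> \<le> ennreal K * (\<integral>\<^sup>+x. epowr (m x) 2 * smax h x \<partial>lborel)"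
        using w packing m by (intro carleson_embedding F mult_mono epowr_mono avg_le_smax) auto
      also have "\<dots> = (\<integral>\<^sup>+x. ennreal K * epowr (m x) 2 * smax h x \<partial>lborel)"
        by (subst nn_integral_cmult[symmetric]) (auto simp: mult.assoc)
      finally show "(\<Sum>R\<in>F. ennreal (w R * (a R)\<^sup>2) * ravg h R)
        \<le> (\<integral>\<^sup>+x. ennreal K * epowr (m x) 2 * smax h x \<partial>lborel)" .
    qed (use w in auto)
    also have "\<dots> = ennreal (C * K powr (p / 2)) * pint p m"
      using C K by (simp add: epowr_mult epowr_epowr epowr_ennreal nn_integral_cmult ennreal_mult mult.assoc)
    finally show "rint F (\<lambda>R. w R * (a R)\<^sup>2) (p / 2) \<le> \<dots>" .
  qed
next
  case False
  with assms have p: "0 < p" "p < 2" by auto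
  show ?thesis
  proof (rule that[of 2])
    fix F :: "drect set" and w a :: "drect \<Rightarrow> real" and K :: real and m :: "real \<times> real \<Rightarrow> ennreal"
    assume F: "finite F" and w: "\<And>R. R \<in> F \<Longrightarrow> 0 \<le> w R" and K: "0 < K"
      and packing: "\<And>F'. F' \<subseteq> F \<Longrightarrow> ennreal (\<Sum>R\<in>F'. w R) \<le> ennreal K * emeasure lborel (\<Union>R\<in>F'. rect R)"
      and [measurable]: "m \<in> borel_measurable borel" and m: "\<And>R x. R \<in> F \<Longrightarrow> x \<in> rect R \<Longrightarrow> ennreal \<bar>a R\<bar> \<le> m x"
    \<comment> \<open>The exponent \<open>p\<close> is the one for which Carleson's embedding bounds
      the integral of \<open>Q\<close> by that of the \<open>p\<close>-th power of
      \<open>m\<close>.\<close>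
    define Q where "Q = rsum F (\<lambda>R. w R * \<bar>a R\<bar> powr p)"
    have [measurable]: "Q \<in> borel_measurable borel" unfolding Q_def by measurable
    have Q0: "0 \<le> Q x" for x unfolding Q_def using w by (intro rsum_nonneg) auto
    have H0: "0 \<le> rsum F (\<lambda>R. w R * (a R)\<^sup>2) x" for x using w by (intro rsum_nonneg) auto
    have "(\<integral>\<^sup>+x. ennreal (Q x) \<partial>lborel) = (\<Sum>R\<in>F. ennreal (w R) * epowr (ennreal \<bar>a R\<bar>) p)"
      unfolding Q_def using w by (subst nn_integral_rsum) (auto simp: epowr_ennreal ennreal_mult simp flip: sum_ennreal)
    also have "\<dots> \<le> ennreal K * pint p m"
      using w packing m p by (intro carleson_embedding F epowr_mono) auto
    finally have Q: "(\<integral>\<^sup>+x. ennreal (Q x) \<partial>lborel) \<le> ennreal K * pint p m" .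
    \<comment> \<open>A neutral factor, inserted so that Young's inequality is applied to a quantity
      homogeneous in \<open>K\<close>; the factor \<open>K powr (p / 2)\<close> stays in
      front.\<close>
    have K1: "ennreal (K powr (p / 2)) * epowr (ennreal (1 / K)) (p / 2) = 1"
      using K by (simp add: epowr_ennreal powr_divide flip: ennreal_mult)
    have pointwise: "ennreal (rsum F (\<lambda>R. w R * (a R)\<^sup>2) x powr (p / 2)) \<le> ennreal (K powr (p / 2)) * (epowr (m x) p + ennreal (1 / K) * ennreal (Q x))" for x
    proof -
      have "ennreal (rsum F (\<lambda>R. w R * (a R)\<^sup>2) x) = (\<Sum>R\<in>F. ennreal (w R * (a R)\<^sup>2 * indicator (rect R) x / rect_measure R))"
        using w by (subst sum_ennreal_rsum) auto
      also have "\<dots> \<le> (\<Sum>R\<in>F. epowr (m x) (2 - p) * ennreal (w R * \<bar>a R\<bar> powr p * indicator (rect R) x / rect_measure R))"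
      proof (rule sum_mono)
        fix R assume R: "R \<in> F"
        show "ennreal (w R * (a R)\<^sup>2 * indicator (rect R) x / rect_measure R) \<le> epowr (m x) (2 - p) * ennreal (w R * \<bar>a R\<bar> powr p * indicator (rect R) x / rect_measure R)"
        proof (cases "x \<in> rect R")
          case True
          have "(a R)\<^sup>2 = \<bar>a R\<bar> powr (2 - p) * \<bar>a R\<bar> powr p"
            by (cases "a R = 0") (auto simp flip: powr_add)
          then have "ennreal (w R * (a R)\<^sup>2 * indicator (rect R) x / rect_measure R) = ennreal (\<bar>a R\<bar> powr (2 - p)) * ennreal (w R * \<bar>a R\<bar> powr p * indicator (rect R) x / rect_measure R)"
            using w[OF R] by (simp add: ac_simps flip: ennreal_mult)
          also have "ennreal (\<bar>a R\<bar> powr (2 - p)) = epowr (ennreal \<bar>a R\<bar>) (2 - p)" by (simp add: epowr_ennreal)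
          also have "\<dots> \<le> epowr (m x) (2 - p)" using True R p by (intro epowr_mono m) auto
          finally show ?thesis by (simp add: mult_right_mono)
        qed simp
      qed
      also have "\<dots> = epowr (m x) (2 - p) * ennreal (Q x)"
        unfolding Q_def sum_distrib_left[symmetric] using w by (subst sum_ennreal_rsum) auto
      finally have "epowr (ennreal (rsum F (\<lambda>R. w R * (a R)\<^sup>2) x)) (p / 2) \<le> epowr (epowr (m x) (2 - p) * ennreal (Q x)) (p / 2)"
        using p by (intro epowr_mono) auto
      then have "ennreal (rsum F (\<lambda>R. w R * (a R)\<^sup>2) x powr (p / 2)) \<le> epowr (m x) ((2 - p) * p / 2) * epowr (ennreal (Q x)) (p / 2)"
        using H0 by (simp add: epowr_ennreal epowr_mult epowr_epowr)
      also have "\<dots> = (ennreal (K powr (p / 2)) * epowr (ennreal (1 / K)) (p / 2)) * (epowr (m x) ((2 - p) * p / 2) * epowr (ennreal (Q x)) (p / 2))"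
        unfolding K1 by simp
      also have "\<dots> = ennreal (K powr (p / 2)) * (epowr (m x) ((2 - p) * p / 2) * epowr (ennreal (1 / K) * ennreal (Q x)) (p / 2))"
        unfolding epowr_mult by (simp only: ac_simps)
      \<comment> \<open>Young's inequality with the conjugate exponents \<open>2 / (2 - p)\<close>
        and \<open>2 / p\<close>, for which \<open>m\<close> appears to the power \<open>p\<close>
        and \<open>Q\<close> to the power 1.\<close>
      also have "\<dots> \<le> ennreal (K powr (p / 2)) * (epowr (epowr (m x) ((2 - p) * p / 2)) (2 / (2 - p)) + epowr (epowr (ennreal (1 / K) * ennreal (Q x)) (p / 2)) (2 / p))"
        using p by (intro mult_left_mono epowr_young) (auto simp: field_simps)
      also have "\<dots> = ennreal (K powr (p / 2)) * (epowr (m x) p + ennreal (1 / K) * ennreal (Q x))"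
        using p by (simp add: epowr_epowr)
      finally show ?thesis .
    qed
    have "rint F (\<lambda>R. w R * (a R)\<^sup>2) (p / 2)
      \<le> (\<integral>\<^sup>+x. ennreal (K powr (p / 2)) * (epowr (m x) p + ennreal (1 / K) * ennreal (Q x)) \<partial>lborel)"
      by (intro nn_integral_mono pointwise)
    also have "\<dots> = ennreal (K powr (p / 2)) * (pint p m + ennreal (1 / K) * (\<integral>\<^sup>+x. ennreal (Q x) \<partial>lborel))"
      by (simp add: nn_integral_cmult nn_integral_add)
    also have "\<dots> \<le> ennreal (K powr (p / 2)) * (pint p m + ennreal (1 / K) * (ennreal K * pint p m))"
      by (intro mult_left_mono add_left_mono Q) auto
    also have "ennreal (1 / K) * (ennreal K * pint p m) = pint p m"
      using K by (simp add: mult.assoc[symmetric] flip: ennreal_mult)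
    also have "ennreal (K powr (p / 2)) * (pint p m + pint p m)
      = ennreal (2 * K powr (p / 2)) * pint p m"
      by (simp add: ennreal_mult mult_2[symmetric] ac_simps)
    finally show "rint F (\<lambda>R. w R * (a R)\<^sup>2) (p / 2) \<le> ennreal (2 * K powr (p / 2)) * pint p m" .
  qed simp
qed

lemma paraprod_opnorm_le_BMO:
  assumes "0 < p"
  obtains C :: real where "0 < C" "\<And>g. paraprod_opnorm p p g \<le> ennreal C * BMO_norm g"
proof -
  obtain C :: real where C: "0 < C" and carl: "\<And>F w K a m. finite F \<Longrightarrow> (\<And>R. R \<in> F \<Longrightarrow> 0 \<le> w R) \<Longrightarrow> 0 < K \<Longrightarrow>
      (\<And>F'. F' \<subseteq> F \<Longrightarrow> ennreal (\<Sum>R\<in>F'. w R) \<le> ennreal K * emeasure lborel (\<Union>R\<in>F'. rect R)) \<Longrightarrow>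
      m \<in> borel_measurable borel \<Longrightarrow> (\<And>R x. R \<in> F \<Longrightarrow> x \<in> rect R \<Longrightarrow> ennreal \<bar>a R\<bar> \<le> m x) \<Longrightarrow>
      rint F (\<lambda>R. w R * (a R)\<^sup>2) (p / 2) \<le> ennreal (C * K powr (p / 2)) * pint p m"
    using carleson_powr[OF assms] by blast
  show ?thesis
  proof (rule that[of "C powr (1 / p)"])
    fix g
    \<comment> \<open>The packing constant has to be positive while the norm may be 0; hence a
      positive real majorant \<open>N\<close>, and a limit at the end.\<close>
    have bound: "paraprod_opnorm p p g \<le> ennreal (C powr (1 / p) * N)" if N: "0 < N" "BMO_norm g \<le> ennreal N" for N
      unfolding paraprod_opnorm_def
    proof (rule SUP_least)
      fix f assume "f \<in> {f. locally_integrable f \<and> Hp_norm p f \<le> 1}"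
      then have M: "pint p (max_d f) \<le> 1"
        using Hp_norm_le_1_iff[OF assms] by simp
      have "pint p (sq_fun (paraprod g f)) \<le> ennreal (C * (N\<^sup>2) powr (p / 2))"
      proof (rule nn_integral_sq_fun_le[OF assms])
        fix F :: "drect set" assume F: "finite F"
        have "rint F (\<lambda>R. (paraprod g f R)\<^sup>2) (p / 2)
          = rint F (\<lambda>R. (g R)\<^sup>2 * (avg f R)\<^sup>2) (p / 2)"
          by (simp add: paraprod_def power_mult_distrib)
        also have "\<dots> \<le> ennreal (C * (N\<^sup>2) powr (p / 2)) * pint p (max_d f)"
        proof (rule carl[OF F])
          fix F' assume "F' \<subseteq> F"
          then have "finite F'" using F finite_subset by blast
          then have "ennreal (\<Sum>R\<in>F'. (g R)\<^sup>2) \<le> epowr (BMO_norm g) 2 * emeasure lborel (\<Union>R\<in>F'. rect R)"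
            by (rule BMO_packing)
          also have "\<dots> \<le> epowr (ennreal N) 2 * emeasure lborel (\<Union>R\<in>F'. rect R)"
            by (intro mult_right_mono epowr_mono N) auto
          finally show "ennreal (\<Sum>R\<in>F'. (g R)\<^sup>2) \<le> ennreal (N\<^sup>2) * emeasure lborel (\<Union>R\<in>F'. rect R)"
            using N by (simp add: epowr_ennreal)
        qed (use N in \<open>auto intro: abs_avg_le_max_d\<close>)
        also have "\<dots> \<le> ennreal (C * (N\<^sup>2) powr (p / 2)) * 1"
          by (intro mult_left_mono M) auto
        finally show "rint F (\<lambda>R. (paraprod g f R)\<^sup>2) (p / 2) \<le> ennreal (C * (N\<^sup>2) powr (p / 2))"
          by simp
      qed
      also have "\<dots> = epowr (ennreal (C powr (1 / p) * N)) p"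
        using C N assms by (simp add: epowr_ennreal powr_mult powr_powr flip: powr_numeral)
      finally show "Hdot_norm p (paraprod g f) \<le> ennreal (C powr (1 / p) * N)"
        using assms by (simp add: Hdot_norm_le_iff)
    qed
    show "paraprod_opnorm p p g \<le> ennreal (C powr (1 / p)) * BMO_norm g"
    proof (cases "BMO_norm g")
      case top
      then show ?thesis using C by (simp add: ennreal_mult_top)
    next
      case (real b)
      show ?thesis
      proof (rule ennreal_le_epsilon)
        fix e :: real assume e: "0 < e"
        let ?N = "b + e / C powr (1 / p)"
        have "paraprod_opnorm p p g \<le> ennreal (C powr (1 / p) * ?N)"
          using e C real by (intro bound) (auto intro!: add_nonneg_pos ennreal_leI)
        also have "C powr (1 / p) * ?N = C powr (1 / p) * b + e" using C by (simp add: field_simps)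
        also have "ennreal \<dots> = ennreal (C powr (1 / p)) * BMO_norm g + ennreal e"
          using real e by (simp add: ennreal_mult)
        finally show "paraprod_opnorm p p g \<le> ennreal (C powr (1 / p)) * BMO_norm g + ennreal e" .
      qed
    qed
  qed (use C in simp)
qed

section \<open>Testing the operator norm\<close>

lemma avg_scale: "avg (\<lambda>x. c * f x) R = c * avg f R"
  by (simp add: avg_def set_lebesgue_integral_def mult.left_commute)

lemma max_d_scale: "0 \<le> c \<Longrightarrow> max_d (\<lambda>x. c * f x) x = ennreal c * max_d f x"
  unfolding max_d_def avg_scale
  by (simp add: abs_mult ennreal_mult SUP_mult_left_ennreal)

text \<open>The function is scaled by \<open>b powr (- 1 / p)\<close> to norm at most 1, and the
  factor is removed again by homogeneity. The lower bounds use the operator norm only through this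
  estimate.\<close>

lemma paraprod_opnorm_test:
  assumes "0 < p" "0 < q" "0 < b" "0 \<le> A" "paraprod_opnorm p q g \<le> ennreal A" "locally_integrable f"
    and M: "pint p (max_d f) \<le> ennreal b" and F: "finite F"
  shows "rint F (\<lambda>R. (g R)\<^sup>2 * (avg f R)\<^sup>2) (q / 2) \<le> ennreal (A powr q * b powr (q / p))"
proof -
  define c where "c = b powr (- 1 / p)"
  have c: "0 < c" using assms by (simp add: c_def)
  have cp: "c powr p = 1 / b" using assms unfolding c_def powr_powr by (simp add: powr_minus_divide)
  have cq: "c powr q * b powr (q / p) = 1" using assms by (simp add: c_def powr_powr flip: powr_add)
  let ?f = "\<lambda>x. c * f x"
  have li: "locally_integrable ?f"
    using assms(6) unfolding locally_integrable_def by (auto intro: set_integrable_mult_right)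
  have "pint p (max_d ?f) = ennreal (1 / b) * pint p (max_d f)"
    using c by (simp add: max_d_scale epowr_mult epowr_ennreal cp nn_integral_cmult)
  also have "\<dots> \<le> ennreal (1 / b) * ennreal b" by (intro mult_left_mono M) auto
  also have "\<dots> = 1" using assms by (simp flip: ennreal_mult)
  finally have "Hp_norm p ?f \<le> 1" using assms by (simp add: Hp_norm_le_1_iff)
  then have "Hdot_norm q (paraprod g ?f) \<le> paraprod_opnorm p q g"
    unfolding paraprod_opnorm_def using li by (intro SUP_upper) auto
  also have "\<dots> \<le> ennreal A" by fact
  finally have "pint q (sq_fun (paraprod g ?f)) \<le> epowr (ennreal A) q"
    using assms by (simp add: Hdot_norm_le_iff)
  then have le: "rint F (\<lambda>R. (paraprod g ?f R)\<^sup>2) (q / 2) \<le> epowr (ennreal A) q"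
    using nn_integral_sq_fun_ge[OF assms(2) F] order_trans by blast
  have sc: "rsum F (\<lambda>R. (paraprod g ?f R)\<^sup>2) x = c\<^sup>2 * rsum F (\<lambda>R. (g R)\<^sup>2 * (avg f R)\<^sup>2) x" for x
    by (simp add: rsum_def paraprod_def avg_scale power_mult_distrib sum_distrib_left ac_simps)
  have "(\<integral>\<^sup>+x. ennreal ((c\<^sup>2 * rsum F (\<lambda>R. (g R)\<^sup>2 * (avg f R)\<^sup>2) x) powr (q / 2)) \<partial>lborel)
    = ennreal (c powr q) * rint F (\<lambda>R. (g R)\<^sup>2 * (avg f R)\<^sup>2) (q / 2)"
    using c by (simp add: powr_mult powr_powr rsum_nonneg ennreal_mult nn_integral_cmult flip: powr_numeral)
  with le have "ennreal (c powr q) * rint F (\<lambda>R. (g R)\<^sup>2 * (avg f R)\<^sup>2) (q / 2)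
     \<le> epowr (ennreal A) q" unfolding sc by simp
  then have "ennreal (b powr (q / p)) * (ennreal (c powr q) * rint F (\<lambda>R. (g R)\<^sup>2 * (avg f R)\<^sup>2) (q / 2))
     \<le> ennreal (b powr (q / p)) * epowr (ennreal A) q" by (rule mult_left_mono) simp
  moreover have "ennreal (b powr (q / p)) * (ennreal (c powr q) * X) = X" for X
  proof -
    have "ennreal (b powr (q / p)) * (ennreal (c powr q) * X) = (ennreal (c powr q) * ennreal (b powr (q / p))) * X"
      by (simp only: ac_simps)
    also have "ennreal (c powr q) * ennreal (b powr (q / p)) = 1"
      using cq by (simp flip: ennreal_mult)
    finally show ?thesis by simp
  qed
  ultimately show ?thesis using assms(4) by (simp add: epowr_ennreal ennreal_mult mult.commute)
qed

section \<open>Haar functions and stopping times on the line\<close>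

text \<open>Step functions that are nonzero on finitely many fibres of a labelling \<open>L\<close>.
  For \<open>lev N\<close>, and later for pairs of such labels, they are the finite combinations of
  indicators of grid cells with side \<open>2 powr - N\<close>; the closure lemmas serve both
  dimensions.\<close>

definition fstep :: "('a \<Rightarrow> 'b) \<Rightarrow> ('a \<Rightarrow> real) \<Rightarrow> bool" where
  "fstep L a \<longleftrightarrow> (\<forall>x y. L x = L y \<longrightarrow> a x = a y) \<and> finite (L ` {x. a x \<noteq> 0})"

lemma fstepI: "(\<And>x y. L x = L y \<Longrightarrow> a x = a y) \<Longrightarrow> finite (L ` {x. a x \<noteq> 0}) \<Longrightarrow> fstep L a"
  unfolding fstep_def by blast

lemma fstep_cong: "fstep L a \<Longrightarrow> L x = L y \<Longrightarrow> a x = a y"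
  unfolding fstep_def by blast

lemma fstep_mult:
  assumes "fstep L a" "\<And>x y. L x = L y \<Longrightarrow> b x = b y"
  shows "fstep L (\<lambda>x. a x * b x)"
  unfolding fstep_def
proof (intro conjI allI impI)
  show "a x * b x = a y * b y" if "L x = L y" for x y
    using fstep_cong[OF assms(1) that] assms(2)[OF that] by simp
  have "L ` {x. a x * b x \<noteq> 0} \<subseteq> L ` {x. a x \<noteq> 0}" by auto
  then show "finite (L ` {x. a x * b x \<noteq> 0})" using assms(1) finite_subset unfolding fstep_def by blast
qed

lemma fstep_add:
  assumes "fstep L a" "fstep L b" shows "fstep L (\<lambda>x. a x + b x)"
  unfolding fstep_def
proof (intro conjI allI impI)
  show "a x + b x = a y + b y" if "L x = L y" for x y
    using fstep_cong[OF assms(1) that] fstep_cong[OF assms(2) that] by simp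
  have "L ` {x. a x + b x \<noteq> 0} \<subseteq> L ` {x. a x \<noteq> 0} \<union> L ` {x. b x \<noteq> 0}" by auto
  then show "finite (L ` {x. a x + b x \<noteq> 0})"
    using assms finite_subset unfolding fstep_def by (metis (no_types, lifting) finite_Un)
qed

lemma fstep_zero: "fstep L (\<lambda>x. 0)"
  by (simp add: fstep_def)

lemma fstep_cmult: "fstep L a \<Longrightarrow> fstep L (\<lambda>x. c * a x)"
  using fstep_mult[of L a "\<lambda>_. c"] by (simp add: mult.commute)

lemma fstep_diff: "fstep L a \<Longrightarrow> fstep L b \<Longrightarrow> fstep L (\<lambda>x. a x - b x)"
  using fstep_add[of L a "\<lambda>x. -1 * b x"] fstep_cmult[of L b "-1"] by simp

lemma fstep_power2: "fstep L a \<Longrightarrow> fstep L (\<lambda>x. (a x)\<^sup>2)"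
  unfolding power2_eq_square by (intro fstep_mult) (auto dest: fstep_cong)

lemma fstep_sum: "(\<And>i. i \<in> S \<Longrightarrow> fstep L (a i)) \<Longrightarrow> fstep L (\<lambda>x. \<Sum>i\<in>S. a i x)"
  by (induction S rule: infinite_finite_induct) (auto intro: fstep_add fstep_zero)

lemma fstep_integrable:
  assumes a: "fstep L a" and meas: "\<And>z. L -` {z} \<in> sets M" and fin: "\<And>z. emeasure M (L -` {z}) < \<infinity>"
  shows "integrable M a"
proof -
  define v where "v z = a (SOME y. L y = z)" for z
  have v: "a x = v (L x)" for x
    unfolding v_def using someI[of "\<lambda>y. L y = L x" x] by (intro fstep_cong[OF a]) auto
  let ?Z = "L ` {x. a x \<noteq> 0}"
  have Z: "finite ?Z" using a unfolding fstep_def by (rule conjunct2)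
  have "a x = (\<Sum>z\<in>?Z. v z * indicator (L -` {z}) x)" for x
  proof (cases "a x = 0")
    case True
    have "L x \<notin> ?Z"
    proof
      assume "L x \<in> ?Z"
      then obtain y where y: "a y \<noteq> 0" "L x = L y" by blast
      have "a x = a y" using a y(2) by (rule fstep_cong)
      with y(1) True show False by simp
    qed
    then have "(\<Sum>z\<in>?Z. v z * indicator (L -` {z}) x) = 0"
      by (intro sum.neutral) (auto simp: indicator_def)
    then show ?thesis using True by simp
  next
    case False
    then have "L x \<in> ?Z" by auto
    have "(\<Sum>z\<in>?Z. v z * indicator (L -` {z}) x) = (\<Sum>z\<in>?Z. if z = L x then v z else 0)"
      by (intro sum.cong) (auto simp: indicator_def)
    also have "\<dots> = v (L x)" using Z \<open>L x \<in> ?Z\<close> by simp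
    finally show ?thesis using v by simp
  qed
  then have eq: "a = (\<lambda>x. \<Sum>z\<in>?Z. v z * indicator (L -` {z}) x)" by (rule ext)
  show ?thesis
    by (subst eq, intro Bochner_Integration.integrable_sum integrable_mult_right integrable_real_indicator meas fin)
qed

lemma vimage_lev: "lev N -` {z} = dyadic_interval (N, z)"
  by (auto simp: mem_dyadic_interval)

lemma fstep_lev_integrable: "fstep (lev N) a \<Longrightarrow> integrable lborel a"
  by (rule fstep_integrable) (auto simp: vimage_lev emeasure_dyadic_interval)

abbreviation ilen :: "dint \<Rightarrow> real" where
  "ilen I \<equiv> 2 powr - real_of_int (fst I)"

text \<open>The Haar functions take the values \<open>\<plusminus>1\<close>; they are not normalized in \<open>L\<^sup>2\<close>.\<close>

definition haar :: "dint \<Rightarrow> real \<Rightarrow> real" where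
  "haar I x = (if lev (fst I) x = snd I then if even (lev (fst I + 1) x) then 1 else -1 else 0)"

lemma lev_Suc: "lev n x = lev (n + 1) x div 2"
  using lev_coarser[of n "n + 1" x] by simp

lemma finite_lev_dyadic_interval: "finite (lev N ` dyadic_interval I)"
proof (cases "fst I \<le> N")
  case True
  let ?d = "2 ^ nat (N - fst I) :: int"
  have "lev N ` dyadic_interval I \<subseteq> {snd I * ?d..snd I * ?d + ?d}"
  proof
    fix z assume "z \<in> lev N ` dyadic_interval I"
    then obtain x where x: "z = lev N x" "lev (fst I) x = snd I" by (auto simp: mem_dyadic_interval)
    have "snd I = z div ?d" using lev_coarser[OF True, of x] x by simp
    moreover have "z mod ?d < ?d" "0 \<le> z mod ?d" by auto
    ultimately show "z \<in> {snd I * ?d..snd I * ?d + ?d}"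
      using div_mult_mod_eq[of z ?d] by (simp del: pos_mod_bound pos_mod_sign) 
  qed
  then show ?thesis by (rule finite_subset) simp
next
  case False
  then have "lev N ` dyadic_interval I \<subseteq> {snd I div 2 ^ nat (fst I - N)}"
    using lev_coarser[of N "fst I"] by (auto simp: mem_dyadic_interval)
  then show ?thesis by (rule finite_subset) simp
qed

lemma indicator_dyadic_interval_cong:
  "fst I \<le> N \<Longrightarrow> lev N x = lev N y \<Longrightarrow> indicator (dyadic_interval I) x = (indicator (dyadic_interval I) y :: real)"
  using lev_eq_coarser[of N x y "fst I"] by (simp add: indicator_def mem_dyadic_interval)

lemma haar_cong: "fst I < N \<Longrightarrow> lev N x = lev N y \<Longrightarrow> haar I x = haar I y"
  using lev_eq_coarser[of N x y "fst I"] lev_eq_coarser[of N x y "fst I + 1"] by (simp add: haar_def)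

lemma fstep_indicator_dyadic: "fst I \<le> N \<Longrightarrow> fstep (lev N) (indicator (dyadic_interval I))"
proof (rule fstepI)
  have "{x. indicator (dyadic_interval I) x \<noteq> (0::real)} = dyadic_interval I"
    by (auto simp: indicator_def)
  then show "finite (lev N ` {x. indicator (dyadic_interval I) x \<noteq> (0::real)})"
    by (simp only: finite_lev_dyadic_interval)
qed (rule indicator_dyadic_interval_cong)

lemma haar_nonzero: "haar I x \<noteq> 0 \<Longrightarrow> x \<in> dyadic_interval I"
  by (auto simp: haar_def mem_dyadic_interval split: if_splits)

lemma fstep_haar: assumes "fst I < N" shows "fstep (lev N) (haar I)"
proof -
  have "finite (lev N ` {x. haar I x \<noteq> 0})"
    by (rule finite_subset[OF image_mono finite_lev_dyadic_interval[of N I]]) (auto dest: haar_nonzero)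
  with haar_cong[OF assms] show ?thesis by (rule fstepI)
qed

lemma haar_power2: "(haar I x)\<^sup>2 = indicator (dyadic_interval I) x"
  by (simp add: haar_def mem_dyadic_interval indicator_def)

lemma haar_eq_indicators:
  "haar I x = indicator (dyadic_interval (fst I + 1, 2 * snd I)) x - indicator (dyadic_interval (fst I + 1, 2 * snd I + 1)) x"
  unfolding haar_def indicator_def mem_dyadic_interval lev_Suc[of "fst I" x]
  by (auto elim!: evenE oddE)

lemma indicator_children:
  "indicator (dyadic_interval I) x = indicator (dyadic_interval (fst I + 1, 2 * snd I)) x + (indicator (dyadic_interval (fst I + 1, 2 * snd I + 1)) x :: real)"
  unfolding indicator_def mem_dyadic_interval lev_Suc[of "fst I" x]
  by (cases "even (lev (fst I + 1) x)") (auto elim!: evenE oddE)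

lemma integral_haar: "(\<integral>x. haar I x \<partial>lborel) = 0"
  unfolding haar_eq_indicators
  by (subst Bochner_Integration.integral_diff)
    (auto simp: measure_dyadic_interval integrable_indicator_iff emeasure_dyadic_interval)

lemma haar_integrable: "integrable lborel (haar I)"
  by (rule fstep_lev_integrable[OF fstep_haar[of _ "fst I + 1"]]) simp

lemma integral_haar_power2: "(\<integral>x. (haar I x)\<^sup>2 \<partial>lborel) = ilen I"
  by (simp add: haar_power2 measure_dyadic_interval)

text \<open>The coarser function is constant on the support of the finer one, which has mean
  zero.\<close>

lemma integral_haar_mult_less:
  assumes "fst I < fst J" shows "(\<integral>x. haar I x * haar J x \<partial>lborel) = 0"
proof -
  obtain y where y: "y \<in> dyadic_interval J" using dyadic_interval_nonempty by blast
  have "haar I x * haar J x = haar I y * haar J x" for x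
  proof (cases "haar J x = 0")
    case False
    then have "lev (fst J) x = lev (fst J) y" using y haar_nonzero[of J x] by (simp add: mem_dyadic_interval)
    then show ?thesis using haar_cong[OF assms, of x y] by simp
  qed simp
  then have "(\<integral>x. haar I x * haar J x \<partial>lborel) = (\<integral>x. haar I y * haar J x \<partial>lborel)"
    by (intro Bochner_Integration.integral_cong) auto
  then show ?thesis by (simp add: integral_haar)
qed

lemma integral_haar_mult: "I \<noteq> J \<Longrightarrow> (\<integral>x. haar I x * haar J x \<partial>lborel) = 0"
proof (cases "fst I = fst J")
  case True
  assume "I \<noteq> J"
  then have "(\<lambda>x. haar I x * haar J x) = (\<lambda>x. 0)"
    using True by (auto simp: haar_def prod_eq_iff)
  then show ?thesis by simp
next
  case False
  then show ?thesis
    using integral_haar_mult_less[of I J] integral_haar_mult_less[of J I]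
    by (cases "fst I < fst J") (auto simp: mult.commute)
qed

lemma integral_haar_sum_power2:
  assumes "finite U"
  shows "(\<integral>x. (\<Sum>I\<in>U. d I * haar I x)\<^sup>2 \<partial>lborel) = (\<Sum>I\<in>U. (d I)\<^sup>2 * ilen I)"
proof -
  have int: "integrable lborel (\<lambda>x. haar I x * haar J x)" for I J
  proof (rule fstep_lev_integrable)
    show "fstep (lev (max (fst I) (fst J) + 1)) (\<lambda>x. haar I x * haar J x)"
      by (intro fstep_mult fstep_haar haar_cong[where N="max (fst I) (fst J) + 1"]) auto
  qed
  have "(\<integral>x. (\<Sum>I\<in>U. d I * haar I x)\<^sup>2 \<partial>lborel) = (\<integral>x. (\<Sum>I\<in>U. \<Sum>J\<in>U. (d I * d J) * (haar I x * haar J x)) \<partial>lborel)"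
    by (simp add: power2_eq_square sum_product ac_simps)
  also have "\<dots> = (\<Sum>I\<in>U. \<Sum>J\<in>U. (d I * d J) * (\<integral>x. haar I x * haar J x \<partial>lborel))"
    using int by (simp add: Bochner_Integration.integral_sum Bochner_Integration.integrable_sum)
  also have "\<dots> = (\<Sum>I\<in>U. \<Sum>J\<in>U. if J = I then (d I)\<^sup>2 * ilen I else 0)"
    using integral_haar_mult integral_haar_power2
    by (intro sum.cong refl) (auto simp: power2_eq_square)
  also have "\<dots> = (\<Sum>I\<in>U. (d I)\<^sup>2 * ilen I)"
    using assms by simp
  finally show ?thesis .
qed

text \<open>A Haar function has mean zero over every dyadic interval that contains its own. This
  cancellation confines the maximal function of a projection to the selected rectangles.\<close>

lemma integral_haar_on_dyadic:
  assumes "(\<integral>x. haar I x * indicator (dyadic_interval Q) x \<partial>lborel) \<noteq> 0"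
  shows "dyadic_interval Q \<subseteq> dyadic_interval I"
proof (rule ccontr)
  assume not: "\<not> dyadic_interval Q \<subseteq> dyadic_interval I"
  have "(\<integral>x. haar I x * indicator (dyadic_interval Q) x \<partial>lborel) = 0"
  proof (cases "dyadic_interval I \<subseteq> dyadic_interval Q")
    case True
    then have "(\<lambda>x. haar I x * indicator (dyadic_interval Q) x) = haar I"
      using haar_nonzero[of I] by (fastforce simp: indicator_def)
    then show ?thesis by (simp add: integral_haar)
  next
    case False
    then have "dyadic_interval I \<inter> dyadic_interval Q = {}"
      using not dyadic_interval_subset by (meson disjoint_iff linear)
    then have "(\<lambda>x. haar I x * indicator (dyadic_interval Q) x) = (\<lambda>x. 0)"
      using haar_nonzero[of I] by (fastforce simp: indicator_def)
    then show ?thesis by simp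
  qed
  with assms show False by simp
qed

section \<open>Averages and Haar coefficients\<close>

definition iavg :: "(real \<Rightarrow> real) \<Rightarrow> dint \<Rightarrow> real" where
  "iavg a I = (\<integral>x. a x * indicator (dyadic_interval I) x \<partial>lborel) / ilen I"

text \<open>The squared norm of \<open>haar I\<close> is \<open>ilen I\<close>, so this is the
  coefficient in the expansion by the functions with values \<plusminus>1.\<close>

definition hcoef :: "(real \<Rightarrow> real) \<Rightarrow> dint \<Rightarrow> real" where
  "hcoef a I = (\<integral>x. a x * haar I x \<partial>lborel) / ilen I"

text \<open>Martingale difference: passing from an interval to a child changes the average by half
  the difference between the averages over the two children, with the sign of the Haar
  function.\<close>

lemma iavg_increment:
  assumes "integrable lborel a"
  shows "iavg a (n + 1, lev (n + 1) x) - iavg a (n, lev n x) = hcoef a (n, lev n x) * haar (n, lev n x) x"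
proof -
  let ?L = "dyadic_interval (n + 1, 2 * lev n x)" and ?R = "dyadic_interval (n + 1, 2 * lev n x + 1)"
  let ?l = "\<integral>y. a y * indicator ?L y \<partial>lborel" and ?r = "\<integral>y. a y * indicator ?R y \<partial>lborel"
  have int: "integrable lborel (\<lambda>y. a y * indicator A y)" if "A \<in> sets borel" for A
    using integrable_mult_indicator[OF _ assms, of A] that by (simp add: mult.commute)
  have sum: "(\<integral>y. a y * indicator (dyadic_interval (n, lev n x)) y \<partial>lborel) = ?l + ?r"
    using int by (simp add: indicator_children[of "(n, lev n x)"] distrib_left)
  have diff: "(\<integral>y. a y * haar (n, lev n x) y \<partial>lborel) = ?l - ?r"
    using int by (simp add: haar_eq_indicators right_diff_distrib)
  have p: "2 powr (- real_of_int n - 1) = 2 powr (- real_of_int n) / 2"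
    by (simp add: powr_diff)
  show ?thesis
  proof (cases "even (lev (n + 1) x)")
    case True
    then have "lev (n + 1) x = 2 * lev n x" using lev_Suc[of n x] by simp
    then show ?thesis
      using True unfolding iavg_def hcoef_def sum diff
      by (simp add: haar_def p) (simp add: field_simps)
  next
    case False
    then have "lev (n + 1) x = 2 * lev n x + 1" using lev_Suc[of n x] by (simp add: odd_two_times_div_two_succ)
    then show ?thesis
      using False unfolding iavg_def hcoef_def sum diff
      by (simp add: haar_def p) (simp add: field_simps)
  qed
qed

lemma iavg_fstep:
  assumes "fstep (lev N) a" shows "iavg a (N, lev N x) = a x"
proof -
  have "a y * indicator (dyadic_interval (N, lev N x)) y = a x * indicator (dyadic_interval (N, lev N x)) y" for y
    using fstep_cong[OF assms, of y x] by (auto simp: indicator_def mem_dyadic_interval)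
  then have "iavg a (N, lev N x) = (\<integral>y. a x * indicator (dyadic_interval (N, lev N x)) y \<partial>lborel) / ilen (N, lev N x)"
    unfolding iavg_def by presburger
  then show ?thesis by (simp add: measure_dyadic_interval)
qed

text \<open>The sum stops at the grid, where the average is the value of the function; no limit is
  involved.\<close>

lemma iavg_telescope:
  assumes a: "fstep (lev N) a" and "m \<le> N"
  shows "(\<Sum>n\<in>{m..<N}. hcoef a (n, lev n x) * haar (n, lev n x) x) = a x - iavg a (m, lev m x)"
proof -
  let ?g = "\<lambda>n. iavg a (n, lev n x)"
  have "(\<Sum>n\<in>{m..<N}. hcoef a (n, lev n x) * haar (n, lev n x) x) = (\<Sum>n\<in>{m..<N}. ?g (n + 1) - ?g n)"
    using iavg_increment[OF fstep_lev_integrable[OF a]] by simp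
  also have "\<dots> = (\<Sum>i<nat (N - m). ?g (m + int (Suc i)) - ?g (m + int i))"
    using assms(2) by (intro sum.reindex_bij_witness[of _ "\<lambda>i. m + int i" "\<lambda>n. nat (n - m)"]) (auto simp: ac_simps)
  also have "\<dots> = ?g (m + int (nat (N - m))) - ?g (m + int 0)"
    by (rule sum_lessThan_telescope)
  also have "\<dots> = a x - ?g m" using assms(2) iavg_fstep[OF a] by simp
  finally show ?thesis .
qed

lemma fstep_finite: "fstep L a \<Longrightarrow> finite (L ` {x. a x \<noteq> 0})"
  unfolding fstep_def by blast

definition dense_in :: "real \<Rightarrow> real set \<Rightarrow> dint \<Rightarrow> bool" where
  "dense_in \<epsilon> G I \<longleftrightarrow> \<epsilon> * ilen I < measure lborel (dyadic_interval I \<inter> G)"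

text \<open>The condition \<open>fst I < N\<close> selects Haar functions that are constant on grid
  cells. Intervals missing \<open>G\<close> are left out to keep the family finite; their
  coefficients vanish for functions supported in \<open>G\<close>.\<close>

definition stop_fam :: "int \<Rightarrow> real \<Rightarrow> real set \<Rightarrow> dint set" where
  "stop_fam N \<epsilon> G = {I. fst I < N \<and> dyadic_interval I \<inter> G \<noteq> {} \<and>
     (\<exists>J. dense_in \<epsilon> G J \<and> dyadic_interval I \<subseteq> dyadic_interval J)}"

definition stop_max :: "int \<Rightarrow> real \<Rightarrow> real set \<Rightarrow> dint set" where
  "stop_max N \<epsilon> G = {J. fst J \<le> N \<and> dense_in \<epsilon> G J \<and>
     (\<forall>J'. dense_in \<epsilon> G J' \<and> dyadic_interval J \<subseteq> dyadic_interval J' \<longrightarrow> J' = J)}"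

text \<open>
  If \<open>a\<close> is supported in \<open>G\<close>, the projection removes from \<open>a\<close> its average over each maximal interval in
  which \<open>G\<close> has density more than \<open>\<epsilon>\<close>. By maximality that density is at most \<open>2 \<epsilon>\<close>, so the averages are
  small in \<open>L\<^sup>2\<close> by Cauchy-Schwarz.
\<close>

definition stop_proj :: "int \<Rightarrow> real \<Rightarrow> real set \<Rightarrow> (real \<Rightarrow> real) \<Rightarrow> real \<Rightarrow> real" where
  "stop_proj N \<epsilon> G a x = (\<Sum>I\<in>stop_fam N \<epsilon> G. hcoef a I * haar I x)"

lemma mem_dyadic_interval_lev [simp]: "x \<in> dyadic_interval (n, lev n x)"
  by (simp add: mem_dyadic_interval)

lemma dyadic_interval_eq_lev: "x \<in> dyadic_interval I \<Longrightarrow> I = (fst I, lev (fst I) x)"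
  by (simp add: mem_dyadic_interval prod_eq_iff)

lemma ex_least_int:
  fixes P :: "int \<Rightarrow> bool"
  assumes "P n" "\<And>k. P k \<Longrightarrow> n0 \<le> k"
  obtains m where "P m" "\<And>k. P k \<Longrightarrow> m \<le> k"
proof
  define l where "l = (LEAST k. P (n0 + int k))"
  have ex: "P (n0 + int (nat (n - n0)))" using assms by simp
  show "P (n0 + int l)" unfolding l_def using ex by (rule LeastI)
  show "n0 + int l \<le> k" if "P k" for k
  proof -
    have "P (n0 + int (nat (k - n0)))" using that assms(2) by simp
    then have "l \<le> nat (k - n0)" unfolding l_def by (rule Least_le)
    then show ?thesis using assms(2)[OF that] by linarith
  qed
qed

context
  fixes N :: int and \<epsilon> :: real and G :: "real set"
  assumes G: "fstep (lev N) (indicator G)" and \<epsilon>: "0 < \<epsilon>" "\<epsilon> < 1"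
begin

lemma stop_set_cong: "lev N x = lev N y \<Longrightarrow> x \<in> G \<longleftrightarrow> y \<in> G"
  using fstep_cong[OF G, of x y] by (auto simp: indicator_def split: if_splits)

lemma stop_set_finite: "finite (lev N ` G)"
proof -
  have "{x. indicator G x \<noteq> (0::real)} = G" by (auto simp: indicator_def)
  with fstep_finite[OF G] show ?thesis by simp
qed

lemma stop_set_measurable [measurable]: "G \<in> sets borel" and stop_set_emeasure: "emeasure lborel G < \<infinity>"
  using fstep_lev_integrable[OF G] by (auto simp: integrable_indicator_iff)

lemma fmeasurable_inter_stop_set: "A \<in> sets borel \<Longrightarrow> A \<inter> G \<in> fmeasurable lborel"
  using stop_set_emeasure by (intro fmeasurableI) (auto intro: le_less_trans[OF emeasure_mono])

lemma dense_in_meets: "dense_in \<epsilon> G I \<Longrightarrow> dyadic_interval I \<inter> G \<noteq> {}"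
  using \<epsilon> by (auto simp: dense_in_def mult_less_0_iff)

text \<open>A dense interval is shorter than the measure of \<open>G\<close> divided by \<epsilon>,
  so among the dense intervals around a point there is a largest one.\<close>

lemma dense_in_level: obtains n0 where "\<And>I. dense_in \<epsilon> G I \<Longrightarrow> n0 \<le> fst I"
proof
  fix I assume I: "dense_in \<epsilon> G I"
  let ?\<gamma> = "measure lborel G"
  have "measure lborel (dyadic_interval I \<inter> G) \<le> ?\<gamma>"
    using stop_set_emeasure by (intro measure_mono_fmeasurable) (auto intro: fmeasurableI)
  then have "\<epsilon> * ilen I < ?\<gamma>" using I by (simp add: dense_in_def)
  then have lt: "2 powr (- real_of_int (fst I)) < ?\<gamma> / \<epsilon>" using \<epsilon> by (simp add: field_simps)
  then have "0 < ?\<gamma> / \<epsilon>" by (rule le_less_trans[rotated]) simp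
  with lt have "- real_of_int (fst I) < log 2 (?\<gamma> / \<epsilon>)" by (simp add: less_log_iff)
  then show "\<lfloor>- log 2 (?\<gamma> / \<epsilon>)\<rfloor> \<le> fst I" by linarith
qed

text \<open>A grid cell that meets \<open>G\<close> lies in it and has density 1. Hence every point
  of \<open>G\<close> lies in a dense interval.\<close>

lemma dense_in_atom: "x \<in> G \<Longrightarrow> dense_in \<epsilon> G (N, lev N x)"
proof -
  assume "x \<in> G"
  have "dyadic_interval (N, lev N x) \<subseteq> G"
  proof
    fix y assume "y \<in> dyadic_interval (N, lev N x)"
    then have "lev N y = lev N x" by (simp add: mem_dyadic_interval)
    then show "y \<in> G" using \<open>x \<in> G\<close> stop_set_cong by blast
  qed
  then have "dyadic_interval (N, lev N x) \<inter> G = dyadic_interval (N, lev N x)" by blast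
  then show ?thesis using \<epsilon> by (simp add: dense_in_def measure_dyadic_interval)
qed

lemma finite_intervals_meeting: "finite {I. n0 \<le> fst I \<and> fst I \<le> N \<and> dyadic_interval I \<inter> G \<noteq> {}}"
proof (rule finite_subset)
  show "{I. n0 \<le> fst I \<and> fst I \<le> N \<and> dyadic_interval I \<inter> G \<noteq> {}} \<subseteq> (\<lambda>(n, z). (n, z div 2 ^ nat (N - n))) ` ({n0..N} \<times> lev N ` G)"
  proof
    fix I assume "I \<in> {I. n0 \<le> fst I \<and> fst I \<le> N \<and> dyadic_interval I \<inter> G \<noteq> {}}"
    then obtain x where x: "x \<in> G" "x \<in> dyadic_interval I" and I: "n0 \<le> fst I" "fst I \<le> N" by blast
    have "I = (fst I, lev N x div 2 ^ nat (N - fst I))"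
      using x(2) lev_coarser[OF I(2), of x] by (simp add: mem_dyadic_interval prod_eq_iff)
    then show "I \<in> (\<lambda>(n, z). (n, z div 2 ^ nat (N - n))) ` ({n0..N} \<times> lev N ` G)"
      using x I by (intro image_eqI[of _ _ "(fst I, lev N x)"]) auto
  qed
  show "finite ((\<lambda>(n, z). (n, z div 2 ^ nat (N - n))) ` ({n0..N} \<times> lev N ` G))"
    using stop_set_finite by blast
qed

lemma stop_fam_finite: "finite (stop_fam N \<epsilon> G)"
proof -
  obtain n0 where n0: "\<And>I. dense_in \<epsilon> G I \<Longrightarrow> n0 \<le> fst I" using dense_in_level by blast
  have "stop_fam N \<epsilon> G \<subseteq> {I. n0 \<le> fst I \<and> fst I \<le> N \<and> dyadic_interval I \<inter> G \<noteq> {}}"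
  proof
    fix I assume I: "I \<in> stop_fam N \<epsilon> G"
    then obtain J where "dense_in \<epsilon> G J" "dyadic_interval I \<subseteq> dyadic_interval J"
      unfolding stop_fam_def by blast
    then have "n0 \<le> fst I" using n0[of J] dyadic_interval_mono_level[of I J] by linarith
    then show "I \<in> {I. n0 \<le> fst I \<and> fst I \<le> N \<and> dyadic_interval I \<inter> G \<noteq> {}}"
      using I unfolding stop_fam_def by auto
  qed
  then show ?thesis by (rule finite_subset[OF _ finite_intervals_meeting])
qed

lemma stop_max_finite: "finite (stop_max N \<epsilon> G)"
proof -
  obtain n0 where n0: "\<And>I. dense_in \<epsilon> G I \<Longrightarrow> n0 \<le> fst I" using dense_in_level by blast
  have "stop_max N \<epsilon> G \<subseteq> {I. n0 \<le> fst I \<and> fst I \<le> N \<and> dyadic_interval I \<inter> G \<noteq> {}}"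
    unfolding stop_max_def using n0 dense_in_meets by blast
  then show ?thesis by (rule finite_subset[OF _ finite_intervals_meeting])
qed

lemma stop_max_disjoint:
  assumes "I \<in> stop_max N \<epsilon> G" "J \<in> stop_max N \<epsilon> G" "x \<in> dyadic_interval I" "x \<in> dyadic_interval J"
  shows "I = J"
proof -
  have "dyadic_interval I \<subseteq> dyadic_interval J \<or> dyadic_interval J \<subseteq> dyadic_interval I"
    using assms dyadic_interval_subset by (meson linear)
  then show ?thesis using assms(1,2) unfolding stop_max_def by blast
qed

text \<open>The Haar terms at \<open>x\<close> telescope from the largest dense interval around
  \<open>x\<close> down to the grid; those not in \<open>stop_fam\<close> belong to intervals
  missing the support of \<open>a\<close>. If no dense interval contains \<open>x\<close>, both
  \<open>a x\<close> and the projection are 0.\<close>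

lemma stop_proj_pointwise:
  assumes a: "fstep (lev N) a" and supp: "\<And>x. a x \<noteq> 0 \<Longrightarrow> x \<in> G"
  shows "(\<exists>J\<in>stop_max N \<epsilon> G. x \<in> dyadic_interval J \<and> a x - stop_proj N \<epsilon> G a x = iavg a J)
    \<or> (a x - stop_proj N \<epsilon> G a x = 0 \<and> (\<forall>J\<in>stop_max N \<epsilon> G. x \<notin> dyadic_interval J))"
proof (cases "\<exists>J. dense_in \<epsilon> G J \<and> x \<in> dyadic_interval J")
  case False
  then have "x \<notin> G" using dense_in_atom mem_dyadic_interval_lev by blast
  then have "a x = 0" using supp by blast
  moreover have "stop_proj N \<epsilon> G a x = 0"
    unfolding stop_proj_def
  proof (intro sum.neutral ballI)
    fix I assume "I \<in> stop_fam N \<epsilon> G"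
    then have "x \<notin> dyadic_interval I" using False by (auto simp: stop_fam_def)
    then have "haar I x = 0" using haar_nonzero by blast
    then show "hcoef a I * haar I x = 0" by simp
  qed
  moreover have "\<forall>J\<in>stop_max N \<epsilon> G. x \<notin> dyadic_interval J" using False by (auto simp: stop_max_def)
  ultimately show ?thesis by simp
next
  case True
  obtain n0 where n0: "\<And>I. dense_in \<epsilon> G I \<Longrightarrow> n0 \<le> fst I" using dense_in_level by blast
  from True obtain n where "dense_in \<epsilon> G (n, lev n x)" using dyadic_interval_eq_lev by metis
  then obtain m where m: "dense_in \<epsilon> G (m, lev m x)" and min: "\<And>k. dense_in \<epsilon> G (k, lev k x) \<Longrightarrow> m \<le> k"
    using ex_least_int[of "\<lambda>k. dense_in \<epsilon> G (k, lev k x)" n n0] n0 by (metis fst_conv)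
  \<comment> \<open>A dense interval finer than the grid meets \<open>G\<close>, so the grid cell
    around it is dense as well, which contradicts the choice of the coarsest level.\<close>
  have mN: "m \<le> N"
  proof (rule ccontr)
    assume "\<not> m \<le> N"
    obtain y where y: "y \<in> G" "lev m y = lev m x" using dense_in_meets[OF m] by (auto simp: mem_dyadic_interval)
    then have "lev N y = lev N x" using lev_eq_coarser[of m y x N] \<open>\<not> m \<le> N\<close> by simp
    then have "dense_in \<epsilon> G (N, lev N x)" using dense_in_atom[OF y(1)] by simp
    then show False using min \<open>\<not> m \<le> N\<close> by blast
  qed
  have max: "(m, lev m x) \<in> stop_max N \<epsilon> G"
    unfolding stop_max_def
  proof (intro CollectI conjI allI impI)
    fix J' assume J': "dense_in \<epsilon> G J' \<and> dyadic_interval (m, lev m x) \<subseteq> dyadic_interval J'"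
    then have "x \<in> dyadic_interval J'" using mem_dyadic_interval_lev by blast
    then have eq: "J' = (fst J', lev (fst J') x)" by (rule dyadic_interval_eq_lev)
    have "fst J' \<le> m" using dyadic_interval_mono_level[of "(m, lev m x)" J'] J' by simp
    moreover have "m \<le> fst J'" using min J' eq by metis
    ultimately have "fst J' = m" by simp
    with eq show "J' = (m, lev m x)" by simp
  qed (use m mN in auto)
  have "stop_proj N \<epsilon> G a x = (\<Sum>I\<in>{I\<in>stop_fam N \<epsilon> G. x \<in> dyadic_interval I}. hcoef a I * haar I x)"
    unfolding stop_proj_def using stop_fam_finite haar_nonzero by (intro sum.mono_neutral_right) auto
  also have "\<dots> = (\<Sum>n\<in>{n\<in>{m..<N}. (n, lev n x) \<in> stop_fam N \<epsilon> G}. hcoef a (n, lev n x) * haar (n, lev n x) x)"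
  proof (rule sum.reindex_bij_witness[of _ "\<lambda>n. (n, lev n x)" fst])
    fix I assume I: "I \<in> {I\<in>stop_fam N \<epsilon> G. x \<in> dyadic_interval I}"
    then have "x \<in> dyadic_interval I" by blast
    then have eq: "I = (fst I, lev (fst I) x)" by (rule dyadic_interval_eq_lev)
    then show "(fst I, lev (fst I) x) = I" by simp
    from I obtain J where J: "dense_in \<epsilon> G J" "dyadic_interval I \<subseteq> dyadic_interval J"
      unfolding stop_fam_def by blast
    then have "x \<in> dyadic_interval J" using \<open>x \<in> dyadic_interval I\<close> by blast
    then have "m \<le> fst J" using min J(1) dyadic_interval_eq_lev by metis
    then have "m \<le> fst I" using dyadic_interval_mono_level[OF J(2)] by simp
    then show "fst I \<in> {n\<in>{m..<N}. (n, lev n x) \<in> stop_fam N \<epsilon> G}"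
      using I eq by (auto simp: stop_fam_def)
    show "hcoef a (fst I, lev (fst I) x) * haar (fst I, lev (fst I) x) x = hcoef a I * haar I x"
      using eq by simp
  qed auto
  also have "\<dots> = (\<Sum>n\<in>{m..<N}. hcoef a (n, lev n x) * haar (n, lev n x) x)"
  proof (rule sum.mono_neutral_left)
    show "\<forall>n\<in>{m..<N} - {n \<in> {m..<N}. (n, lev n x) \<in> stop_fam N \<epsilon> G}. hcoef a (n, lev n x) * haar (n, lev n x) x = 0"
    proof
      fix n assume n: "n \<in> {m..<N} - {n \<in> {m..<N}. (n, lev n x) \<in> stop_fam N \<epsilon> G}"
      have "dyadic_interval (n, lev n x) \<subseteq> dyadic_interval (m, lev m x)"
        using n by (intro dyadic_interval_subset[of x]) auto
      then have disj: "dyadic_interval (n, lev n x) \<inter> G = {}" using n m unfolding stop_fam_def by auto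
      have "(\<lambda>y. a y * haar (n, lev n x) y) = (\<lambda>y. 0)"
        using disj supp haar_nonzero[of "(n, lev n x)"] by fastforce
      then have "hcoef a (n, lev n x) = 0" unfolding hcoef_def by simp
      then show "hcoef a (n, lev n x) * haar (n, lev n x) x = 0" by simp
    qed
  qed auto
  also have "\<dots> = a x - iavg a (m, lev m x)" by (rule iavg_telescope[OF a mN])
  finally show ?thesis using max by (intro disjI1 bexI[of _ "(m, lev m x)"]) auto
qed

text \<open>By maximality the parent is not dense, and it is twice as long.\<close>

lemma stop_max_measure:
  assumes "J \<in> stop_max N \<epsilon> G"
  shows "measure lborel (dyadic_interval J \<inter> G) \<le> 2 * \<epsilon> * ilen J"
proof -
  let ?P = "(fst J - 1, snd J div 2)"
  have sub: "dyadic_interval J \<subseteq> dyadic_interval ?P"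
    using lev_Suc[of "fst J - 1"] by (auto simp: mem_dyadic_interval)
  have "\<not> dense_in \<epsilon> G ?P"
  proof
    assume "dense_in \<epsilon> G ?P"
    then have "?P = J" using assms sub by (auto simp: stop_max_def)
    then show False by (simp add: prod_eq_iff)
  qed
  then have "measure lborel (dyadic_interval ?P \<inter> G) \<le> \<epsilon> * ilen ?P"
    by (simp add: dense_in_def)
  also have "\<dots> = 2 * \<epsilon> * ilen J" by (simp add: powr_diff powr_minus divide_inverse)
  finally show ?thesis
    using measure_mono_fmeasurable[of "dyadic_interval J \<inter> G" "dyadic_interval ?P \<inter> G" lborel] sub fmeasurable_inter_stop_set[of "dyadic_interval ?P"]
    by force
qed

lemma stop_max_iavg:
  assumes a: "fstep (lev N) a" and supp: "\<And>x. a x \<noteq> 0 \<Longrightarrow> x \<in> G" and J: "J \<in> stop_max N \<epsilon> G"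
  shows "(iavg a J)\<^sup>2 * ilen J \<le> 2 * \<epsilon> * (\<integral>x. (a x)\<^sup>2 * indicator (dyadic_interval J) x \<partial>lborel)"
proof -
  let ?D = "dyadic_interval J" and ?g = "measure lborel (dyadic_interval J \<inter> G)"
  let ?b = "\<integral>x. a x * indicator ?D x \<partial>lborel" and ?q = "\<integral>x. (a x)\<^sup>2 * indicator ?D x \<partial>lborel"
  have lt: "\<epsilon> * ilen J < ?g" using J by (auto simp: stop_max_def dense_in_def)
  have "0 < \<epsilon> * ilen J" using \<epsilon> by simp
  then have g: "0 < ?g" using lt by linarith
  have inta: "integrable lborel (\<lambda>x. a x * indicator ?D x)"
    using integrable_mult_indicator[OF _ fstep_lev_integrable[OF a], of ?D] by (simp add: mult.commute)
  have intq: "integrable lborel (\<lambda>x. (a x)\<^sup>2 * indicator ?D x)"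
    using integrable_mult_indicator[OF _ fstep_lev_integrable[OF fstep_power2[OF a]], of ?D] by (simp add: mult.commute)
  have intg: "integrable lborel (indicator (?D \<inter> G) :: real \<Rightarrow> real)"
    using fmeasurable_inter_stop_set[of ?D] by (auto simp: integrable_indicator_iff fmeasurable_def)
  \<comment> \<open>The mean of \<open>a\<close> over the part of \<open>G\<close> in this interval;
    expanding the nonnegative integral below with this value is the Cauchy-Schwarz
    inequality.\<close>
  let ?c = "?b / ?g"
  have "0 \<le> (\<integral>x. (a x - ?c * indicator G x)\<^sup>2 * indicator ?D x \<partial>lborel)"
    by (intro integral_nonneg_AE) auto
  also have "(\<lambda>x. (a x - ?c * indicator G x)\<^sup>2 * indicator ?D x) =
      (\<lambda>x. (a x)\<^sup>2 * indicator ?D x - 2 * ?c * (a x * indicator ?D x) + ?c\<^sup>2 * indicator (?D \<inter> G) x)"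
  proof
    fix x
    have "a x * indicator G x = a x" using supp[of x] by (auto simp: indicator_def)
    then show "(a x - ?c * indicator G x)\<^sup>2 * indicator ?D x =
      (a x)\<^sup>2 * indicator ?D x - 2 * ?c * (a x * indicator ?D x) + ?c\<^sup>2 * indicator (?D \<inter> G) x"
      by (auto simp: indicator_def power2_eq_square algebra_simps)
  qed
  also have "(\<integral>x. (a x)\<^sup>2 * indicator ?D x - 2 * ?c * (a x * indicator ?D x) + ?c\<^sup>2 * indicator (?D \<inter> G) x \<partial>lborel)
    = ?q - 2 * ?c * ?b + ?c\<^sup>2 * ?g"
    using inta intq intg by simp
  also have "\<dots> = ?q - ?b\<^sup>2 / ?g" using g by (simp add: power2_eq_square)
  finally have "?b\<^sup>2 \<le> ?g * ?q" using g by (simp add: field_simps)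
  also have "\<dots> \<le> (2 * \<epsilon> * ilen J) * ?q"
    by (intro mult_right_mono stop_max_measure J integral_nonneg_AE) auto
  finally have "?b\<^sup>2 \<le> (2 * \<epsilon> * ?q) * ilen J" by (simp add: ac_simps)
  then show ?thesis by (simp add: iavg_def power2_eq_square field_simps)
qed

lemma fstep_stop_proj: "fstep (lev N) (stop_proj N \<epsilon> G a)"
  unfolding stop_proj_def by (intro fstep_sum fstep_cmult fstep_haar) (auto simp: stop_fam_def)

text \<open>The error is a combination of indicators of disjoint intervals, so its square integrates
  to a sum of squared averages, each controlled by the mass of \<open>a\<close> on its own
  interval.\<close>

lemma stop_proj_error:
  assumes a: "fstep (lev N) a" and supp: "\<And>x. a x \<noteq> 0 \<Longrightarrow> x \<in> G"
  shows "(\<integral>x. (a x - stop_proj N \<epsilon> G a x)\<^sup>2 \<partial>lborel) \<le> 2 * \<epsilon> * (\<integral>x. (a x)\<^sup>2 \<partial>lborel)"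
proof -
  let ?M = "stop_max N \<epsilon> G"
  have intq: "integrable lborel (\<lambda>x. (a x)\<^sup>2 * indicator (dyadic_interval J) x)" for J
    using integrable_mult_indicator[OF _ fstep_lev_integrable[OF fstep_power2[OF a]], of "dyadic_interval J"] by (simp add: mult.commute)
  have sum1: "(\<Sum>J\<in>?M. c J * indicator (dyadic_interval J) x) = c K" if "K \<in> ?M" "x \<in> dyadic_interval K" for K x and c :: "dint \<Rightarrow> real"
  proof -
    have "(\<Sum>J\<in>?M. c J * indicator (dyadic_interval J) x) = (\<Sum>J\<in>?M. if J = K then c K else 0)"
    proof (intro sum.cong refl)
      fix J assume "J \<in> ?M"
      then show "c J * indicator (dyadic_interval J) x = (if J = K then c K else 0)"
        using that stop_max_disjoint[of J K x] by (cases "x \<in> dyadic_interval J") auto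
    qed
    then show ?thesis using that(1) stop_max_finite by simp
  qed
  have eq: "(a x - stop_proj N \<epsilon> G a x)\<^sup>2 = (\<Sum>J\<in>?M. (iavg a J)\<^sup>2 * indicator (dyadic_interval J) x)" for x
    using stop_proj_pointwise[OF a supp, of x]
  proof
    assume "\<exists>J\<in>?M. x \<in> dyadic_interval J \<and> a x - stop_proj N \<epsilon> G a x = iavg a J"
    then obtain J where "J \<in> ?M" "x \<in> dyadic_interval J" "a x - stop_proj N \<epsilon> G a x = iavg a J" by blast
    then show ?thesis using sum1[of J x "\<lambda>J. (iavg a J)\<^sup>2"] by simp
  next
    assume *: "a x - stop_proj N \<epsilon> G a x = 0 \<and> (\<forall>J\<in>?M. x \<notin> dyadic_interval J)"
    then have "(\<Sum>J\<in>?M. (iavg a J)\<^sup>2 * indicator (dyadic_interval J) x) = 0"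
      by (intro sum.neutral) auto
    with * show ?thesis by simp
  qed
  have "(\<integral>x. (a x - stop_proj N \<epsilon> G a x)\<^sup>2 \<partial>lborel) = (\<Sum>J\<in>?M. (iavg a J)\<^sup>2 * ilen J)"
    unfolding eq by (subst Bochner_Integration.integral_sum)
      (auto simp: measure_dyadic_interval integrable_indicator_iff emeasure_dyadic_interval)
  also have "\<dots> \<le> (\<Sum>J\<in>?M. 2 * \<epsilon> * (\<integral>x. (a x)\<^sup>2 * indicator (dyadic_interval J) x \<partial>lborel))"
    by (intro sum_mono stop_max_iavg a supp)
  also have "\<dots> = 2 * \<epsilon> * (\<integral>x. (\<Sum>J\<in>?M. (a x)\<^sup>2 * indicator (dyadic_interval J) x) \<partial>lborel)"
    using intq by (subst Bochner_Integration.integral_sum) (auto simp: sum_distrib_left)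
  also have "\<dots> \<le> 2 * \<epsilon> * (\<integral>x. (a x)\<^sup>2 \<partial>lborel)"
  proof (intro mult_left_mono integral_mono)
    show "integrable lborel (\<lambda>x. \<Sum>J\<in>?M. (a x)\<^sup>2 * indicator (dyadic_interval J) x)"
      using intq by (rule Bochner_Integration.integrable_sum)
    show "integrable lborel (\<lambda>x. (a x)\<^sup>2)" by (rule fstep_lev_integrable[OF fstep_power2[OF a]])
    show "(\<Sum>J\<in>?M. (a x)\<^sup>2 * indicator (dyadic_interval J) x) \<le> (a x)\<^sup>2" for x
    proof (cases "\<exists>K\<in>?M. x \<in> dyadic_interval K")
      case True
      then show ?thesis using sum1[of _ x "\<lambda>_. (a x)\<^sup>2"] by auto
    next
      case False
      then have "(\<Sum>J\<in>?M. (a x)\<^sup>2 * indicator (dyadic_interval J) x) = 0" by (intro sum.neutral) auto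
      then show ?thesis by simp
    qed
  qed (use \<epsilon> in auto)
  finally show ?thesis .
qed

end

section \<open>Test functions on the plane\<close>

text \<open>One level for both variables suffices: a rectangle with sides of any coarser levels is a
  union of grid squares.\<close>

definition lev2 :: "int \<Rightarrow> real \<times> real \<Rightarrow> int \<times> int" where
  "lev2 N x = (lev N (fst x), lev N (snd x))"

lemma vimage_lev2: "lev2 N -` {z} = rect ((N, fst z), (N, snd z))"
  by (auto simp: lev2_def mem_rect mem_dyadic_interval)

lemma fstep_lev2_integrable: "fstep (lev2 N) a \<Longrightarrow> integrable lborel a"
  by (rule fstep_integrable) (auto simp: vimage_lev2 emeasure_rect)

lemma fstep_lev2_tensor:
  assumes a: "fstep (lev N) a" and b: "fstep (lev N) b"
  shows "fstep (lev2 N) (\<lambda>x. a (fst x) * b (snd x))"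
proof (rule fstepI)
  fix x y assume "lev2 N x = lev2 N y"
  then have "lev N (fst x) = lev N (fst y)" "lev N (snd x) = lev N (snd y)" by (simp_all add: lev2_def)
  then show "a (fst x) * b (snd x) = a (fst y) * b (snd y)"
    using fstep_cong[OF a] fstep_cong[OF b] by metis
next
  have "lev2 N ` {x. a (fst x) * b (snd x) \<noteq> 0} \<subseteq> lev N ` {x. a x \<noteq> 0} \<times> lev N ` {x. b x \<noteq> 0}"
    by (auto simp: lev2_def)
  then show "finite (lev2 N ` {x. a (fst x) * b (snd x) \<noteq> 0})"
    using fstep_finite[OF a] fstep_finite[OF b] by (meson finite_SigmaI finite_subset)
qed

lemma fstep_lev2_iterated:
  assumes "fstep (lev2 N) f"
  shows "(\<integral>x1. \<integral>x2. f (x1, x2) \<partial>lborel \<partial>lborel) = (\<integral>x. f x \<partial>lborel)"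
    and "integrable lborel (\<lambda>x1. \<integral>x2. f (x1, x2) \<partial>lborel)"
proof -
  have "integrable (lborel \<Otimes>\<^sub>M lborel) f"
    using fstep_lev2_integrable[OF assms] by (simp only: lborel_prod)
  from lborel_pair.integral_fst'[OF this] lborel_pair.integrable_fst'[OF this]
  show "(\<integral>x1. \<integral>x2. f (x1, x2) \<partial>lborel \<partial>lborel) = (\<integral>x. f x \<partial>lborel)"
    and "integrable lborel (\<lambda>x1. \<integral>x2. f (x1, x2) \<partial>lborel)"
    by (simp_all only: lborel_prod)
qed

lemma avg_tensor:
  assumes "fstep (lev N) a" "fstep (lev N) b"
  shows "avg (\<lambda>x. a (fst x) * b (snd x)) Q =
    (\<integral>x. a x * indicator (dyadic_interval (fst Q)) x \<partial>lborel) * (\<integral>x. b x * indicator (dyadic_interval (snd Q)) x \<partial>lborel) / rect_measure Q"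
proof -
  have int: "integrable (lborel \<Otimes>\<^sub>M lborel) (\<lambda>x. indicator (rect Q) x *\<^sub>R (a (fst x) * b (snd x)))"
    unfolding lborel_prod
    by (rule integrable_mult_indicator[OF _ fstep_lev2_integrable[OF fstep_lev2_tensor[OF assms]]]) simp
  have "(LINT x:rect Q|lborel. a (fst x) * b (snd x)) = (\<integral>x. indicator (rect Q) x *\<^sub>R (a (fst x) * b (snd x)) \<partial>(lborel \<Otimes>\<^sub>M lborel))"
    unfolding set_lebesgue_integral_def lborel_prod ..
  also have "\<dots> = (\<integral>x1. \<integral>x2. indicator (rect Q) (x1, x2) *\<^sub>R (a x1 * b x2) \<partial>lborel \<partial>lborel)"
    using lborel_pair.integral_fst'[OF int] by simp
  also have "\<dots> = (\<integral>x1. \<integral>x2. (a x1 * indicator (dyadic_interval (fst Q)) x1) * (b x2 * indicator (dyadic_interval (snd Q)) x2) \<partial>lborel \<partial>lborel)"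
    by (intro Bochner_Integration.integral_cong refl) (auto simp: indicator_def mem_rect)
  also have "\<dots> = (\<integral>x. a x * indicator (dyadic_interval (fst Q)) x \<partial>lborel) * (\<integral>x. b x * indicator (dyadic_interval (snd Q)) x \<partial>lborel)"
    by simp
  finally show ?thesis by (simp add: avg_def)
qed

lemma avg_sum:
  assumes "\<And>i. i \<in> S \<Longrightarrow> integrable lborel (f i)"
  shows "avg (\<lambda>x. \<Sum>i\<in>S. f i x) Q = (\<Sum>i\<in>S. avg (f i) Q)"
proof -
  have "set_integrable lborel (rect Q) (f i)" if "i \<in> S" for i
    unfolding set_integrable_def by (rule integrable_mult_indicator[OF _ assms[OF that]]) simp
  then have "(LINT x:rect Q|lborel. \<Sum>i\<in>S. f i x) = (\<Sum>i\<in>S. LINT x:rect Q|lborel. f i x)"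
    unfolding set_lebesgue_integral_def set_integrable_def
    by (simp add: scaleR_sum_right sum_distrib_left Bochner_Integration.integral_sum)
  then show ?thesis by (simp add: avg_def sum_divide_distrib)
qed

text \<open>The values and the default \<open>d\<close> are arbitrary because the lemma is applied
  to real functions and also to the set-valued map of slices, with the empty set as default.\<close>

lemma finite_range_fstep:
  assumes "\<And>x y. L x = L y \<Longrightarrow> f x = f y" "finite (L ` {x. f x \<noteq> d})"
  shows "finite (range f)"
proof (rule finite_subset)
  show "range f \<subseteq> insert d ((\<lambda>z. f (SOME y. L y = z)) ` (L ` {x. f x \<noteq> d}))"
  proof
    fix v assume "v \<in> range f"
    then obtain x where x: "v = f x" by blast
    have "L (SOME y. L y = L x) = L x" by (rule someI[of _ x]) simp
    then have "f (SOME y. L y = L x) = f x" by (rule assms(1))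
    then have "v = (\<lambda>z. f (SOME y. L y = z)) (L x)" using x by simp
    then show "v \<in> insert d ((\<lambda>z. f (SOME y. L y = z)) ` (L ` {x. f x \<noteq> d}))"
      using x by (cases "f x = d") blast+
  qed
  show "finite (insert d ((\<lambda>z. f (SOME y. L y = z)) ` (L ` {x. f x \<noteq> d})))"
    using assms(2) by blast
qed

lemma le_divide_ennreal_iff:
  assumes "0 < b" shows "c \<le> x / ennreal b \<longleftrightarrow> c * ennreal b \<le> x"
proof -
  have *: "ennreal (1 / b) * ennreal b = 1" using assms by (simp flip: ennreal_mult)
  have d: "x / ennreal b = x * ennreal (1 / b)"
    using assms by (simp add: divide_ennreal_def inverse_ennreal divide_inverse)
  show ?thesis
    unfolding d using mult_right_mono[of c "x * ennreal (1 / b)" "ennreal b"]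
      mult_right_mono[of "c * ennreal b" x "ennreal (1 / b)"] *
    by (auto simp: mult.assoc mult.commute[of "ennreal b"])
qed

text \<open>The average over \<open>I\<close> is at least the height \<open>b\<close> times the
  density \<open>c\<close> of the set where it is attained.\<close>

lemma dmax_ge:
  assumes "x \<in> dyadic_interval I" and [measurable]: "A \<in> sets borel"
    and "c * ilen I \<le> measure lborel (dyadic_interval I \<inter> A)" "0 \<le> c" "0 \<le> b"
    and h: "\<And>y. y \<in> A \<Longrightarrow> y \<in> dyadic_interval I \<Longrightarrow> ennreal b \<le> h y"
  shows "ennreal (b * c) \<le> dmax h x"
proof -
  have em: "emeasure lborel (dyadic_interval I \<inter> A) = ennreal (measure lborel (dyadic_interval I \<inter> A))"
  proof (rule emeasure_eq_ennreal_measure)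
    have "emeasure lborel (dyadic_interval I \<inter> A) \<le> emeasure lborel (dyadic_interval I)" by (intro emeasure_mono) auto
    then show "emeasure lborel (dyadic_interval I \<inter> A) \<noteq> top"
      by (auto simp: emeasure_dyadic_interval top_unique)
  qed
  have "ennreal (b * c) * ennreal (ilen I) = ennreal b * ennreal (c * ilen I)"
    using assms(4,5) by (simp add: ennreal_mult mult.assoc)
  also have "\<dots> \<le> ennreal b * emeasure lborel (dyadic_interval I \<inter> A)"
    unfolding em using assms(3) by (intro mult_left_mono ennreal_leI) auto
  also have "\<dots> = (\<integral>\<^sup>+y. ennreal b * indicator (dyadic_interval I \<inter> A) y \<partial>lborel)"
    by (subst nn_integral_cmult_indicator) auto
  also have "\<dots> \<le> (\<integral>\<^sup>+y\<in>dyadic_interval I. h y \<partial>lborel)"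
    using h by (intro nn_integral_mono) (auto simp: indicator_def)
  finally have "ennreal (b * c) \<le> (\<integral>\<^sup>+y\<in>dyadic_interval I. h y \<partial>lborel) / ennreal (ilen I)"
    by (subst le_divide_ennreal_iff) auto
  also have "\<dots> \<le> dmax h x" unfolding dmax_def using assms(1) by (intro SUP_upper) auto
  finally show ?thesis .
qed


section \<open>The stopping projection in two parameters\<close>

context
  fixes N :: int and \<epsilon> :: real and \<Omega> :: "(real \<times> real) set"
  assumes \<Omega>: "fstep (lev2 N) (indicator \<Omega>)" and \<epsilon>: "0 < \<epsilon>" "\<epsilon> < 1"
begin

definition slice :: "real \<Rightarrow> real set" where
  "slice x1 = {x2. (x1, x2) \<in> \<Omega>}"

text \<open>All intervals that are selected on some slice. Only finitely many different slices
  occur, so a single finite sum can replace the families varying with the slice.\<close>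

definition slice_fams :: "dint set" where
  "slice_fams = (\<Union>T\<in>range slice. stop_fam N \<epsilon> T)"

text \<open>This set plays the role of \<open>G\<close> for the stopping time in the first
  variable.\<close>

definition slice_sel :: "dint \<Rightarrow> real set" where
  "slice_sel J = {x1. J \<in> stop_fam N \<epsilon> (slice x1)}"

definition slice_coef :: "dint \<Rightarrow> real \<Rightarrow> real" where
  "slice_coef J x1 = indicator (slice_sel J) x1 * hcoef (indicator (slice x1)) J"

text \<open>
  The stopping set in the first variable depends on the Haar interval \<open>J\<close> of the second one. Since
  the one-dimensional error estimate is relative to the norm of each coefficient, the errors can be
  summed over \<open>J\<close>.
\<close>

definition bistop_proj :: "real \<times> real \<Rightarrow> real" where
  "bistop_proj x = (\<Sum>J\<in>slice_fams. stop_proj N \<epsilon> (slice_sel J) (slice_coef J) (fst x) * haar J (snd x))"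

lemma base_set_cong: "lev2 N x = lev2 N y \<Longrightarrow> x \<in> \<Omega> \<longleftrightarrow> y \<in> \<Omega>"
  using fstep_cong[OF \<Omega>, of x y] by (auto simp: indicator_def split: if_splits)

lemma base_set_finite: "finite (lev2 N ` \<Omega>)"
proof -
  have "{x. indicator \<Omega> x \<noteq> (0::real)} = \<Omega>" by (auto simp: indicator_def)
  with fstep_finite[OF \<Omega>] show ?thesis by simp
qed

lemma slice_cong: "lev N x = lev N y \<Longrightarrow> slice x = slice y"
proof -
  assume eq: "lev N x = lev N y"
  have "(x, z) \<in> \<Omega> \<longleftrightarrow> (y, z) \<in> \<Omega>" for z by (rule base_set_cong) (simp only: lev2_def fst_conv snd_conv eq)
  then show ?thesis by (simp add: slice_def)
qed

lemma fstep_slice: "fstep (lev N) (indicator (slice x1))"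
proof (rule fstepI)
  fix x y assume "lev N x = lev N y"
  then have "(x1, x) \<in> \<Omega> \<longleftrightarrow> (x1, y) \<in> \<Omega>" by (intro base_set_cong) (simp add: lev2_def)
  then show "indicator (slice x1) x = (indicator (slice x1) y :: real)" by (simp add: slice_def indicator_def)
next
  have "lev N ` {x. indicator (slice x1) x \<noteq> (0::real)} \<subseteq> snd ` lev2 N ` \<Omega>"
    by (force simp: slice_def lev2_def indicator_def)
  then show "finite (lev N ` {x. indicator (slice x1) x \<noteq> (0::real)})"
    using base_set_finite finite_subset by blast
qed

lemma finite_slice_support: "finite (lev N ` {x. slice x \<noteq> {}})"
proof -
  have "lev N ` {x. slice x \<noteq> {}} \<subseteq> fst ` lev2 N ` \<Omega>"
    by (force simp: slice_def lev2_def)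
  then show ?thesis using base_set_finite finite_subset by blast
qed

lemma slice_fams_finite: "finite slice_fams"
  unfolding slice_fams_def
proof (intro finite_UN_I)
  show "finite (range slice)" by (rule finite_range_fstep[OF slice_cong finite_slice_support])
  show "finite (stop_fam N \<epsilon> T)" if "T \<in> range slice" for T
    using that stop_fam_finite[OF fstep_slice \<epsilon>] by blast
qed

lemma slice_fams_level: "J \<in> slice_fams \<Longrightarrow> fst J < N"
  by (auto simp: slice_fams_def stop_fam_def)

lemma fstep_slice_sel: "fstep (lev N) (indicator (slice_sel J))"
proof (rule fstepI)
  fix x y assume "lev N x = lev N y"
  then have "slice x = slice y" by (rule slice_cong)
  then show "indicator (slice_sel J) x = (indicator (slice_sel J) y :: real)" by (simp add: slice_sel_def indicator_def)
next
  have "{x. indicator (slice_sel J) x \<noteq> (0::real)} \<subseteq> {x. slice x \<noteq> {}}"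
    by (auto simp: slice_sel_def stop_fam_def indicator_def)
  then show "finite (lev N ` {x. indicator (slice_sel J) x \<noteq> (0::real)})"
    using finite_slice_support by (meson finite_subset image_mono)
qed

lemma fstep_slice_coef: "fstep (lev N) (slice_coef J)"
proof -
  have "fstep (lev N) (\<lambda>x. indicator (slice_sel J) x * hcoef (indicator (slice x)) J)"
  proof (rule fstep_mult[OF fstep_slice_sel])
    fix x y assume "lev N x = lev N y"
    then have "slice x = slice y" by (rule slice_cong)
    then show "hcoef (indicator (slice x)) J = hcoef (indicator (slice y)) J" by (simp only:)
  qed
  then show ?thesis unfolding slice_coef_def .
qed

lemma slice_coef_supp: "slice_coef J x \<noteq> 0 \<Longrightarrow> x \<in> slice_sel J"
  by (auto simp: slice_coef_def indicator_def split: if_splits)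

text \<open>The intermediate stage, projected in the second variable only. It splits the error into
  two one-dimensional ones.\<close>

definition slice_proj :: "real \<times> real \<Rightarrow> real" where
  "slice_proj x = (\<Sum>J\<in>slice_fams. slice_coef J (fst x) * haar J (snd x))"

lemma slice_proj_eq: "slice_proj (x1, x2) = stop_proj N \<epsilon> (slice x1) (indicator (slice x1)) x2"
proof -
  have "(\<Sum>J\<in>slice_fams. slice_coef J x1 * haar J x2) = (\<Sum>J\<in>stop_fam N \<epsilon> (slice x1). slice_coef J x1 * haar J x2)"
    using slice_fams_finite
    by (intro sum.mono_neutral_right) (auto simp: slice_fams_def slice_coef_def slice_sel_def)
  then show ?thesis
    by (simp add: slice_proj_def stop_proj_def slice_coef_def slice_sel_def)
qed

lemma fstep_slice_proj: "fstep (lev2 N) slice_proj"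
  unfolding slice_proj_def
  by (intro fstep_sum fstep_lev2_tensor fstep_slice_coef fstep_haar slice_fams_level)

lemma fstep_bistop_proj: "fstep (lev2 N) bistop_proj"
  unfolding bistop_proj_def
  by (intro fstep_sum fstep_lev2_tensor fstep_stop_proj[OF fstep_slice_sel \<epsilon>] fstep_haar slice_fams_level)

lemma integral_indicator_power2: "(\<integral>x. (indicator \<Omega> x)\<^sup>2 \<partial>lborel) = measure lborel \<Omega>"
proof -
  have "(\<lambda>x. (indicator \<Omega> x :: real)\<^sup>2) = indicator \<Omega>" by (auto simp: indicator_def)
  then show ?thesis by simp
qed

lemma slice_proj_error:
  "(\<integral>x. (indicator \<Omega> x - slice_proj x)\<^sup>2 \<partial>lborel) \<le> 2 * \<epsilon> * measure lborel \<Omega>"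
proof -
  have fs1: "fstep (lev2 N) (\<lambda>x. (indicator \<Omega> x - slice_proj x)\<^sup>2)"
    by (intro fstep_power2 fstep_diff \<Omega> fstep_slice_proj)
  have fs2: "fstep (lev2 N) (\<lambda>x. (indicator \<Omega> x)\<^sup>2)"
    by (intro fstep_power2 \<Omega>)
  have ind: "indicator \<Omega> (x1, x2) = (indicator (slice x1) x2 :: real)" for x1 x2
    by (simp add: slice_def indicator_def)
  have "(\<integral>x. (indicator \<Omega> x - slice_proj x)\<^sup>2 \<partial>lborel)
    = (\<integral>x1. \<integral>x2. (indicator \<Omega> (x1, x2) - slice_proj (x1, x2))\<^sup>2 \<partial>lborel \<partial>lborel)"
    by (rule fstep_lev2_iterated(1)[OF fs1, symmetric])
  also have "\<dots> \<le> (\<integral>x1. 2 * \<epsilon> * (\<integral>x2. (indicator \<Omega> (x1, x2))\<^sup>2 \<partial>lborel) \<partial>lborel)"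
  proof (rule integral_mono)
    show "integrable lborel (\<lambda>x1. \<integral>x2. (indicator \<Omega> (x1, x2) - slice_proj (x1, x2))\<^sup>2 \<partial>lborel)"
      by (rule fstep_lev2_iterated(2)[OF fs1])
    show "integrable lborel (\<lambda>x1. 2 * \<epsilon> * (\<integral>x2. (indicator \<Omega> (x1, x2))\<^sup>2 \<partial>lborel))"
      by (intro integrable_mult_right fstep_lev2_iterated(2)[OF fs2])
    show "(\<integral>x2. (indicator \<Omega> (x1, x2) - slice_proj (x1, x2))\<^sup>2 \<partial>lborel) \<le> 2 * \<epsilon> * (\<integral>x2. (indicator \<Omega> (x1, x2))\<^sup>2 \<partial>lborel)" for x1
      unfolding slice_proj_eq ind
      by (rule stop_proj_error[OF fstep_slice \<epsilon> fstep_slice]) (auto simp: indicator_def split: if_splits)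
  qed
  also have "\<dots> = 2 * \<epsilon> * (\<integral>x. (indicator \<Omega> x)\<^sup>2 \<partial>lborel)"
    using fstep_lev2_iterated(1)[OF fs2] by simp
  finally show ?thesis by (simp only: integral_indicator_power2)
qed

text \<open>Orthogonality in the second variable for every fixed first coordinate. The errors of the
  second stage, estimated separately for each \<open>J\<close>, can therefore be added without cross
  terms.\<close>

lemma integral_haar_expansion_power2:
  assumes "\<And>J. J \<in> slice_fams \<Longrightarrow> fstep (lev N) (d J)"
  shows "(\<integral>x. (\<Sum>J\<in>slice_fams. d J (fst x) * haar J (snd x))\<^sup>2 \<partial>lborel) = (\<Sum>J\<in>slice_fams. ilen J * (\<integral>x. (d J x)\<^sup>2 \<partial>lborel))"
proof -
  have fs: "fstep (lev2 N) (\<lambda>x. (\<Sum>J\<in>slice_fams. d J (fst x) * haar J (snd x))\<^sup>2)"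
    by (intro fstep_power2 fstep_sum fstep_lev2_tensor assms fstep_haar slice_fams_level)
  have "(\<integral>x. (\<Sum>J\<in>slice_fams. d J (fst x) * haar J (snd x))\<^sup>2 \<partial>lborel)
    = (\<integral>x1. \<integral>x2. (\<Sum>J\<in>slice_fams. d J x1 * haar J x2)\<^sup>2 \<partial>lborel \<partial>lborel)"
    using fstep_lev2_iterated(1)[OF fs] by simp
  also have "\<dots> = (\<integral>x1. (\<Sum>J\<in>slice_fams. ilen J * (d J x1)\<^sup>2) \<partial>lborel)"
    by (simp only: integral_haar_sum_power2[OF slice_fams_finite]) (simp only: mult.commute)
  also have "\<dots> = (\<Sum>J\<in>slice_fams. ilen J * (\<integral>x. (d J x)\<^sup>2 \<partial>lborel))"
    by (subst Bochner_Integration.integral_sum)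
      (auto intro!: integrable_mult_right fstep_lev_integrable fstep_power2 assms)
  finally show ?thesis .
qed

text \<open>The first stage costs \<open>2 * \<epsilon>\<close>; the second costs
  \<open>2 * \<epsilon>\<close> times the squared norm of \<open>slice_proj\<close>, itself at most
  \<open>2 + 4 * \<epsilon>\<close> times the measure. The triangle inequality for squares gives
  \<open>12 * \<epsilon> + 16 * \<epsilon>\<^sup>2\<close>, at most
  \<open>28 * \<epsilon>\<close>.\<close>

lemma bistop_proj_error:
  "(\<integral>x. (indicator \<Omega> x - bistop_proj x)\<^sup>2 \<partial>lborel) \<le> 28 * \<epsilon> * measure lborel \<Omega>"
proof -
  let ?m = "measure lborel \<Omega>"
  have int: "integrable lborel (\<lambda>x. (f x)\<^sup>2)" if "fstep (lev2 N) f" for f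
    using that by (intro fstep_lev2_integrable fstep_power2)
  have sq: "(a + b)\<^sup>2 \<le> 2 * a\<^sup>2 + 2 * b\<^sup>2" for a b :: real
    using zero_le_power2[of "a - b"] by (simp add: power2_eq_square algebra_simps)
  have "(\<integral>x. (slice_proj x)\<^sup>2 \<partial>lborel) \<le> (\<integral>x. 2 * (indicator \<Omega> x)\<^sup>2 + 2 * (indicator \<Omega> x - slice_proj x)\<^sup>2 \<partial>lborel)"
  proof (rule integral_mono)
    show "integrable lborel (\<lambda>x. 2 * (indicator \<Omega> x)\<^sup>2 + 2 * (indicator \<Omega> x - slice_proj x)\<^sup>2)"
      by (intro Bochner_Integration.integrable_add integrable_mult_right int fstep_diff \<Omega> fstep_slice_proj)
    show "(slice_proj x)\<^sup>2 \<le> 2 * (indicator \<Omega> x)\<^sup>2 + 2 * (indicator \<Omega> x - slice_proj x)\<^sup>2" for x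
      using sq[of "indicator \<Omega> x" "slice_proj x - indicator \<Omega> x"] by (simp add: power2_commute)
  qed (intro int fstep_slice_proj)
  also have "\<dots> = 2 * ?m + 2 * (\<integral>x. (indicator \<Omega> x - slice_proj x)\<^sup>2 \<partial>lborel)"
    using int[OF \<Omega>] int[OF fstep_diff[OF \<Omega> fstep_slice_proj]]
    by (simp add: integral_indicator_power2)
  also have "\<dots> \<le> 2 * ?m + 2 * (2 * \<epsilon> * ?m)"
    using slice_proj_error by simp
  finally have f1: "(\<integral>x. (slice_proj x)\<^sup>2 \<partial>lborel) \<le> (2 + 4 * \<epsilon>) * ?m" by (simp add: algebra_simps)
  have "(\<integral>x. (slice_proj x - bistop_proj x)\<^sup>2 \<partial>lborel)
    = (\<integral>x. (\<Sum>J\<in>slice_fams. (slice_coef J (fst x) - stop_proj N \<epsilon> (slice_sel J) (slice_coef J) (fst x)) * haar J (snd x))\<^sup>2 \<partial>lborel)"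
    by (simp add: slice_proj_def bistop_proj_def left_diff_distrib sum_subtractf)
  also have "\<dots> = (\<Sum>J\<in>slice_fams. ilen J * (\<integral>x. (slice_coef J x - stop_proj N \<epsilon> (slice_sel J) (slice_coef J) x)\<^sup>2 \<partial>lborel))"
    by (intro integral_haar_expansion_power2 fstep_diff fstep_slice_coef fstep_stop_proj[OF fstep_slice_sel \<epsilon>])
  also have "\<dots> \<le> (\<Sum>J\<in>slice_fams. ilen J * (2 * \<epsilon> * (\<integral>x. (slice_coef J x)\<^sup>2 \<partial>lborel)))"
    by (intro sum_mono mult_left_mono stop_proj_error[OF fstep_slice_sel \<epsilon> fstep_slice_coef] slice_coef_supp) auto
  also have "\<dots> = 2 * \<epsilon> * (\<Sum>J\<in>slice_fams. ilen J * (\<integral>x. (slice_coef J x)\<^sup>2 \<partial>lborel))"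
    by (simp add: sum_distrib_left ac_simps)
  also have "\<dots> = 2 * \<epsilon> * (\<integral>x. (slice_proj x)\<^sup>2 \<partial>lborel)"
    unfolding slice_proj_def using integral_haar_expansion_power2[OF fstep_slice_coef] by simp
  also have "\<dots> \<le> 2 * \<epsilon> * ((2 + 4 * \<epsilon>) * ?m)" using f1 \<epsilon> by (intro mult_left_mono) auto
  finally have f2: "(\<integral>x. (slice_proj x - bistop_proj x)\<^sup>2 \<partial>lborel) \<le> (4 * \<epsilon> + 8 * \<epsilon> * \<epsilon>) * ?m"
    by (simp add: algebra_simps)
  have "(\<integral>x. (indicator \<Omega> x - bistop_proj x)\<^sup>2 \<partial>lborel)
    \<le> (\<integral>x. 2 * (indicator \<Omega> x - slice_proj x)\<^sup>2 + 2 * (slice_proj x - bistop_proj x)\<^sup>2 \<partial>lborel)"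
  proof (rule integral_mono)
    show "integrable lborel (\<lambda>x. 2 * (indicator \<Omega> x - slice_proj x)\<^sup>2 + 2 * (slice_proj x - bistop_proj x)\<^sup>2)"
      by (intro Bochner_Integration.integrable_add integrable_mult_right int fstep_diff \<Omega> fstep_slice_proj fstep_bistop_proj)
    show "(indicator \<Omega> x - bistop_proj x)\<^sup>2 \<le> 2 * (indicator \<Omega> x - slice_proj x)\<^sup>2 + 2 * (slice_proj x - bistop_proj x)\<^sup>2" for x
      using sq[of "indicator \<Omega> x - slice_proj x" "slice_proj x - bistop_proj x"] by simp
  qed (intro int fstep_diff \<Omega> fstep_bistop_proj)
  also have "\<dots> = 2 * (\<integral>x. (indicator \<Omega> x - slice_proj x)\<^sup>2 \<partial>lborel) + 2 * (\<integral>x. (slice_proj x - bistop_proj x)\<^sup>2 \<partial>lborel)"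
    using int[OF fstep_diff[OF \<Omega> fstep_slice_proj]] int[OF fstep_diff[OF fstep_slice_proj fstep_bistop_proj]] by simp
  also have "\<dots> \<le> 2 * (2 * \<epsilon> * ?m) + 2 * ((4 * \<epsilon> + 8 * \<epsilon> * \<epsilon>) * ?m)"
    using slice_proj_error f2 by simp
  also have "\<dots> = (12 * \<epsilon> + 16 * (\<epsilon> * \<epsilon>)) * ?m" by (simp add: algebra_simps)
  also have "\<dots> \<le> 28 * \<epsilon> * ?m"
  proof (intro mult_right_mono)
    have "\<epsilon> * \<epsilon> \<le> \<epsilon> * 1" using \<epsilon> by (intro mult_left_mono) auto
    then show "12 * \<epsilon> + 16 * (\<epsilon> * \<epsilon>) \<le> 28 * \<epsilon>" by simp
  qed simp
  finally show ?thesis .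
qed

text \<open>By cancellation \<open>Q\<close> lies in the product of a selected pair
  \<open>I\<close>, \<open>J\<close>. The interval \<open>I\<close> lies in some \<open>I'\<close>
  of which \<open>slice_sel J\<close> fills more than \<epsilon>, and for each \<open>y\<close> in
  \<open>slice_sel J\<close> the interval \<open>J\<close> lies in some \<open>J'\<close> of which
  the slice at \<open>y\<close> fills more than \<epsilon>. As \<open>J'\<close> varies with
  \<open>y\<close>, the iterated maximal function is bounded below, not \<open>smax\<close>.\<close>

lemma avg_bistop_proj:
  assumes "avg bistop_proj Q \<noteq> 0" "x \<in> rect Q"
  shows "ennreal (\<epsilon>\<^sup>2) \<le> dmax (\<lambda>y1. dmax (\<lambda>y2. indicator \<Omega> (y1, y2)) (snd x)) (fst x)"
proof -
  let ?q1 = "dyadic_interval (fst Q)" and ?q2 = "dyadic_interval (snd Q)"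
  have "avg bistop_proj Q = (\<Sum>J\<in>slice_fams. avg (\<lambda>x. stop_proj N \<epsilon> (slice_sel J) (slice_coef J) (fst x) * haar J (snd x)) Q)"
    unfolding bistop_proj_def
    by (intro avg_sum fstep_lev2_integrable[where N=N] fstep_lev2_tensor fstep_stop_proj[OF fstep_slice_sel \<epsilon>] fstep_haar slice_fams_level)
  with assms(1) obtain J where J: "J \<in> slice_fams"
    and "avg (\<lambda>x. stop_proj N \<epsilon> (slice_sel J) (slice_coef J) (fst x) * haar J (snd x)) Q \<noteq> 0"
    by (metis (mono_tags, lifting) sum.neutral)
  then have "(\<integral>x. stop_proj N \<epsilon> (slice_sel J) (slice_coef J) x * indicator ?q1 x \<partial>lborel) \<noteq> 0"
    and J2: "(\<integral>x. haar J x * indicator ?q2 x \<partial>lborel) \<noteq> 0"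
    by (subst (asm) avg_tensor[OF fstep_stop_proj[OF fstep_slice_sel \<epsilon>] fstep_haar[OF slice_fams_level[OF J]]]; simp)+
  moreover have "(\<integral>x. stop_proj N \<epsilon> (slice_sel J) (slice_coef J) x * indicator ?q1 x \<partial>lborel)
    = (\<Sum>I\<in>stop_fam N \<epsilon> (slice_sel J). hcoef (slice_coef J) I * (\<integral>x. haar I x * indicator ?q1 x \<partial>lborel))"
  proof -
    have int: "integrable lborel (\<lambda>x. haar I x * indicator ?q1 x)" for I
      using integrable_mult_indicator[OF _ haar_integrable, of ?q1 I] by (simp add: mult.commute)
    show ?thesis
      using int by (simp add: stop_proj_def sum_distrib_right mult.assoc Bochner_Integration.integral_sum)
  qed
  ultimately obtain I where I: "I \<in> stop_fam N \<epsilon> (slice_sel J)" and I2: "(\<integral>x. haar I x * indicator ?q1 x \<partial>lborel) \<noteq> 0"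
    by (metis (mono_tags, lifting) mult_zero_right sum.neutral)
  have x: "fst x \<in> dyadic_interval I" "snd x \<in> dyadic_interval J"
    using assms(2) integral_haar_on_dyadic[OF I2] integral_haar_on_dyadic[OF J2] by (auto simp: mem_rect)
  obtain I' where I': "dense_in \<epsilon> (slice_sel J) I'" "dyadic_interval I \<subseteq> dyadic_interval I'"
    using I by (auto simp: stop_fam_def)
  have "ennreal (\<epsilon> * \<epsilon>) \<le> dmax (\<lambda>y1. dmax (\<lambda>y2. indicator \<Omega> (y1, y2)) (snd x)) (fst x)"
  proof (rule dmax_ge)
    show "fst x \<in> dyadic_interval I'" using x I' by blast
    show "slice_sel J \<in> sets borel" by (rule stop_set_measurable[OF fstep_slice_sel \<epsilon>])
    show "\<epsilon> * ilen I' \<le> measure lborel (dyadic_interval I' \<inter> slice_sel J)" using I'(1) by (simp add: dense_in_def)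
    fix y assume "y \<in> slice_sel J"
    then obtain J' where J': "dense_in \<epsilon> (slice y) J'" "dyadic_interval J \<subseteq> dyadic_interval J'"
      by (auto simp: slice_sel_def stop_fam_def)
    have "ennreal (1 * \<epsilon>) \<le> dmax (\<lambda>y2. indicator \<Omega> (y, y2)) (snd x)"
    proof (rule dmax_ge)
      show "snd x \<in> dyadic_interval J'" using x J' by blast
      show "slice y \<in> sets borel" by (rule stop_set_measurable[OF fstep_slice \<epsilon>])
      show "\<epsilon> * ilen J' \<le> measure lborel (dyadic_interval J' \<inter> slice y)" using J'(1) by (simp add: dense_in_def)
    qed (use \<epsilon> in \<open>auto simp: slice_def\<close>)
    then show "ennreal \<epsilon> \<le> dmax (\<lambda>y2. indicator \<Omega> (y, y2)) (snd x)" by simp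
  qed (use \<epsilon> in auto)
  then show ?thesis by (simp add: power2_eq_square)
qed

end

section \<open>Existence of test functions\<close>

lemma markov_emeasure:
  assumes [measurable]: "u \<in> borel_measurable M" and c: "0 < c"
  shows "emeasure M {x\<in>space M. ennreal c \<le> u x} \<le> ennreal (1 / c) * (\<integral>\<^sup>+x. u x \<partial>M)"
proof -
  have "ennreal c * emeasure M {x\<in>space M. ennreal c \<le> u x} = (\<integral>\<^sup>+x. ennreal c * indicator {x\<in>space M. ennreal c \<le> u x} x \<partial>M)"
    by (subst nn_integral_cmult_indicator) auto
  also have "\<dots> \<le> (\<integral>\<^sup>+x. u x \<partial>M)"
    by (intro nn_integral_mono) (auto simp: indicator_def)
  finally have "ennreal (1 / c) * (ennreal c * emeasure M {x\<in>space M. ennreal c \<le> u x}) \<le> ennreal (1 / c) * (\<integral>\<^sup>+x. u x \<partial>M)"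
    by (rule mult_left_mono) simp
  then show ?thesis using c by (simp add: mult.assoc[symmetric] flip: ennreal_mult)
qed

lemma markov_epowr:
  assumes [measurable]: "u \<in> borel_measurable borel" and c: "0 < c" and s: "0 < s"
  shows "emeasure lborel {x. ennreal c \<le> u x} \<le> ennreal (1 / c powr s) * pint s u"
proof -
  have "{x. ennreal c \<le> u x} = {x. ennreal (c powr s) \<le> epowr (u x) s}"
    using c s epowr_le_iff[of "1 / s" "ennreal (c powr s)"] by (auto simp: epowr_ennreal powr_powr)
  then show ?thesis
    using markov_emeasure[of "\<lambda>x. epowr (u x) s" lborel "c powr s"] c by simp
qed

text \<open>On a set of finite measure this bounds the integral of a \<open>p\<close>-th power by an
  \<open>L\<^sup>2\<close> estimate, in place of Hoelder's inequality.\<close>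

lemma epowr_le_1_plus: "0 < p \<Longrightarrow> p \<le> 2 \<Longrightarrow> epowr t p \<le> 1 + epowr t 2"
proof (cases t)
  case (real r)
  assume p: "0 < p" "p \<le> 2"
  have "r powr p \<le> 1 + r\<^sup>2"
  proof (cases "r \<le> 1")
    case True
    then have "r powr p \<le> 1" using real p by (intro powr_le1) auto
    then show ?thesis by (simp add: add_increasing2)
  next
    case False
    then have "r powr p \<le> r powr 2" using p by (intro powr_mono) auto
    then show ?thesis using False by simp
  qed
  then show ?thesis using real by (simp add: epowr_ennreal ennreal_leI flip: ennreal_1 ennreal_plus)
qed simp

lemma smax_strong_type_2:
  assumes "h \<in> borel_measurable borel"
  shows "pint 2 (smax h) \<le> 64 * pint 2 h"
    and "(\<integral>\<^sup>+x. epowr (dmax (\<lambda>y1. dmax (\<lambda>y2. h (y1, y2)) (snd x)) (fst x)) 2 \<partial>lborel) \<le> 64 * pint 2 h"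
  using smax_strong_type[OF assms, of 2] dmax_dmax_strong_type[OF assms, of 2] by simp_all

lemma locally_integrable_if_integrable: "integrable lborel f \<Longrightarrow> locally_integrable f"
  unfolding locally_integrable_def set_integrable_def
  by (intro allI impI integrable_mult_indicator) (auto simp: compact_imp_closed borel_closed)

lemma nn_integral_indicator_epowr:
  assumes "A \<in> sets borel" shows "pint s (indicator A) = emeasure lborel A"
proof -
  have "pint s (indicator A) = (\<integral>\<^sup>+x. indicator A x \<partial>lborel)"
    by (intro nn_integral_cong) (auto simp: indicator_def)
  then show ?thesis using assms by simp
qed

lemma avg_indicator: "A \<in> sets borel \<Longrightarrow> avg (indicator A) R = measure lborel (rect R \<inter> A) / rect_measure R"
  by (simp add: avg_def set_lebesgue_integral_def indicator_inter_arith[symmetric])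

lemma fmeasurable_rect: "rect R \<in> fmeasurable lborel"
  by (intro fmeasurableI) (auto simp: emeasure_rect)

lemma fstep_lev2_fmeasurable:
  assumes "fstep (lev2 N) (indicator A)" shows "A \<in> fmeasurable lborel"
  using fstep_lev2_integrable[OF assms] by (auto simp: integrable_indicator_iff fmeasurable_def)

lemma avg_diff:
  assumes "integrable lborel f" "integrable lborel h"
  shows "avg (\<lambda>x. f x - h x) R = avg f R - avg h R"
proof -
  have "set_integrable lborel (rect R) f" "set_integrable lborel (rect R) h"
    using assms unfolding set_integrable_def by (intro integrable_mult_indicator; simp)+
  then show ?thesis by (simp add: avg_def set_integral_diff diff_divide_distrib)
qed

lemma abs_avg_le_smax: "x \<in> rect R \<Longrightarrow> ennreal \<bar>avg f R\<bar> \<le> smax (\<lambda>y. ennreal \<bar>f y\<bar>) x"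
  using abs_avg_le_max_d max_d_le_smax order_trans by blast

lemma nn_integral_fstep_power2:
  assumes "fstep (lev2 N) f"
  shows "(\<integral>\<^sup>+x. epowr (ennreal \<bar>f x\<bar>) 2 \<partial>lborel) = ennreal (\<integral>x. (f x)\<^sup>2 \<partial>lborel)"
proof -
  have "(\<integral>\<^sup>+x. ennreal ((f x)\<^sup>2) \<partial>lborel) = ennreal (\<integral>x. (f x)\<^sup>2 \<partial>lborel)"
    using fstep_lev2_integrable[OF fstep_power2[OF assms]] by (intro nn_integral_eq_integral) auto
  then show ?thesis by (simp add: epowr_ennreal)
qed

text \<open>The set \<open>E\<close> collects the rectangles on which the lower bound for the averages may fail.\<close>

definition test_pair :: "real \<Rightarrow> real \<Rightarrow> real \<Rightarrow> (real \<times> real) set \<Rightarrow> (real \<times> real \<Rightarrow> real) \<Rightarrow> (real \<times> real) set \<Rightarrow> bool" where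
  "test_pair p C \<delta> \<Omega> f E \<longleftrightarrow> integrable lborel f \<and>
     pint p (max_d f) \<le> ennreal (C * measure lborel \<Omega>) \<and>
     E \<in> sets borel \<and> emeasure lborel E \<le> ennreal (\<delta> * measure lborel \<Omega>) \<and>
     (\<forall>R. rect_measure R \<le> 2 * measure lborel (rect R \<inter> \<Omega>) \<longrightarrow> 1 / 4 \<le> \<bar>avg f R\<bar> \<or> rect R \<subseteq> E)"

text \<open>The strong maximal theorem applies to the indicator, whose averages over the relevant
  rectangles are at least 1/2, so the exceptional set is empty.\<close>

lemma test_pair_gt_1:
  assumes p: "1 < p" and \<delta>: "0 < \<delta>"
  obtains C :: real where "0 < C" "\<And>N \<Omega>. fstep (lev2 N) (indicator \<Omega>) \<Longrightarrow> \<exists>f E. test_pair p C \<delta> \<Omega> f E"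
proof (rule that)
  show "0 < (2 powr p * p / (p - 1))\<^sup>2" using p by simp
  fix N \<Omega> assume "fstep (lev2 N) (indicator \<Omega>)"
  then have \<Omega>: "\<Omega> \<in> fmeasurable lborel" by (rule fstep_lev2_fmeasurable)
  then have [measurable]: "\<Omega> \<in> sets borel" by auto
  have int: "integrable lborel (indicator \<Omega> :: real \<times> real \<Rightarrow> real)"
    using \<Omega> by (auto simp: integrable_indicator_iff fmeasurable_def)
  have "test_pair p ((2 powr p * p / (p - 1))\<^sup>2) \<delta> \<Omega> (indicator \<Omega>) {}"
    unfolding test_pair_def
  proof (intro conjI allI impI)
    have "pint p (max_d (indicator \<Omega>)) \<le> pint p (smax (\<lambda>y. ennreal \<bar>indicator \<Omega> y\<bar>))"
      using p by (intro nn_integral_mono epowr_mono max_d_le_smax) auto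
    also have "\<dots> \<le> ennreal ((2 powr p * p / (p - 1))\<^sup>2) * (\<integral>\<^sup>+x. epowr (ennreal \<bar>indicator \<Omega> x\<bar>) p \<partial>lborel)"
      using p by (intro smax_strong_type) auto
    also have "(\<integral>\<^sup>+x. epowr (ennreal \<bar>indicator \<Omega> x\<bar>) p \<partial>lborel) = emeasure lborel \<Omega>"
      by (subst nn_integral_indicator_epowr[symmetric, of _ p]) (auto simp: ennreal_indicator)
    also have "\<dots> = ennreal (measure lborel \<Omega>)" by (rule emeasure_eq_measure2[OF \<Omega>])
    finally show "pint p (max_d (indicator \<Omega>)) \<le> ennreal ((2 powr p * p / (p - 1))\<^sup>2 * measure lborel \<Omega>)"
      by (simp add: ennreal_mult)
    fix R assume "rect_measure R \<le> 2 * measure lborel (rect R \<inter> \<Omega>)"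
    then have "1 / 2 \<le> avg (indicator \<Omega>) R" by (simp add: avg_indicator field_simps)
    then show "1 / 4 \<le> \<bar>avg (indicator \<Omega>) R\<bar> \<or> rect R \<subseteq> {}" by simp
  qed (use int \<delta> in auto)
  then show "\<exists>f E. test_pair p ((2 powr p * p / (p - 1))\<^sup>2) \<delta> \<Omega> f E" by blast
qed

lemma test_pair_le_1:
  assumes p: "0 < p" "p \<le> 1" and \<delta>: "0 < \<delta>"
  obtains C :: real where "0 < C" "\<And>N \<Omega>. fstep (lev2 N) (indicator \<Omega>) \<Longrightarrow> \<exists>f E. test_pair p C \<delta> \<Omega> f E"
proof (rule that)
  \<comment> \<open>The measure of \<open>E\<close> collects 16 from Markov's inequality in
    \<open>L\<^sup>2\<close> at height 1/4, 64 from the maximal theorem and 28 from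
    \<open>bistop_proj_error\<close>.\<close>
  define \<epsilon> where "\<epsilon> = min (1 / 2) (\<delta> / (16 * 64 * 28))"
  have \<epsilon>: "0 < \<epsilon>" "\<epsilon> < 1" "\<epsilon> \<le> 1 / 2" and \<epsilon>\<delta>: "16 * 64 * 28 * \<epsilon> \<le> \<delta>" using \<delta> by (auto simp: \<epsilon>_def)
  \<comment> \<open>The summands bound the measure of \<open>W\<close> and the squared norm of the
    maximal function of \<open>f\<close>; the squared norm of \<open>f\<close> is at most 30 times
    the measure, as \<epsilon> \<le> 1/2.\<close>
  define C where "C = 64 / (\<epsilon>\<^sup>2)\<^sup>2 + 64 * 30"
  show "0 < C" using \<epsilon> by (auto simp: C_def intro!: add_pos_pos)
  fix N \<Omega> assume fs: "fstep (lev2 N) (indicator \<Omega>)"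
  then have \<Omega>: "\<Omega> \<in> fmeasurable lborel" by (rule fstep_lev2_fmeasurable)
  then have [measurable]: "\<Omega> \<in> sets borel" by auto
  let ?m = "measure lborel \<Omega>"
  have em: "emeasure lborel \<Omega> = ennreal ?m" by (rule emeasure_eq_measure2[OF \<Omega>])
  define f where "f = bistop_proj N \<epsilon> \<Omega>"
  have fsf: "fstep (lev2 N) f" unfolding f_def by (rule fstep_bistop_proj[OF fs \<epsilon>(1,2)])
  have int_f: "integrable lborel f" by (rule fstep_lev2_integrable[OF fsf])
  then have [measurable]: "f \<in> borel_measurable borel" by simp
  have int_\<Omega>: "integrable lborel (indicator \<Omega> :: real \<times> real \<Rightarrow> real)" by (rule fstep_lev2_integrable[OF fs])
  have err: "(\<integral>x. (indicator \<Omega> x - f x)\<^sup>2 \<partial>lborel) \<le> 28 * \<epsilon> * ?m"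
    unfolding f_def by (rule bistop_proj_error[OF fs \<epsilon>(1,2)])
  define E where "E = {x. ennreal (1 / 4) \<le> smax (\<lambda>y. ennreal \<bar>indicator \<Omega> y - f y\<bar>) x}"
  let ?dd = "\<lambda>x. dmax (\<lambda>y1. dmax (\<lambda>y2. indicator \<Omega> (y1, y2)) (snd x)) (fst x)"
  have [measurable]: "\<Omega> \<in> sets (borel \<Otimes>\<^sub>M borel)" using \<open>\<Omega> \<in> sets borel\<close> by (simp only: borel_prod)
  have "?dd \<in> borel_measurable (borel \<Otimes>\<^sub>M borel)" by measurable
  then have dd_meas [measurable]: "?dd \<in> borel_measurable borel" by (simp only: borel_prod)
  \<comment> \<open>The enlargement of \<Omega>: off \<open>W\<close> all averages of
    \<open>f\<close> vanish by \<open>avg_bistop_proj\<close>.\<close>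
  define W where "W = {x. ennreal (\<epsilon>\<^sup>2) \<le> ?dd x}"
  have [measurable]: "W \<in> sets borel" unfolding W_def using dd_meas by simp
  have "emeasure lborel W \<le> ennreal (1 / (\<epsilon>\<^sup>2) powr 2) * pint 2 ?dd"
    unfolding W_def using \<epsilon> by (intro markov_epowr dd_meas) auto
  also have "\<dots> \<le> ennreal (1 / (\<epsilon>\<^sup>2) powr 2) * (64 * pint 2 (indicator \<Omega>))"
    by (intro mult_left_mono smax_strong_type_2(2)) auto
  also have "\<dots> = ennreal (64 / (\<epsilon>\<^sup>2)\<^sup>2 * ?m)"
    using \<epsilon> by (simp add: nn_integral_indicator_epowr em mult.commute flip: ennreal_mult ennreal_numeral)
  finally have W: "emeasure lborel W \<le> ennreal (64 / (\<epsilon>\<^sup>2)\<^sup>2 * ?m)" .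
  have "(\<integral>x. (f x)\<^sup>2 \<partial>lborel) \<le> (\<integral>x. 2 * (indicator \<Omega> x)\<^sup>2 + 2 * (indicator \<Omega> x - f x)\<^sup>2 \<partial>lborel)"
  proof (rule integral_mono)
    have int: "integrable lborel (\<lambda>x. (f x)\<^sup>2)" if "fstep (lev2 N) f" for f
      using that by (intro fstep_lev2_integrable fstep_power2)
    show "integrable lborel (\<lambda>x. (f x)\<^sup>2)" by (rule int[OF fsf])
    show "integrable lborel (\<lambda>x. 2 * (indicator \<Omega> x)\<^sup>2 + 2 * (indicator \<Omega> x - f x)\<^sup>2)"
      by (intro Bochner_Integration.integrable_add integrable_mult_right int fstep_diff fs fsf)
    show "(f x)\<^sup>2 \<le> 2 * (indicator \<Omega> x)\<^sup>2 + 2 * (indicator \<Omega> x - f x)\<^sup>2" for x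
      using zero_le_power2[of "2 * indicator \<Omega> x - f x"] by (simp add: power2_eq_square algebra_simps)
  qed
  also have "\<dots> = 2 * ?m + 2 * (\<integral>x. (indicator \<Omega> x - f x)\<^sup>2 \<partial>lborel)"
    using fstep_lev2_integrable[OF fstep_power2[OF fs]] fstep_lev2_integrable[OF fstep_power2[OF fstep_diff[OF fs fsf]]]
    by (simp add: integral_indicator_power2[OF fs \<epsilon>(1,2)])
  also have "\<dots> \<le> 2 * ?m + 2 * (28 * \<epsilon> * ?m)" using err by simp
  also have "\<dots> \<le> 2 * ?m + 2 * (28 * (1 / 2) * ?m)"
    using \<epsilon> by (intro add_left_mono mult_left_mono mult_right_mono) auto
  finally have f2: "(\<integral>x. (f x)\<^sup>2 \<partial>lborel) \<le> 30 * ?m" by simp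
  have "test_pair p C \<delta> \<Omega> f E"
    unfolding test_pair_def
  proof (intro conjI allI impI)
    have pw: "epowr (max_d f x) p \<le> indicator W x + epowr (smax (\<lambda>y. ennreal \<bar>f y\<bar>) x) 2" for x
    proof (cases "x \<in> W")
      case True
      have "epowr (max_d f x) p \<le> 1 + epowr (max_d f x) 2" using p by (intro epowr_le_1_plus) auto
      also have "\<dots> \<le> 1 + epowr (smax (\<lambda>y. ennreal \<bar>f y\<bar>) x) 2"
        by (intro add_left_mono epowr_mono max_d_le_smax) auto
      finally show ?thesis using True by simp
    next
      case False
      have "avg f Q = 0" if "x \<in> rect Q" for Q
        using avg_bistop_proj[OF fs \<epsilon>(1,2) _ that] False unfolding f_def W_def by blast
      then have "max_d f x = 0" unfolding max_d_def by (auto simp: SUP_eq_iff bot_ennreal intro!: antisym SUP_least)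
      then show ?thesis by simp
    qed
    have "pint p (max_d f) \<le> (\<integral>\<^sup>+x. indicator W x + epowr (smax (\<lambda>y. ennreal \<bar>f y\<bar>) x) 2 \<partial>lborel)"
      by (intro nn_integral_mono pw)
    also have "\<dots> = emeasure lborel W + pint 2 (smax (\<lambda>y. ennreal \<bar>f y\<bar>))"
      by (simp add: nn_integral_add)
    also have "\<dots> \<le> ennreal (64 / (\<epsilon>\<^sup>2)\<^sup>2 * ?m) + 64 * ennreal (30 * ?m)"
    proof (intro add_mono W)
      have "pint 2 (smax (\<lambda>y. ennreal \<bar>f y\<bar>)) \<le> 64 * (\<integral>\<^sup>+x. epowr (ennreal \<bar>f x\<bar>) 2 \<partial>lborel)"
        by (rule smax_strong_type_2(1)) measurable
      also have "\<dots> \<le> 64 * ennreal (30 * ?m)"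
        unfolding nn_integral_fstep_power2[OF fsf] by (intro mult_left_mono ennreal_leI f2) auto
      finally show "pint 2 (smax (\<lambda>y. ennreal \<bar>f y\<bar>)) \<le> 64 * ennreal (30 * ?m)" .
    qed
    also have "\<dots> = ennreal (C * ?m)"
    proof -
      have "64 * ennreal (30 * ?m) = ennreal (64 * (30 * ?m))" by (subst ennreal_mult) auto
      then show ?thesis by (simp add: C_def algebra_simps flip: ennreal_plus)
    qed
    finally show "pint p (max_d f) \<le> ennreal (C * ?m)" .
    show "E \<in> sets borel" unfolding E_def by measurable
    have "emeasure lborel E \<le> ennreal (1 / (1 / 4) powr 2) * pint 2 (smax (\<lambda>y. ennreal \<bar>indicator \<Omega> y - f y\<bar>))"
      unfolding E_def by (intro markov_epowr) auto
    also have "\<dots> \<le> ennreal (1 / (1 / 4) powr 2) * (64 * (\<integral>\<^sup>+x. epowr (ennreal \<bar>indicator \<Omega> x - f x\<bar>) 2 \<partial>lborel))"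
      by (intro mult_left_mono smax_strong_type_2(1)) auto
    also have "\<dots> = 16 * (64 * ennreal (\<integral>x. (indicator \<Omega> x - f x)\<^sup>2 \<partial>lborel))"
      by (subst nn_integral_fstep_power2[OF fstep_diff[OF fs fsf]]) (simp add: power2_eq_square)
    also have "\<dots> \<le> 16 * (64 * ennreal (28 * \<epsilon> * ?m))"
      by (intro mult_left_mono ennreal_leI err) auto
    also have "\<dots> = ennreal (16 * (64 * (28 * \<epsilon> * ?m)))"
      using \<epsilon> by (subst ennreal_mult, simp, simp, subst ennreal_mult, simp_all)
    also have "\<dots> \<le> ennreal (\<delta> * ?m)"
      using mult_right_mono[OF \<epsilon>\<delta>, of ?m] by (intro ennreal_leI) (simp add: ac_simps)
    finally show "emeasure lborel E \<le> ennreal (\<delta> * ?m)" .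
    fix R assume "rect_measure R \<le> 2 * measure lborel (rect R \<inter> \<Omega>)"
    then have half: "1 / 2 \<le> avg (indicator \<Omega>) R" by (simp add: avg_indicator field_simps)
    show "1 / 4 \<le> \<bar>avg f R\<bar> \<or> rect R \<subseteq> E"
    proof (cases "1 / 4 \<le> \<bar>avg f R\<bar>")
      case False
      \<comment> \<open>The average of the indicator is at least 1/2, so the difference has average
        at least 1/4 in absolute value, and its maximal function is large on all of
        \<open>R\<close>.\<close>
      then have "1 / 4 \<le> \<bar>avg (\<lambda>x. indicator \<Omega> x - f x) R\<bar>"
        using half avg_diff[OF int_\<Omega> int_f, of R] by linarith
      then have "ennreal (1 / 4) \<le> ennreal \<bar>avg (\<lambda>x. indicator \<Omega> x - f x) R\<bar>" by (rule ennreal_leI)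
      then have "rect R \<subseteq> E" unfolding E_def using abs_avg_le_smax order_trans by blast
      then show ?thesis ..
    qed simp
  qed (rule int_f)
  then show "\<exists>f E. test_pair p C \<delta> \<Omega> f E" by blast
qed

lemma test_pair_exists:
  assumes p: "0 < p" and \<delta>: "0 < \<delta>"
  obtains C :: real where "0 < C" "\<And>N \<Omega>. fstep (lev2 N) (indicator \<Omega>) \<Longrightarrow> \<exists>f E. test_pair p C \<delta> \<Omega> f E"
proof (cases "p \<le> 1")
  case True
  from test_pair_le_1[OF p True \<delta>] that show ?thesis by blast
next
  case False
  then have "1 < p" by simp
  from test_pair_gt_1[OF this \<delta>] that show ?thesis by blast
qed

section \<open>Lower bound by the BMO norm\<close>

lemma fstep_comp:
  assumes a: "fstep L a" and "\<phi> 0 = (0::real)" shows "fstep L (\<lambda>x. \<phi> (a x))"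
proof (rule fstepI)
  show "\<phi> (a x) = \<phi> (a y)" if "L x = L y" for x y using fstep_cong[OF a that] by (rule arg_cong)
  show "finite (L ` {x. \<phi> (a x) \<noteq> 0})"
    by (rule finite_subset[OF image_mono fstep_finite[OF a]]) (use assms(2) in auto)
qed

lemma fstep_rsum:
  assumes "finite F"
  obtains N where "\<And>F' w. F' \<subseteq> F \<Longrightarrow> fstep (lev2 N) (rsum F' w)"
proof -
  \<comment> \<open>At least the finest level of a side occurring in \<open>F\<close>; the
    \<open>0\<close> keeps the set nonempty.\<close>
  define N where "N = Max (insert 0 ((\<lambda>R. fst (fst R)) ` F \<union> (\<lambda>R. fst (snd R)) ` F))"
  have N: "fst (fst R) \<le> N" "fst (snd R) \<le> N" if "R \<in> F" for R
    unfolding N_def using assms that by (auto intro!: Max_ge)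
  have "fstep (lev2 N) (indicator (rect R))" if "R \<in> F" for R
  proof -
    have "fstep (lev2 N) (\<lambda>x. indicator (dyadic_interval (fst R)) (fst x) * indicator (dyadic_interval (snd R)) (snd x))"
      by (intro fstep_lev2_tensor fstep_indicator_dyadic N that)
    moreover have "(\<lambda>x. indicator (dyadic_interval (fst R)) (fst x) * indicator (dyadic_interval (snd R)) (snd x)) = (indicator (rect R) :: _ \<Rightarrow> real)"
      by (auto simp: indicator_def mem_rect)
    ultimately show ?thesis by simp
  qed
  note fs = this
  show ?thesis
  proof (rule that[of N])
    fix F' w assume "F' \<subseteq> F"
    have "fstep (lev2 N) (\<lambda>x. \<Sum>R\<in>F'. (w R / rect_measure R) * indicator (rect R) x)"
      using \<open>F' \<subseteq> F\<close> by (intro fstep_sum fstep_cmult fs) auto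
    then show "fstep (lev2 N) (rsum F' w)" unfolding rsum_def by simp
  qed
qed

lemma indicator_superlevel: "indicator {x. c < h x} = (\<lambda>x. indicator {c<..} (h x))"
  by (auto simp: indicator_def)

lemma fstep_superlevel:
  assumes "fstep L h" "0 \<le> c" shows "fstep L (indicator {x. c < h x})"
  unfolding indicator_superlevel using assms(2) by (intro fstep_comp[OF assms(1), of "indicator {c<..}"]) simp

text \<open>As a superlevel set of a step function, the union becomes a finite union of grid cells
  through \<open>fstep_superlevel\<close>.\<close>

lemma Union_rect_superlevel:
  assumes "finite F" shows "(\<Union>R\<in>F. rect R) = {x. 0 < rsum F (\<lambda>_. 1) x}"
proof (intro set_eqI iffI)
  fix x assume "x \<in> (\<Union>R\<in>F. rect R)"
  then obtain R where R: "R \<in> F" "x \<in> rect R" by blast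
  have "0 < 1 * indicator (rect R) x / rect_measure R" using R by simp
  also have "\<dots> \<le> rsum F (\<lambda>_. 1) x"
    unfolding rsum_def using assms R by (intro member_le_sum) (auto simp: less_imp_le)
  finally show "x \<in> {x. 0 < rsum F (\<lambda>_. 1) x}" by simp
next
  fix x assume "x \<in> {x. 0 < rsum F (\<lambda>_. 1) x}"
  then have "(\<Sum>R\<in>F. 1 * indicator (rect R) x / rect_measure R) \<noteq> 0" unfolding rsum_def by simp
  then obtain R where "R \<in> F" "1 * indicator (rect R) x / rect_measure R \<noteq> 0"
    by (rule sum.not_neutral_contains_not_neutral)
  then show "x \<in> (\<Union>R\<in>F. rect R)" by (auto simp: indicator_def split: if_splits)
qed

lemma fmeasurable_Union_rect: "finite F \<Longrightarrow> (\<Union>R\<in>F. rect R) \<in> fmeasurable lborel"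
  by (intro fmeasurable.finite_UN) (auto intro: fmeasurable_rect)

text \<open>The average of \<open>h\<close> over \<open>R\<close> is a constant bounded by
  \<open>smax h\<close> on \<open>R\<close>, and at least half of \<open>R\<close> lies outside of
  \<open>Z\<close>; so it is at most twice the average of \<open>smax h\<close> cut off to the
  complement. The conclusion has the form required by \<open>rsum_duality\<close>.\<close>

lemma rsum_half_outside:
  assumes F: "finite F" and w: "\<And>R. R \<in> F \<Longrightarrow> 0 \<le> w R" and [measurable]: "Z \<in> sets borel" "h \<in> borel_measurable borel"
    and half: "\<And>R. R \<in> F \<Longrightarrow> 2 * measure lborel (rect R \<inter> Z) \<le> rect_measure R"
  shows "(\<Sum>R\<in>F. ennreal (w R) * ravg h R)
    \<le> (\<integral>\<^sup>+x. 2 * ennreal (rsum F w x) * indicator (- Z) x * smax h x \<partial>lborel)"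
proof -
  have le: "ravg h R
    \<le> (\<integral>\<^sup>+x\<in>rect R. 2 * indicator (- Z) x * smax h x \<partial>lborel) / ennreal (rect_measure R)" (is "?a \<le> _") if R: "R \<in> F" for R
  proof -
    have em: "emeasure lborel (rect R - Z) = ennreal (measure lborel (rect R - Z))"
      using fmeasurable_rect by (intro emeasure_eq_measure2 fmeasurable_Diff) auto
    have "measure lborel (rect R - Z) = rect_measure R - measure lborel (rect R \<inter> Z)"
      using measure_Diff[of lborel "rect R" "rect R \<inter> Z"] fmeasurable_rect[of R]
      by (simp add: Diff_Int_distrib2 measure_rect Diff_Int fmeasurable_def emeasure_rect)
    then have "rect_measure R \<le> 2 * measure lborel (rect R - Z)" using half[OF R] by simp
    then have "?a * ennreal (rect_measure R) \<le> ?a * (2 * emeasure lborel (rect R - Z))"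
      unfolding em by (intro mult_left_mono) (auto simp flip: ennreal_numeral ennreal_mult intro!: ennreal_leI)
    also have "\<dots> = (\<integral>\<^sup>+x. (2 * ?a) * indicator (rect R - Z) x \<partial>lborel)"
      by (subst nn_integral_cmult_indicator) (auto simp: ac_simps)
    also have "\<dots> \<le> (\<integral>\<^sup>+x\<in>rect R. 2 * indicator (- Z) x * smax h x \<partial>lborel)"
    proof (intro nn_integral_mono)
      fix x
      show "(2 * ?a) * indicator (rect R - Z) x \<le> 2 * indicator (- Z) x * smax h x * indicator (rect R) x"
        by (cases "x \<in> rect R \<and> x \<notin> Z") (auto intro!: mult_left_mono avg_le_smax)
    qed
    finally show ?thesis by (subst le_divide_ennreal_iff) auto
  qed
  have "(\<Sum>R\<in>F. ennreal (w R) * ravg h R)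
    \<le> (\<Sum>R\<in>F. ennreal (w R) * ((\<integral>\<^sup>+x\<in>rect R. 2 * indicator (- Z) x * smax h x \<partial>lborel) / ennreal (rect_measure R)))"
    by (intro sum_mono mult_left_mono le) auto
  also have "\<dots> = (\<integral>\<^sup>+x. ennreal (rsum F w x) * (2 * indicator (- Z) x * smax h x) \<partial>lborel)"
    using w by (subst nn_integral_rsum_mult) auto
  finally show ?thesis by (simp add: ac_simps)
qed

text \<open>The case \<open>h = 1\<close>, whose averages are 1 and whose maximal function is at
  most 1.\<close>

lemma sum_half_outside:
  assumes F: "finite F" and w: "\<And>R. R \<in> F \<Longrightarrow> 0 \<le> w R" and [measurable]: "Z \<in> sets borel"
    and half: "\<And>R. R \<in> F \<Longrightarrow> 2 * measure lborel (rect R \<inter> Z) \<le> rect_measure R"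
  shows "ennreal (\<Sum>R\<in>F. w R) \<le> 2 * (\<integral>\<^sup>+x. ennreal (rsum F w x) * indicator (- Z) x \<partial>lborel)"
proof -
  have 1: "(\<integral>\<^sup>+x\<in>rect R. 1 \<partial>lborel) / ennreal (rect_measure R) = 1" for R
    by (simp add: emeasure_rect divide_ennreal)
  have "ennreal (\<Sum>R\<in>F. w R) = (\<Sum>R\<in>F. ennreal (w R) * ((\<integral>\<^sup>+x\<in>rect R. 1 \<partial>lborel) / ennreal (rect_measure R)))"
    unfolding 1 using w by (simp add: sum_ennreal)
  also have "\<dots> \<le> (\<integral>\<^sup>+x. 2 * ennreal (rsum F w x) * indicator (- Z) x * smax (\<lambda>_. 1) x \<partial>lborel)"
    by (rule rsum_half_outside[OF F w _ _ half]) auto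
  also have "\<dots> \<le> (\<integral>\<^sup>+x. 2 * ennreal (rsum F w x) * indicator (- Z) x * 1 \<partial>lborel)"
    by (intro nn_integral_mono mult_left_mono smax_one_le) auto
  also have "\<dots> = 2 * (\<integral>\<^sup>+x. ennreal (rsum F w x) * indicator (- Z) x \<partial>lborel)"
    by (subst nn_integral_cmult[symmetric]) (auto simp: mult.assoc)
  finally show ?thesis .
qed

lemma rect_subset_smax_superlevel:
  assumes "rect_measure R < 2 * measure lborel (rect R \<inter> Z)" and [measurable]: "Z \<in> sets borel"
  shows "rect R \<subseteq> {x. ennreal (1 / 2) \<le> smax (indicator Z) x}"
proof
  fix x assume x: "x \<in> rect R"
  have em: "emeasure lborel (rect R \<inter> Z) = ennreal (measure lborel (rect R \<inter> Z))"
    using fmeasurable_rect[of R] by (intro emeasure_eq_measure2 fmeasurable_Int_fmeasurable) auto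
  have "ennreal (1 / 2) * ennreal (rect_measure R) = ennreal (1 / 2 * rect_measure R)"
    by (rule ennreal_mult[symmetric]) auto
  also have "\<dots> \<le> ennreal (measure lborel (rect R \<inter> Z))"
    using assms(1) by (intro ennreal_leI) simp
  also have "\<dots> = (\<integral>\<^sup>+y\<in>rect R. indicator Z y \<partial>lborel)"
    unfolding em[symmetric] by (simp add: indicator_inter_arith[symmetric] Int_commute)
  finally have "ennreal (1 / 2) \<le> (\<integral>\<^sup>+y\<in>rect R. indicator Z y \<partial>lborel) / ennreal (rect_measure R)"
    by (subst le_divide_ennreal_iff) auto
  also have "\<dots> \<le> smax (indicator Z) x" by (rule avg_le_smax[OF x])
  finally show "x \<in> {x. ennreal (1 / 2) \<le> smax (indicator Z) x}" by simp
qed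

text \<open>Markov's inequality in \<open>L\<^sup>2\<close> at height 1/2 contributes 4, the maximal
  theorem 64.\<close>

lemma smax_superlevel_measure:
  assumes [measurable]: "Z \<in> sets borel"
  shows "emeasure lborel {x. ennreal (1 / 2) \<le> smax (indicator Z) x} \<le> 256 * emeasure lborel Z"
proof -
  have "emeasure lborel {x. ennreal (1 / 2) \<le> smax (indicator Z) x} \<le> ennreal (1 / (1 / 2) powr 2) * pint 2 (smax (indicator Z))"
    by (intro markov_epowr) auto
  also have "\<dots> \<le> ennreal (1 / (1 / 2) powr 2) * (64 * pint 2 (indicator Z))"
    by (intro mult_left_mono smax_strong_type_2(1)) auto
  also have "\<dots> = 256 * emeasure lborel Z"
    by (simp add: nn_integral_indicator_epowr power2_eq_square mult.assoc[symmetric])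
  finally show ?thesis .
qed

text \<open>One of the finitely many nonempty subfamilies maximizes the ratio of weight to measure
  of the union; these measures are positive because rectangles have positive measure.\<close>

lemma exists_extremal_packing:
  assumes F: "finite F" and ne: "F \<noteq> {}"
  obtains F0 N2 where "F0 \<subseteq> F" "F0 \<noteq> {}" "(\<Sum>R\<in>F0. w R) = N2 * measure lborel (\<Union>R\<in>F0. rect R)"
    "\<And>F'. F' \<subseteq> F \<Longrightarrow> (\<Sum>R\<in>F'. w R) \<le> N2 * measure lborel (\<Union>R\<in>F'. rect R)"
proof -
  let ?m = "\<lambda>F'. measure lborel (\<Union>R\<in>F'. rect R)"
  have pos: "0 < ?m F'" if sub: "F' \<subseteq> F" and ne': "F' \<noteq> {}" for F'
  proof -
    obtain R where "R \<in> F'" using ne' by blast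
    then have "measure lborel (rect R) \<le> ?m F'"
      using F sub by (intro measure_mono_fmeasurable fmeasurable_Union_rect) (auto intro: finite_subset)
    then show ?thesis by (metis less_le_trans measure_rect rect_measure_pos(1))
  qed
  let ?q = "\<lambda>F'. (\<Sum>R\<in>F'. w R) / ?m F'"
  let ?S = "Pow F - {{}}"
  have fin: "finite (?q ` ?S)" and "?q ` ?S \<noteq> {}" using F ne by auto
  then obtain F0 where F0: "F0 \<in> ?S" "?q F0 = Max (?q ` ?S)"
    using Max_in by (metis (no_types, lifting) imageE)
  show ?thesis
  proof (rule that[of F0 "?q F0"])
    show "F0 \<subseteq> F" "F0 \<noteq> {}" using F0 by auto
    then show "(\<Sum>R\<in>F0. w R) = ?q F0 * ?m F0" using pos[of F0] by simp
    fix F' assume "F' \<subseteq> F"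
    show "(\<Sum>R\<in>F'. w R) \<le> ?q F0 * ?m F'"
    proof (cases "F' = {}")
      case False
      then have "?q F' \<le> ?q F0" unfolding F0(2) using fin \<open>F' \<subseteq> F\<close> by (intro Max_ge) auto
      then show ?thesis using pos[OF \<open>F' \<subseteq> F\<close> False] by (simp add: divide_le_eq)
    qed simp
  qed
qed

text \<open>
  On an extremal subfamily, the rectangles in the exceptional set and those mostly contained in a
  high superlevel set \<open>Z\<close> of the square function cover so little measure that, by the packing
  condition itself, they carry at most half of the mass. The remaining ones are at least half outside
  of \<open>Z\<close>, where the square function is bounded.
\<close>

lemma BMO_packing_le_opnorm:
  assumes p: "0 < p"
  obtains C :: real where "0 < C"
    "\<And>g A F. 0 < A \<Longrightarrow> paraprod_opnorm p p g \<le> ennreal A \<Longrightarrow> finite F \<Longrightarrow>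
      (\<Sum>R\<in>F. (g R)\<^sup>2) \<le> C * A\<^sup>2 * measure lborel (\<Union>R\<in>F. rect R)"
proof -
  obtain C0 :: real where C0: "0 < C0" and test: "\<And>N \<Omega>. fstep (lev2 N) (indicator \<Omega>) \<Longrightarrow> \<exists>f E. test_pair p C0 (1 / 4) \<Omega> f E"
    using test_pair_exists[OF p, of "1 / 4"] by auto
  \<comment> \<open>Chosen so that Markov's inequality at height \<open>\<kappa> * A\<^sup>2\<close>
    leaves at most 1/1024 of the measure. As 1024 = 4 * 256, with 256 from
    \<open>smax_superlevel_measure\<close>, the enlargement of that set still has at most a quarter
    of the measure.\<close>
  define \<kappa> where "\<kappa> = (1024 * 4 powr p * C0) powr (2 / p)"
  have \<kappa>: "0 < \<kappa>" using C0 by (simp add: \<kappa>_def)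
  have \<kappa>p: "\<kappa> powr (p / 2) = 1024 * 4 powr p * C0" using C0 p by (simp add: \<kappa>_def powr_powr)
  show ?thesis
  proof (rule that[of "4 * \<kappa>"])
    fix g :: "drect \<Rightarrow> real" and A :: real and F :: "drect set"
    assume A: "0 < A" and op: "paraprod_opnorm p p g \<le> ennreal A" and F: "finite F"
    let ?m = "\<lambda>F'. measure lborel (\<Union>R\<in>F'. rect R)"
    let ?w = "\<lambda>R. (g R)\<^sup>2"
    show "(\<Sum>R\<in>F. ?w R) \<le> 4 * \<kappa> * A\<^sup>2 * ?m F"
    proof (cases "F = {}")
      case False
      then obtain F0 N2 where F0: "F0 \<subseteq> F" "F0 \<noteq> {}" and eq: "(\<Sum>R\<in>F0. ?w R) = N2 * ?m F0"
        and max: "\<And>F'. F' \<subseteq> F \<Longrightarrow> (\<Sum>R\<in>F'. ?w R) \<le> N2 * ?m F'"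
        using exists_extremal_packing[OF F, of ?w] by metis
      have finF0: "finite F0" using F F0 finite_subset by blast
      define \<Omega> where "\<Omega> = (\<Union>R\<in>F0. rect R)"
      let ?\<mu> = "measure lborel \<Omega>"
      have fm\<Omega>: "\<Omega> \<in> fmeasurable lborel" unfolding \<Omega>_def by (rule fmeasurable_Union_rect[OF finF0])
      have \<mu>: "0 < ?\<mu>"
      proof -
        obtain R where "R \<in> F0" using F0 by blast
        then have "measure lborel (rect R) \<le> ?\<mu>"
          by (intro measure_mono_fmeasurable fm\<Omega>) (auto simp: \<Omega>_def)
        then show ?thesis by (metis less_le_trans measure_rect rect_measure_pos(1))
      qed
      have N2: "0 \<le> N2"
      proof -
        have "0 \<le> N2 * ?\<mu>" using eq unfolding \<Omega>_def by (metis sum_nonneg zero_le_power2)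
        then show ?thesis using \<mu> by (simp add: zero_le_mult_iff)
      qed
      obtain N where N: "\<And>F' w. F' \<subseteq> F0 \<Longrightarrow> fstep (lev2 N) (rsum F' w)" using fstep_rsum[OF finF0] by blast
      have "fstep (lev2 N) (indicator \<Omega>)"
        unfolding \<Omega>_def Union_rect_superlevel[OF finF0] by (intro fstep_superlevel N) auto
      then obtain f E where tp: "test_pair p C0 (1 / 4) \<Omega> f E" using test by blast
      then have [measurable]: "E \<in> sets borel" and E: "emeasure lborel E \<le> ennreal (1 / 4 * ?\<mu>)"
        and good: "\<And>R. rect_measure R \<le> 2 * measure lborel (rect R \<inter> \<Omega>) \<Longrightarrow> 1 / 4 \<le> \<bar>avg f R\<bar> \<or> rect R \<subseteq> E"
        and f: "integrable lborel f" "pint p (max_d f) \<le> ennreal (C0 * ?\<mu>)"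
        unfolding test_pair_def by blast+
      define FE where "FE = {R\<in>F0. rect R \<subseteq> E}"
      define Fg where "Fg = F0 - FE"
      have avg: "1 / 4 \<le> \<bar>avg f R\<bar>" if "R \<in> Fg" for R
      proof -
        have "rect R \<inter> \<Omega> = rect R" using that by (auto simp: \<Omega>_def Fg_def)
        then show ?thesis using good[of R] that by (auto simp: measure_rect Fg_def FE_def)
      qed
      have finite': "finite Fg" "finite FE" using finF0 by (auto simp: Fg_def FE_def)
      define V where "V = rsum Fg ?w"
      have [measurable]: "V \<in> borel_measurable borel" unfolding V_def by measurable
      have V0: "0 \<le> V x" for x unfolding V_def by (rule rsum_nonneg) auto
      have "rint F0 (\<lambda>R. ?w R * (avg f R)\<^sup>2) (p / 2) \<le> ennreal (A powr p * (C0 * ?\<mu>) powr (p / p))"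
        using p A C0 \<mu> op f finF0 by (intro paraprod_opnorm_test locally_integrable_if_integrable) auto
      also have "\<dots> = ennreal (A powr p * (C0 * ?\<mu>))" using p C0 \<mu> by simp
      finally have I1: "rint F0 (\<lambda>R. ?w R * (avg f R)\<^sup>2) (p / 2) \<le> ennreal (A powr p * (C0 * ?\<mu>))" .
      have Vle: "V x powr (p / 2) \<le> 4 powr p * rsum F0 (\<lambda>R. ?w R * (avg f R)\<^sup>2) x powr (p / 2)" for x
      proof -
        have "rsum Fg (\<lambda>R. ?w R * (1 / 16)) x \<le> rsum F0 (\<lambda>R. ?w R * (avg f R)\<^sup>2) x"
        proof (rule rsum_mono[OF finF0])
          fix R assume "R \<in> Fg"
          then have "(1 / 4)\<^sup>2 \<le> (avg f R)\<^sup>2" using avg[of R] by (subst abs_le_square_iff[symmetric]) auto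
          then show "?w R * (1 / 16) \<le> ?w R * (avg f R)\<^sup>2" by (intro mult_left_mono) (auto simp: power2_eq_square)
        qed (auto simp: Fg_def)
        moreover have "rsum Fg (\<lambda>R. ?w R * (1 / 16)) x = V x / 16"
          unfolding V_def rsum_def by (simp add: sum_divide_distrib ac_simps)
        ultimately have "V x \<le> 16 * rsum F0 (\<lambda>R. ?w R * (avg f R)\<^sup>2) x" by simp
        then have "V x powr (p / 2) \<le> (16 * rsum F0 (\<lambda>R. ?w R * (avg f R)\<^sup>2) x) powr (p / 2)"
          using p V0 by (intro powr_mono2) auto
        also have "\<dots> = 16 powr (p / 2) * rsum F0 (\<lambda>R. ?w R * (avg f R)\<^sup>2) x powr (p / 2)"
          by (intro powr_mult)
        also have "16 powr (p / 2) = (4 powr 2) powr (p / 2)" by simp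
        also have "\<dots> = 4 powr p" by (simp only: powr_powr) simp
        finally show ?thesis .
      qed
      have "(\<integral>\<^sup>+x. ennreal (V x powr (p / 2)) \<partial>lborel) \<le> (\<integral>\<^sup>+x. ennreal (4 powr p) * ennreal (rsum F0 (\<lambda>R. ?w R * (avg f R)\<^sup>2) x powr (p / 2)) \<partial>lborel)"
        by (intro nn_integral_mono) (auto simp flip: ennreal_mult intro!: ennreal_leI Vle)
      also have "\<dots> \<le> ennreal (4 powr p) * ennreal (A powr p * (C0 * ?\<mu>))"
        by (subst nn_integral_cmult) (auto intro!: mult_left_mono I1)
      finally have I2: "(\<integral>\<^sup>+x. ennreal (V x powr (p / 2)) \<partial>lborel) \<le> ennreal (4 powr p * (A powr p * (C0 * ?\<mu>)))"
        using C0 by (simp add: ennreal_mult)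
      define h0 where "h0 = \<kappa> * A\<^sup>2"
      have h0: "0 < h0" using \<kappa> A by (simp add: h0_def)
      have level_powr: "h0 powr (p / 2) = 1024 * 4 powr p * C0 * A powr p"
        using \<kappa> A p by (simp add: h0_def powr_mult \<kappa>p powr_powr flip: powr_numeral)
      define Z where "Z = {x. ennreal h0 \<le> ennreal (V x)}"
      have [measurable]: "Z \<in> sets borel" unfolding Z_def by measurable
      have "emeasure lborel Z \<le> ennreal (1 / h0 powr (p / 2)) * (\<integral>\<^sup>+x. epowr (ennreal (V x)) (p / 2) \<partial>lborel)"
        unfolding Z_def using h0 p by (intro markov_epowr) auto
      also have "\<dots> \<le> ennreal (1 / h0 powr (p / 2)) * ennreal (4 powr p * (A powr p * (C0 * ?\<mu>)))"
        using I2 V0 by (intro mult_left_mono) (auto simp: epowr_ennreal)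
      also have "\<dots> = ennreal (?\<mu> / 1024)"
        using C0 A \<mu> by (simp add: level_powr flip: ennreal_mult)
      finally have Z: "emeasure lborel Z \<le> ennreal (?\<mu> / 1024)" .
      define F1 where "F1 = {R\<in>Fg. rect_measure R < 2 * measure lborel (rect R \<inter> Z)}"
      define F2 where "F2 = Fg - F1"
      have fin2: "finite F1" "finite F2" using finite' by (auto simp: F1_def F2_def)
      \<comment> \<open>Extremality enters here: a subfamily covering at most a quarter of the
        measure carries at most a quarter of the weight of \<open>F0\<close>.\<close>
      have small: "(\<Sum>R\<in>F'. ?w R) \<le> N2 * (?\<mu> / 4)"
        if "F' \<subseteq> F0" "(\<Union>R\<in>F'. rect R) \<subseteq> B" "B \<in> sets borel" "emeasure lborel B \<le> ennreal (?\<mu> / 4)" for F' B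
      proof -
        have fF': "finite F'" using that(1) finF0 finite_subset by blast
        have "ennreal (?m F') = emeasure lborel (\<Union>R\<in>F'. rect R)"
          by (rule emeasure_eq_measure2[OF fmeasurable_Union_rect[OF fF'], symmetric])
        also have "\<dots> \<le> emeasure lborel B" using that by (intro emeasure_mono) auto
        also note that(4)
        finally have "?m F' \<le> ?\<mu> / 4" using \<mu> by (subst (asm) ennreal_le_iff) auto
        then have "N2 * ?m F' \<le> N2 * (?\<mu> / 4)" using N2 by (rule mult_left_mono)
        then show ?thesis using max[of F'] that(1) F0(1) by force
      qed
      have SE: "(\<Sum>R\<in>FE. ?w R) \<le> N2 * (?\<mu> / 4)"
        using E by (intro small[of _ E]) (auto simp: FE_def)
      have "emeasure lborel {x. ennreal (1 / 2) \<le> smax (indicator Z) x} \<le> 256 * ennreal (?\<mu> / 1024)"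
        by (rule order_trans[OF smax_superlevel_measure mult_left_mono[OF Z]]) auto
      also have "\<dots> = ennreal (256 * (?\<mu> / 1024))" by (subst ennreal_mult) auto
      finally have mZ: "emeasure lborel {x. ennreal (1 / 2) \<le> smax (indicator Z) x} \<le> ennreal (?\<mu> / 4)" by simp
      have S1: "(\<Sum>R\<in>F1. ?w R) \<le> N2 * (?\<mu> / 4)"
      proof (rule small[OF _ _ _ mZ])
        show "F1 \<subseteq> F0" by (auto simp: F1_def Fg_def)
        show "(\<Union>R\<in>F1. rect R) \<subseteq> {x. ennreal (1 / 2) \<le> smax (indicator Z) x}"
        proof (rule UN_least)
          fix R assume "R \<in> F1"
          then show "rect R \<subseteq> {x. ennreal (1 / 2) \<le> smax (indicator Z) x}"
            by (intro rect_subset_smax_superlevel) (auto simp: F1_def)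
        qed
      qed measurable
      have "ennreal (\<Sum>R\<in>F2. ?w R) \<le> 2 * (\<integral>\<^sup>+x. ennreal (rsum F2 ?w x) * indicator (- Z) x \<partial>lborel)"
        by (rule sum_half_outside[OF fin2(2)]) (auto simp: F2_def F1_def)
      also have "\<dots> \<le> 2 * (\<integral>\<^sup>+x. ennreal h0 * indicator \<Omega> x \<partial>lborel)"
      proof (intro mult_left_mono nn_integral_mono)
        fix x
        show "ennreal (rsum F2 ?w x) * indicator (- Z) x \<le> ennreal h0 * indicator \<Omega> x"
        proof (cases "x \<in> \<Omega> \<and> x \<notin> Z")
          case True
          have "rsum F2 ?w x \<le> V x" unfolding V_def by (rule rsum_mono[OF finite'(1)]) (auto simp: F2_def)
          also have "V x \<le> h0" using True h0 by (simp add: Z_def not_le ennreal_less_iff V0)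
          finally show ?thesis using True by (simp add: ennreal_leI)
        next
          case False
          moreover have "rsum F2 ?w x = 0" if "x \<notin> \<Omega>"
            unfolding rsum_def using that by (intro sum.neutral) (auto simp: \<Omega>_def F2_def Fg_def)
          ultimately show ?thesis by (auto simp: indicator_def)
        qed
      qed simp
      also have "\<dots> = 2 * (ennreal h0 * ennreal ?\<mu>)"
        using fm\<Omega> emeasure_eq_measure2[OF fm\<Omega>] by (subst nn_integral_cmult_indicator) auto
      also have "\<dots> = ennreal (2 * (h0 * ?\<mu>))"
        using h0 by (simp add: ennreal_mult)
      finally have S2: "(\<Sum>R\<in>F2. ?w R) \<le> 2 * (h0 * ?\<mu>)"
        using h0 by (subst (asm) ennreal_le_iff) auto
      have "(\<Sum>R\<in>F0. ?w R) = (\<Sum>R\<in>FE. ?w R) + ((\<Sum>R\<in>F1. ?w R) + (\<Sum>R\<in>F2. ?w R))"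
      proof -
        have "(\<Sum>R\<in>F0. ?w R) = (\<Sum>R\<in>FE. ?w R) + (\<Sum>R\<in>Fg. ?w R)"
          unfolding Fg_def using finF0 by (subst sum.subset_diff[of FE F0]) (auto simp: FE_def)
        moreover have "(\<Sum>R\<in>Fg. ?w R) = (\<Sum>R\<in>F1. ?w R) + (\<Sum>R\<in>F2. ?w R)"
          unfolding F2_def using finite' by (subst sum.subset_diff[of F1 Fg]) (auto simp: F1_def)
        ultimately show ?thesis by simp
      qed
      \<comment> \<open>Two quarters of the left-hand side are absorbed, which leaves
        \<open>N2 \<le> 4 * h0\<close>.\<close>
      then have "N2 * ?\<mu> \<le> N2 * (?\<mu> / 4) + (N2 * (?\<mu> / 4) + 2 * (h0 * ?\<mu>))"
        using eq SE S1 S2 unfolding \<Omega>_def by linarith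
      then have "N2 * ?\<mu> \<le> (4 * h0) * ?\<mu>" by (simp add: algebra_simps)
      then have "N2 \<le> 4 * h0" using \<mu> by simp
      then have "N2 * ?m F \<le> 4 * h0 * ?m F" by (rule mult_right_mono) simp
      then show ?thesis using max[of F] by (simp add: h0_def mult.assoc)
    qed simp
  qed (use \<kappa> in simp)
qed

text \<open>Lower bounds are proved for positive real majorants \<open>A\<close> of the operator
  norm; letting \<open>e\<close> tend to 0 covers an operator norm that is itself 0.\<close>

lemma ennreal_scaled_le:
  assumes C: "0 < C" and bound: "\<And>A. 0 < A \<Longrightarrow> y \<le> ennreal A \<Longrightarrow> x \<le> ennreal (C * A)"
  shows "ennreal (1 / C) * x \<le> y"
proof (rule ennreal_le_epsilon)
  fix e :: real assume "y < top" and e: "0 < e"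
  then obtain a where a: "0 \<le> a" "y = ennreal a" by (cases y) auto
  have "x \<le> ennreal (C * (a + e))"
    using a e by (intro bound) (auto intro!: ennreal_leI)
  then have "ennreal (1 / C) * x \<le> ennreal (1 / C) * ennreal (C * (a + e))"
    by (rule mult_left_mono) simp
  also have "\<dots> = ennreal (1 / C * (C * (a + e)))"
    using C a e by (intro ennreal_mult[symmetric]) auto
  also have "1 / C * (C * (a + e)) = a + e" using C by simp
  finally show "ennreal (1 / C) * x \<le> y + ennreal e"
    using a e by simp
qed

lemma BMO_le_paraprod_opnorm:
  assumes p: "0 < p"
  obtains c :: real where "0 < c" "\<And>g. ennreal c * BMO_norm g \<le> paraprod_opnorm p p g"
proof -
  obtain C :: real where C: "0 < C" and pack: "\<And>g A F. 0 < A \<Longrightarrow> paraprod_opnorm p p g \<le> ennreal A \<Longrightarrow> finite F \<Longrightarrow>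
      (\<Sum>R\<in>F. (g R)\<^sup>2) \<le> C * A\<^sup>2 * measure lborel (\<Union>R\<in>F. rect R)"
    using BMO_packing_le_opnorm[OF p] by blast
  show ?thesis
  proof (rule that[of "1 / sqrt C"])
    show "0 < 1 / sqrt C" using C by simp
    fix g
    have bound: "BMO_norm g \<le> ennreal (sqrt C * A)" if A: "0 < A" "paraprod_opnorm p p g \<le> ennreal A" for A
    proof (rule BMO_norm_le)
      fix F :: "drect set" assume F: "finite F"
      have "ennreal (\<Sum>R\<in>F. (g R)\<^sup>2) \<le> ennreal (C * A\<^sup>2 * measure lborel (\<Union>R\<in>F. rect R))"
        by (intro ennreal_leI pack A F)
      also have "\<dots> = ennreal ((sqrt C * A)\<^sup>2) * emeasure lborel (\<Union>R\<in>F. rect R)"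
        using C by (simp add: emeasure_eq_measure2[OF fmeasurable_Union_rect[OF F]] power_mult_distrib ennreal_mult)
      finally show "ennreal (\<Sum>R\<in>F. (g R)\<^sup>2) \<le> ennreal ((sqrt C * A)\<^sup>2) * emeasure lborel (\<Union>R\<in>F. rect R)" .
    qed (use C A in simp)
    show "ennreal (1 / sqrt C) * BMO_norm g \<le> paraprod_opnorm p p g"
      by (rule ennreal_scaled_le) (use C bound in auto)
  qed
qed

section \<open>Lower bound by the square function\<close>

text \<open>As \<open>rsum\<close> is the squared square function, this is the set where the square
  function exceeds \<open>2 powr k\<close>.\<close>

abbreviation sq_level :: "drect set \<Rightarrow> (drect \<Rightarrow> real) \<Rightarrow> int \<Rightarrow> (real \<times> real) set" where
  "sq_level F g k \<equiv> {x. 2 powr (2 * real_of_int k) < rsum F (\<lambda>R. (g R)\<^sup>2) x}"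

text \<open>For positive \<open>a\<close>, the sum of the geometric series with ratio
  \<open>2 powr (- a)\<close>.\<close>

definition geo :: "real \<Rightarrow> real" where
  "geo a = 1 / (1 - 2 powr (- a))"

lemma geo_pos: "0 < a \<Longrightarrow> 0 < geo a"
  using powr_less_mono[of "- a" 0 2] by (simp add: geo_def)

text \<open>The terms grow geometrically, so those up to \<open>X\<close> are dominated by the
  largest one times \<open>geo a\<close>. Sums over level sets become powers of the square function
  in this way.\<close>

lemma geo_sum_le:
  assumes a: "0 < a" and K: "finite K" and X: "0 \<le> X"
  shows "(\<Sum>k\<in>K. 2 powr (real_of_int k * a) * indicator {k. 2 powr (real_of_int k * a) \<le> X} k) \<le> geo a * X"
proof (cases "X = 0")
  case True
  then have "(\<Sum>k\<in>K. 2 powr (real_of_int k * a) * indicator {k. 2 powr (real_of_int k * a) \<le> X} k) = 0"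
    by (intro sum.neutral) (auto simp: indicator_def)
  then show ?thesis using True by simp
next
  case False
  with X have X: "0 < X" by simp
  \<comment> \<open>The largest integer whose term does not exceed \<open>X\<close>; the sum is
    indexed by the distance to it.\<close>
  define m where "m = \<lfloor>log 2 X / a\<rfloor>"
  define K' where "K' = {k\<in>K. 2 powr (real_of_int k * a) \<le> X}"
  have km: "k \<le> m" if "k \<in> K'" for k
  proof -
    have "real_of_int k * a \<le> log 2 X" using that X by (simp add: K'_def le_log_iff)
    then show ?thesis using a by (simp add: m_def le_floor_iff field_simps)
  qed
  have "real_of_int m * a \<le> log 2 X"
    using of_int_floor_le[of "log 2 X / a"] unfolding m_def pos_le_divide_eq[OF a] .
  then have mX: "2 powr (real_of_int m * a) \<le> X" using X by (simp add: le_log_iff)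
  let ?y = "2 powr (- a)"
  have y: "0 < ?y" "?y < 1" using a powr_less_mono[of "- a" 0 2] by auto
  have inj: "inj_on (\<lambda>k. nat (m - k)) K'"
  proof (rule inj_onI)
    fix k l assume "k \<in> K'" "l \<in> K'" "nat (m - k) = nat (m - l)"
    then show "k = l" using km[of k] km[of l] by linarith
  qed
  have "(\<Sum>k\<in>K. 2 powr (real_of_int k * a) * indicator {k. 2 powr (real_of_int k * a) \<le> X} k) = (\<Sum>k\<in>K'. 2 powr (real_of_int k * a))"
    unfolding K'_def sum.inter_filter[OF K] by (intro sum.cong) (auto simp: indicator_def)
  also have "\<dots> = (\<Sum>k\<in>K'. 2 powr (real_of_int m * a) * ?y ^ nat (m - k))"
  proof (intro sum.cong refl)
    fix k assume "k \<in> K'"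
    then have "?y ^ nat (m - k) = ?y powr real_of_int (m - k)" using km y by (simp add: powr_realpow[symmetric])
    also have "\<dots> = 2 powr (real_of_int k * a - real_of_int m * a)" by (simp add: powr_powr algebra_simps)
    finally show "2 powr (real_of_int k * a) = 2 powr (real_of_int m * a) * ?y ^ nat (m - k)"
      by (simp flip: powr_add)
  qed
  also have "\<dots> = 2 powr (real_of_int m * a) * (\<Sum>i\<in>(\<lambda>k. nat (m - k)) ` K'. ?y ^ i)"
    by (simp add: sum.reindex[OF inj] sum_distrib_left)
  also have "\<dots> \<le> X * (\<Sum>i. ?y ^ i)"
  proof (intro mult_mono mX sum_le_suminf)
    show "finite ((\<lambda>k. nat (m - k)) ` K')" using K by (simp add: K'_def)
  qed (use y X in \<open>auto intro!: summable_geometric sum_nonneg\<close>)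
  also have "\<dots> = geo a * X" using y by (simp add: suminf_geometric geo_def)
  finally show ?thesis .
qed

lemma geo_sum_inverse_le:
  assumes a: "0 < a" and K: "finite K" and X: "0 < X"
  shows "(\<Sum>k\<in>K. 2 powr (- (real_of_int k * a)) * indicator {k. X \<le> 2 powr (real_of_int k * a)} k) \<le> geo a / X"
proof -
  have "(\<Sum>k\<in>K. 2 powr (- (real_of_int k * a)) * indicator {k. X \<le> 2 powr (real_of_int k * a)} k)
    = (\<Sum>k\<in>uminus ` K. 2 powr (real_of_int k * a) * indicator {k. 2 powr (real_of_int k * a) \<le> 1 / X} k)"
    using X by (subst sum.reindex) (auto simp: indicator_def powr_minus field_simps intro!: sum.cong)
  also have "\<dots> \<le> geo a * (1 / X)" using K X by (intro geo_sum_le a) auto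
  finally show ?thesis by simp
qed

text \<open>The rectangles at most half contained in \<Omega> contribute less than half of the
  level, so the others contribute at least half. Those of them around \<open>x\<close> satisfy
  \<open>c \<le> \<tau> R\<close>, because \<open>x\<close> lies outside of the exceptional
  set.\<close>

lemma level_pointwise:
  assumes F: "finite F" and x: "x \<notin> E" "2 powr (2 * real_of_int k) < rsum F (\<lambda>R. (g R)\<^sup>2) x"
    and bad: "rsum {R\<in>F. 2 * measure lborel (rect R \<inter> \<Omega>) \<le> rect_measure R} (\<lambda>R. (g R)\<^sup>2) x < 2 powr (2 * real_of_int k) / 2"
    and \<tau>: "\<And>R. R \<in> F \<Longrightarrow> rect_measure R \<le> 2 * measure lborel (rect R \<inter> \<Omega>) \<Longrightarrow> c \<le> \<tau> R \<or> rect R \<subseteq> E" and c: "0 \<le> c"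
  shows "c\<^sup>2 * (2 powr (2 * real_of_int k) / 2) \<le> rsum F (\<lambda>R. (g R)\<^sup>2 * (\<tau> R)\<^sup>2) x"
proof -
  let ?B = "{R\<in>F. 2 * measure lborel (rect R \<inter> \<Omega>) \<le> rect_measure R}"
  have split: "rsum F (\<lambda>R. (g R)\<^sup>2) x = rsum (F - ?B) (\<lambda>R. (g R)\<^sup>2) x + rsum ?B (\<lambda>R. (g R)\<^sup>2) x"
    unfolding rsum_def using F by (intro sum.subset_diff) auto
  have "c\<^sup>2 * (2 powr (2 * real_of_int k) / 2) \<le> c\<^sup>2 * rsum (F - ?B) (\<lambda>R. (g R)\<^sup>2) x"
    using x(2) bad split by (intro mult_left_mono) auto
  also have "\<dots> = (\<Sum>R\<in>F - ?B. (g R)\<^sup>2 * c\<^sup>2 * indicator (rect R) x / rect_measure R)"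
    by (simp add: rsum_def sum_distrib_left ac_simps)
  also have "\<dots> \<le> (\<Sum>R\<in>F - ?B. (g R)\<^sup>2 * (\<tau> R)\<^sup>2 * indicator (rect R) x / rect_measure R)"
  proof (intro sum_mono)
    fix R assume R: "R \<in> F - ?B"
    show "(g R)\<^sup>2 * c\<^sup>2 * indicator (rect R) x / rect_measure R \<le> (g R)\<^sup>2 * (\<tau> R)\<^sup>2 * indicator (rect R) x / rect_measure R"
    proof (cases "x \<in> rect R")
      case True
      then have "c \<le> \<tau> R" using \<tau>[of R] R x(1) by auto
      then have "c\<^sup>2 \<le> (\<tau> R)\<^sup>2" using c by (intro power_mono)
      then show ?thesis by (intro divide_right_mono mult_right_mono mult_left_mono) (auto simp: less_imp_le)
    qed simp
  qed
  also have "\<dots> \<le> rsum F (\<lambda>R. (g R)\<^sup>2 * (\<tau> R)\<^sup>2) x"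
    unfolding rsum_def[symmetric] using F by (intro rsum_mono) auto
  finally show ?thesis .
qed

text \<open>A single term suffices, the one with \<open>4 powr k < V \<le> 4 powr (k + 1)\<close>.
  Its index is one below the ceiling because the inequality defining the level sets is
  strict.\<close>

lemma powr_le_level_sum:
  assumes K: "finite K" and V: "0 < V" and mem: "\<lceil>log 4 V\<rceil> - 1 \<in> K" and r: "0 < r"
  shows "V powr (r / 2) \<le> 2 powr r * (\<Sum>k\<in>K. 2 powr (real_of_int k * r) * indicator {k. 2 powr (2 * real_of_int k) < V} k)"
proof -
  define k where "k = \<lceil>log 4 V\<rceil> - 1"
  have four: "(4::real) powr t = 2 powr (2 * t)" for t using powr_powr[of 2 2 t] by simp
  have "real_of_int k < log 4 V" "log 4 V \<le> real_of_int k + 1" unfolding k_def by linarith+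
  then have kV: "2 powr (2 * real_of_int k) < V" "V \<le> 2 powr (2 * (real_of_int k + 1))"
    using V by (simp_all add: less_log_iff log_le_iff four)
  have "V powr (r / 2) \<le> (2 powr (2 * (real_of_int k + 1))) powr (r / 2)"
    using kV V r by (intro powr_mono2) auto
  also have "\<dots> = 2 powr r * (2 powr (real_of_int k * r) * indicator {k. 2 powr (2 * real_of_int k) < V} k)"
  proof -
    have "2 * (real_of_int k + 1) * (r / 2) = r + real_of_int k * r" by (simp add: field_simps)
    then have eq: "(2 powr (2 * (real_of_int k + 1))) powr (r / 2) = 2 powr r * 2 powr (real_of_int k * r)"
      by (simp only: powr_powr powr_add)
    show ?thesis unfolding eq using kV(1) by simp
  qed
  also have "\<dots> \<le> 2 powr r * (\<Sum>k\<in>K. 2 powr (real_of_int k * r) * indicator {k. 2 powr (2 * real_of_int k) < V} k)"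
    using K mem unfolding k_def[symmetric] by (intro mult_left_mono member_le_sum) auto
  finally show ?thesis .
qed

lemma nn_integral_weighted_sets:
  assumes "\<And>k. k \<in> K \<Longrightarrow> 0 \<le> c k" "\<And>k. k \<in> K \<Longrightarrow> A k \<in> sets borel"
  shows "(\<Sum>k\<in>K. ennreal (c k) * emeasure lborel (A k)) = (\<integral>\<^sup>+x. ennreal (\<Sum>k\<in>K. c k * indicator (A k) x) \<partial>lborel)"
proof -
  have "(\<integral>\<^sup>+x. ennreal (\<Sum>k\<in>K. c k * indicator (A k) x) \<partial>lborel) = (\<integral>\<^sup>+x. (\<Sum>k\<in>K. ennreal (c k) * indicator (A k) x) \<partial>lborel)"
    using assms(1) by (intro nn_integral_cong) (subst sum_ennreal[symmetric], auto simp: ennreal_mult ennreal_indicator)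
  also have "\<dots> = (\<Sum>k\<in>K. ennreal (c k) * emeasure lborel (A k))"
    using assms(2) by (simp add: nn_integral_sum nn_integral_cmult_indicator)
  finally show ?thesis ..
qed

text \<open>
  \<open>\<tau> R\<close> is a lower bound for the average over \<open>R\<close> of the test function, which has size \<open>2\<^bsup>k\<alpha>\<^esup>\<close> on the level
  set with index \<open>k\<close>; \<open>E k\<close> is the exceptional set of that level.
\<close>

definition level_adapted ::
  "real \<Rightarrow> real \<Rightarrow> drect set \<Rightarrow> (drect \<Rightarrow> real) \<Rightarrow> int set \<Rightarrow> (drect \<Rightarrow> real) \<Rightarrow> (int \<Rightarrow> (real \<times> real) set) \<Rightarrow> bool" where
  "level_adapted \<delta> \<alpha> F g K \<tau> E \<longleftrightarrow> (\<forall>k\<in>K. E k \<in> sets borel \<and>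
     emeasure lborel (E k) \<le> ennreal (\<delta> * measure lborel (sq_level F g k)) \<and>
     (\<forall>R\<in>F. rect_measure R \<le> 2 * measure lborel (rect R \<inter> (sq_level F g k)) \<longrightarrow>
        2 powr (real_of_int k * \<alpha>) / 4 \<le> \<tau> R \<or> rect R \<subseteq> E k))"

text \<open>
  The level set with index \<open>k\<close> is compared with rectangles half contained in the lower level set with
  index \<open>k - L\<close>. The other rectangles contribute a square function that is controlled by the truncation
  of \<open>V\<close> at the level \<open>k - L\<close>, which gains a factor exponentially small in \<open>L\<close>.
\<close>

lemma level_bound:
  assumes q: "0 < q" and r: "0 < r" and \<alpha>: "0 < \<alpha>" and qr: "q * (\<alpha> + 1) = r"
  obtains \<delta> C :: real where "0 < \<delta>" "0 < C"
    "\<And>F g. finite F \<Longrightarrow> \<exists>K. finite K \<and> (\<forall>\<tau> E.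
      level_adapted \<delta> \<alpha> F g K \<tau> E \<longrightarrow>
      rint F (\<lambda>R. (g R)\<^sup>2) (r / 2)
        \<le> ennreal C * rint F (\<lambda>R. (g R)\<^sup>2 * (\<tau> R)\<^sup>2) (q / 2))"
proof -
  \<comment> \<open>\<open>rsum_duality\<close> needs an exponent at least 1, and
    \<open>r < 2 * s\<close> makes \<open>a\<close> positive, so that the sum over the levels of the
    bad part converges.\<close>
  define s where "s = max 1 r"
  have s: "1 \<le> s" "r < 2 * s" using r by (auto simp: s_def)
  define a where "a = 2 * s - r"
  have a: "0 < a" using s by (simp add: a_def)
  obtain Cs :: real where Cs: "0 < Cs" and dual: "\<And>F w K. finite F \<Longrightarrow> (\<And>R. R \<in> F \<Longrightarrow> 0 \<le> w R) \<Longrightarrow> K \<in> borel_measurable borel \<Longrightarrow>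
      (\<And>h. h \<in> borel_measurable borel \<Longrightarrow>
        (\<Sum>R\<in>F. ennreal (w R) * ravg h R) \<le> (\<integral>\<^sup>+x. K x * smax h x \<partial>lborel)) \<Longrightarrow>
      rint F w s \<le> ennreal Cs * pint s K"
    using rsum_duality[OF s(1)] by blast
  define D where "D = 2 powr r * (4 powr s * Cs * geo a)"
  have D: "0 < D" using Cs geo_pos[OF a] by (simp add: D_def)
  \<comment> \<open>Large enough for the gain \<open>2 powr (- (L * a))\<close> to beat the constant
    \<open>D\<close> and leave a quarter.\<close>
  define L where "L = \<lceil>log 2 (4 * D) / a\<rceil>"
  have L: "D * 2 powr (- (real_of_int L * a)) \<le> 1 / 4"
  proof -
    have "log 2 (4 * D) \<le> real_of_int L * a" using le_of_int_ceiling[of "log 2 (4 * D) / a"] unfolding L_def pos_divide_le_eq[OF a] .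
    then have "4 * D \<le> 2 powr (real_of_int L * a)" using D by (simp add: log_le_iff)
    then show ?thesis by (simp add: powr_minus field_simps)
  qed
  \<comment> \<open>The exceptional sets belong to the level \<open>k - L\<close>, and shifting back
    costs \<open>2 powr (L * r)\<close>; this \<delta> reduces their share to another
    quarter.\<close>
  define \<delta> where "\<delta> = 1 / (4 * (2 powr r * (2 powr (real_of_int L * r) * geo r)))"
  have \<delta>: "0 < \<delta>" "2 powr r * (\<delta> * (2 powr (real_of_int L * r) * geo r)) = 1 / 4"
    using geo_pos[OF r] by (simp_all add: \<delta>_def)
  \<comment> \<open>The square of the 1/4 in \<open>level_adapted\<close> times the 1/2 in
    \<open>level_pointwise\<close> is 1/32; the power of 2 is due to the shift by
    \<open>L\<close>.\<close>
  define c0 where "c0 = 2 powr (- (2 * real_of_int L * \<alpha>)) / 32"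
  have c0: "0 < c0" by (simp add: c0_def)
  define C3 where "C3 = geo r * (1 / c0) powr (q / 2)"
  have C3: "0 < C3" using geo_pos[OF r] c0 by (simp add: C3_def)
  show ?thesis
  proof (rule that[of \<delta> "2 * (2 powr r * C3)"])
    show "0 < \<delta>" by (rule \<delta>)
    show "0 < 2 * (2 powr r * C3)" using C3 by simp
    fix F :: "drect set" and g :: "drect \<Rightarrow> real" assume F: "finite F"
    define V where "V = rsum F (\<lambda>R. (g R)\<^sup>2)"
    have V0: "0 \<le> V x" for x unfolding V_def by (rule rsum_nonneg) auto
    have [measurable]: "V \<in> borel_measurable borel" unfolding V_def by measurable
    obtain N where "\<And>F' w. F' \<subseteq> F \<Longrightarrow> fstep (lev2 N) (rsum F' w)" using fstep_rsum[OF F] by blast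
    then have fsV: "fstep (lev2 N) V" unfolding V_def by simp
    define \<Omega> where "\<Omega> k = {x. 2 powr (2 * real_of_int k) < V x}" for k
    have [measurable]: "\<Omega> k \<in> sets borel" for k unfolding \<Omega>_def by measurable
    have em\<Omega>: "emeasure lborel (\<Omega> k) = ennreal (measure lborel (\<Omega> k))" for k
      unfolding \<Omega>_def by (intro emeasure_eq_measure2 fstep_lev2_fmeasurable[where N=N] fstep_superlevel fsV) auto
    \<comment> \<open>\<open>V\<close> takes finitely many values, so finitely many levels suffice,
      one for each value.\<close>
    define K where "K = (\<lambda>v. \<lceil>log 4 v\<rceil> - 1) ` range V"
    have K: "finite K"
      unfolding K_def using finite_range_fstep[OF fstep_cong[OF fsV] fstep_finite[OF fsV]] by blast
    have memK: "\<lceil>log 4 (V x)\<rceil> - 1 \<in> K" for x by (auto simp: K_def)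
    show "\<exists>K. finite K \<and> (\<forall>\<tau> E.
      level_adapted \<delta> \<alpha> F g K \<tau> E \<longrightarrow>
      rint F (\<lambda>R. (g R)\<^sup>2) (r / 2)
        \<le> ennreal (2 * (2 powr r * C3)) * rint F (\<lambda>R. (g R)\<^sup>2 * (\<tau> R)\<^sup>2) (q / 2))"
    \<comment> \<open>Test functions are used at the lower levels \<open>k - L\<close>, hence the
      shifted set.\<close>
    proof (intro exI[of _ "(\<lambda>k. k - L) ` K"] conjI allI impI)
      show "finite ((\<lambda>k. k - L) ` K)" using K by simp
      fix \<tau> :: "drect \<Rightarrow> real" and E :: "int \<Rightarrow> (real \<times> real) set"
      assume hyp: "level_adapted \<delta> \<alpha> F g ((\<lambda>k. k - L) ` K) \<tau> E"
      have Emeas: "E (k - L) \<in> sets borel" and Esmall: "emeasure lborel (E (k - L)) \<le> ennreal (\<delta> * measure lborel (\<Omega> (k - L)))"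
        and \<tau>: "\<And>R. R \<in> F \<Longrightarrow> rect_measure R \<le> 2 * measure lborel (rect R \<inter> \<Omega> (k - L)) \<Longrightarrow>
           2 powr (real_of_int (k - L) * \<alpha>) / 4 \<le> \<tau> R \<or> rect R \<subseteq> E (k - L)" if "k \<in> K" for k
        using hyp that unfolding level_adapted_def \<Omega>_def V_def by blast+
      define T where "T = rsum F (\<lambda>R. (g R)\<^sup>2 * (\<tau> R)\<^sup>2)"
      have T0: "0 \<le> T x" for x unfolding T_def by (rule rsum_nonneg) auto
      have [measurable]: "T \<in> borel_measurable borel" unfolding T_def by measurable
      define Bf where "Bf k = {R\<in>F. 2 * measure lborel (rect R \<inter> \<Omega> (k - L)) \<le> rect_measure R}" for k
      have Bf: "finite (Bf k)" "Bf k \<subseteq> F" for k using F by (auto simp: Bf_def)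
      define U where "U k = rsum (Bf k) (\<lambda>R. (g R)\<^sup>2)" for k
      have U0: "0 \<le> U k x" for k x unfolding U_def by (rule rsum_nonneg) auto
      have UV: "U k x \<le> V x" for k x unfolding U_def V_def using F Bf by (intro rsum_mono) auto
      have [measurable]: "U k \<in> borel_measurable borel" for k unfolding U_def by measurable
      define Bd where "Bd k = {x. 2 powr (2 * real_of_int k) / 2 \<le> U k x}" for k
      have [measurable]: "Bd k \<in> sets borel" for k unfolding Bd_def by measurable
      define Tk where "Tk k = {x. c0 * 2 powr (2 * real_of_int k * (\<alpha> + 1)) \<le> T x}" for k
      have [measurable]: "Tk k \<in> sets borel" for k unfolding Tk_def by measurable
      let ?IV = "\<integral>\<^sup>+x. ennreal (V x powr (r / 2)) \<partial>lborel" and ?IT = "\<integral>\<^sup>+x. ennreal (T x powr (q / 2)) \<partial>lborel"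
      \<comment> \<open>A point of level \<open>k\<close> is exceptional, or the bad rectangles
        supply half of its level, or else \<open>level_pointwise\<close> makes \<open>T\<close>
        large there.\<close>
      have cover: "\<Omega> k \<subseteq> E (k - L) \<union> Bd k \<union> Tk k" if k: "k \<in> K" for k
      proof
        fix x assume x: "x \<in> \<Omega> k"
        show "x \<in> E (k - L) \<union> Bd k \<union> Tk k"
        proof (rule ccontr)
          assume not: "x \<notin> E (k - L) \<union> Bd k \<union> Tk k"
          have "(2 powr (real_of_int (k - L) * \<alpha>) / 4)\<^sup>2 * (2 powr (2 * real_of_int k) / 2) \<le> T x"
            unfolding T_def
          proof (rule level_pointwise[OF F _ _ _ \<tau>[OF k]])
            show "x \<notin> E (k - L)" using not by simp
            show "2 powr (2 * real_of_int k) < rsum F (\<lambda>R. (g R)\<^sup>2) x" using x by (simp add: \<Omega>_def V_def)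
            show "rsum {R \<in> F. 2 * measure lborel (rect R \<inter> \<Omega> (k - L)) \<le> rect_measure R} (\<lambda>R. (g R)\<^sup>2) x < 2 powr (2 * real_of_int k) / 2"
              using not by (simp add: Bd_def U_def Bf_def)
          qed auto
          moreover have "(2 powr (real_of_int (k - L) * \<alpha>) / 4)\<^sup>2 * (2 powr (2 * real_of_int k) / 2) = c0 * 2 powr (2 * real_of_int k * (\<alpha> + 1))"
          proof -
            have "(2 powr (real_of_int (k - L) * \<alpha>))\<^sup>2 * 2 powr (2 * real_of_int k) = 2 powr (- (2 * real_of_int L * \<alpha>)) * 2 powr (2 * real_of_int k * (\<alpha> + 1))"
              by (simp add: power2_eq_square algebra_simps flip: powr_add)
            then show ?thesis by (simp add: c0_def power_divide)
          qed
          ultimately show False using not by (simp add: Tk_def)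
        qed
      qed
      have IV: "?IV \<le> ennreal (2 powr r) * (\<Sum>k\<in>K. ennreal (2 powr (real_of_int k * r)) * emeasure lborel (\<Omega> k))"
      proof -
        have "?IV \<le> (\<integral>\<^sup>+x. ennreal (2 powr r) * ennreal (\<Sum>k\<in>K. 2 powr (real_of_int k * r) * indicator (\<Omega> k) x) \<partial>lborel)"
        proof (intro nn_integral_mono)
          fix x
          have "V x powr (r / 2) \<le> 2 powr r * (\<Sum>k\<in>K. 2 powr (real_of_int k * r) * indicator (\<Omega> k) x)"
          proof (cases "V x = 0")
            case False
            then have "0 < V x" using V0[of x] by simp
            from powr_le_level_sum[OF K this memK r] show ?thesis by (simp add: \<Omega>_def indicator_def)
          qed (auto intro!: mult_nonneg_nonneg sum_nonneg)
          then have "ennreal (V x powr (r / 2)) \<le> ennreal (2 powr r * (\<Sum>k\<in>K. 2 powr (real_of_int k * r) * indicator (\<Omega> k) x))" by (rule ennreal_leI)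
          also have "\<dots> = ennreal (2 powr r) * ennreal (\<Sum>k\<in>K. 2 powr (real_of_int k * r) * indicator (\<Omega> k) x)"
            by (intro ennreal_mult sum_nonneg) auto
          finally show "ennreal (V x powr (r / 2)) \<le> ennreal (2 powr r) * ennreal (\<Sum>k\<in>K. 2 powr (real_of_int k * r) * indicator (\<Omega> k) x)" .
        qed
        also have "\<dots> = ennreal (2 powr r) * (\<Sum>k\<in>K. ennreal (2 powr (real_of_int k * r)) * emeasure lborel (\<Omega> k))"
          by (subst nn_integral_cmult) (auto simp: nn_integral_weighted_sets)
        finally show ?thesis .
      qed
      have PE: "(\<Sum>k\<in>K. ennreal (2 powr (real_of_int k * r)) * emeasure lborel (E (k - L))) \<le> ennreal (\<delta> * (2 powr (real_of_int L * r) * geo r)) * ?IV"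
      proof -
        have "(\<Sum>k\<in>K. ennreal (2 powr (real_of_int k * r)) * emeasure lborel (E (k - L)))
          \<le> (\<Sum>k\<in>K. ennreal (2 powr (real_of_int k * r)) * (ennreal \<delta> * emeasure lborel (\<Omega> (k - L))))"
          using Esmall \<delta> by (intro sum_mono mult_left_mono) (auto simp: em\<Omega> ennreal_mult)
        also have "\<dots> = ennreal \<delta> * (\<Sum>k\<in>K. ennreal (2 powr (real_of_int k * r)) * emeasure lborel (\<Omega> (k - L)))"
          by (simp add: sum_distrib_left ac_simps)
        also have "\<dots> = ennreal \<delta> * (\<integral>\<^sup>+x. ennreal (\<Sum>k\<in>K. 2 powr (real_of_int k * r) * indicator (\<Omega> (k - L)) x) \<partial>lborel)"
          by (subst nn_integral_weighted_sets) auto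
        also have "\<dots> \<le> ennreal \<delta> * (\<integral>\<^sup>+x. ennreal (2 powr (real_of_int L * r) * geo r) * ennreal (V x powr (r / 2)) \<partial>lborel)"
        proof (intro mult_left_mono nn_integral_mono)
          fix x
          let ?X = "2 powr (real_of_int L * r) * V x powr (r / 2)"
          have "(\<Sum>k\<in>K. 2 powr (real_of_int k * r) * indicator (\<Omega> (k - L)) x)
            \<le> (\<Sum>k\<in>K. 2 powr (real_of_int k * r) * indicator {k. 2 powr (real_of_int k * r) \<le> ?X} k)"
          proof (intro sum_mono mult_left_mono)
            fix k
            have "2 powr (real_of_int k * r) \<le> ?X" if "x \<in> \<Omega> (k - L)"
            proof -
              have "2 powr (real_of_int k * r) = 2 powr (real_of_int L * r) * (2 powr (2 * real_of_int (k - L))) powr (r / 2)"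
                by (simp add: powr_powr algebra_simps flip: powr_add)
              also have "\<dots> \<le> ?X" using that r by (intro mult_left_mono powr_mono2) (auto simp: \<Omega>_def)
              finally show ?thesis .
            qed
            then show "indicator (\<Omega> (k - L)) x \<le> (indicator {k. 2 powr (real_of_int k * r) \<le> ?X} k :: real)"
              by (auto simp: indicator_def)
          qed auto
          also have "\<dots> \<le> geo r * ?X" by (rule geo_sum_le[OF r K]) simp
          finally have "ennreal (\<Sum>k\<in>K. 2 powr (real_of_int k * r) * indicator (\<Omega> (k - L)) x) \<le> ennreal ((2 powr (real_of_int L * r) * geo r) * V x powr (r / 2))"
            by (intro ennreal_leI) (simp add: ac_simps)
          also have "\<dots> = ennreal (2 powr (real_of_int L * r) * geo r) * ennreal (V x powr (r / 2))"
            using geo_pos[OF r] by (intro ennreal_mult) auto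
          finally show "ennreal (\<Sum>k\<in>K. 2 powr (real_of_int k * r) * indicator (\<Omega> (k - L)) x) \<le> \<dots>" .
        qed simp
        also have "\<dots> = ennreal (\<delta> * (2 powr (real_of_int L * r) * geo r)) * ?IV"
          using \<delta> geo_pos[OF r] by (subst nn_integral_cmult) (auto simp: ennreal_mult mult.assoc)
        finally show ?thesis .
      qed
      have PB: "(\<Sum>k\<in>K. ennreal (2 powr (real_of_int k * r)) * emeasure lborel (Bd k)) \<le> ennreal (4 powr s * Cs * geo a * 2 powr (- (real_of_int L * a))) * ?IV"
      proof -
        have Bd: "emeasure lborel (Bd k) \<le> ennreal (2 powr (s - 2 * real_of_int k * s)) * (ennreal Cs * (\<integral>\<^sup>+x. ennreal ((2 * V x) powr s * indicator (- \<Omega> (k - L)) x) \<partial>lborel))" for k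
        proof -
          have "emeasure lborel (Bd k) = emeasure lborel {x. ennreal (2 powr (2 * real_of_int k) / 2) \<le> ennreal (U k x)}"
            unfolding Bd_def by (simp add: U0)
          also have "\<dots> \<le> ennreal (1 / (2 powr (2 * real_of_int k) / 2) powr s) * (\<integral>\<^sup>+x. epowr (ennreal (U k x)) s \<partial>lborel)"
            using s by (intro markov_epowr) auto
          also have "(\<integral>\<^sup>+x. epowr (ennreal (U k x)) s \<partial>lborel) = (\<integral>\<^sup>+x. ennreal (U k x powr s) \<partial>lborel)"
            by (simp add: epowr_ennreal U0)
          \<comment> \<open>The rectangles in \<open>Bf k\<close> are at least half outside of the
            lower level set, so \<open>rsum_half_outside\<close> provides the hypothesis of
            duality.\<close>
          also have "\<dots> \<le> ennreal Cs * (\<integral>\<^sup>+x. epowr (2 * ennreal (U k x) * indicator (- \<Omega> (k - L)) x) s \<partial>lborel)"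
            unfolding U_def by (rule dual[OF Bf(1)]) (auto simp: Bf_def intro!: rsum_half_outside Bf(1)[unfolded Bf_def])
          also have "\<dots> \<le> ennreal Cs * (\<integral>\<^sup>+x. ennreal ((2 * V x) powr s * indicator (- \<Omega> (k - L)) x) \<partial>lborel)"
          proof (intro mult_left_mono nn_integral_mono)
            fix x
            have "epowr (2 * ennreal (U k x)) s = ennreal ((2 * U k x) powr s)"
              using U0[of k x] by (simp add: epowr_ennreal flip: ennreal_numeral ennreal_mult)
            moreover have "(2 * U k x) powr s \<le> (2 * V x) powr s" using U0 UV s by (intro powr_mono2) auto
            ultimately show "epowr (2 * ennreal (U k x) * indicator (- \<Omega> (k - L)) x) s \<le> ennreal ((2 * V x) powr s * indicator (- \<Omega> (k - L)) x)"
              by (cases "x \<in> \<Omega> (k - L)") (auto intro: ennreal_leI)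
          qed simp
          also have "1 / (2 powr (2 * real_of_int k) / 2) powr s = 2 powr (s - 2 * real_of_int k * s)"
            by (simp add: powr_divide powr_powr powr_diff)
          finally show ?thesis by (simp add: mult_left_mono)
        qed
        have "(\<Sum>k\<in>K. ennreal (2 powr (real_of_int k * r)) * emeasure lborel (Bd k))
          \<le> (\<Sum>k\<in>K. ennreal (2 powr (real_of_int k * r)) * (ennreal (2 powr (s - 2 * real_of_int k * s)) * (ennreal Cs * (\<integral>\<^sup>+x. ennreal ((2 * V x) powr s * indicator (- \<Omega> (k - L)) x) \<partial>lborel))))"
          by (intro sum_mono mult_left_mono Bd) auto
        also have "\<dots> = (\<Sum>k\<in>K. ennreal Cs * (\<integral>\<^sup>+x. ennreal (2 powr (s - real_of_int k * a) * ((2 * V x) powr s * indicator (- \<Omega> (k - L)) x)) \<partial>lborel))"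
        proof (intro sum.cong refl)
          fix k
          let ?J = "\<integral>\<^sup>+x. ennreal ((2 * V x) powr s * indicator (- \<Omega> (k - L)) x) \<partial>lborel"
          have "ennreal (2 powr (real_of_int k * r)) * (ennreal (2 powr (s - 2 * real_of_int k * s)) * (ennreal Cs * ?J))
            = ennreal Cs * ((ennreal (2 powr (real_of_int k * r)) * ennreal (2 powr (s - 2 * real_of_int k * s))) * ?J)"
            by (simp only: ac_simps)
          also have "ennreal (2 powr (real_of_int k * r)) * ennreal (2 powr (s - 2 * real_of_int k * s)) = ennreal (2 powr (s - real_of_int k * a))"
            by (simp add: a_def algebra_simps flip: ennreal_mult powr_add)
          also have "\<dots> * ?J = (\<integral>\<^sup>+x. ennreal (2 powr (s - real_of_int k * a) * ((2 * V x) powr s * indicator (- \<Omega> (k - L)) x)) \<partial>lborel)"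
            by (subst nn_integral_cmult[symmetric]) (auto intro!: nn_integral_cong ennreal_mult[symmetric])
          finally show "ennreal (2 powr (real_of_int k * r)) * (ennreal (2 powr (s - 2 * real_of_int k * s)) * (ennreal Cs * ?J))
            = ennreal Cs * (\<integral>\<^sup>+x. ennreal (2 powr (s - real_of_int k * a) * ((2 * V x) powr s * indicator (- \<Omega> (k - L)) x)) \<partial>lborel)" .
        qed
        also have "\<dots> = ennreal Cs * (\<integral>\<^sup>+x. ennreal (\<Sum>k\<in>K. 2 powr (s - real_of_int k * a) * ((2 * V x) powr s * indicator (- \<Omega> (k - L)) x)) \<partial>lborel)"
          unfolding sum_distrib_left[symmetric]
          by (subst nn_integral_sum[symmetric]) (auto intro!: arg_cong2[where f="(*)"] nn_integral_cong)
        also have "\<dots> \<le> ennreal Cs * (\<integral>\<^sup>+x. ennreal (4 powr s * geo a * 2 powr (- (real_of_int L * a))) * ennreal (V x powr (r / 2)) \<partial>lborel)"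
        proof (intro mult_left_mono nn_integral_mono)
          fix x
          have "(\<Sum>k\<in>K. 2 powr (s - real_of_int k * a) * ((2 * V x) powr s * indicator (- \<Omega> (k - L)) x))
            \<le> (4 powr s * geo a * 2 powr (- (real_of_int L * a))) * V x powr (r / 2)"
          proof (cases "V x = 0")
            case False
            then have V: "0 < V x" using V0[of x] by simp
            let ?X = "2 powr (real_of_int L * a) * V x powr (a / 2)"
            have "(\<Sum>k\<in>K. 2 powr (s - real_of_int k * a) * ((2 * V x) powr s * indicator (- \<Omega> (k - L)) x))
              \<le> (\<Sum>k\<in>K. (2 powr s * (2 * V x) powr s) * (2 powr (- (real_of_int k * a)) * indicator {k. ?X \<le> 2 powr (real_of_int k * a)} k))"
            proof (intro sum_mono)
              fix k
              \<comment> \<open>Off the lower level set \<open>V\<close> is at most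
                \<open>2 powr (2 * (k - L))\<close>; at a given point only large \<open>k\<close>
                contribute, and their sum is geometric with negative exponent.\<close>
              have "?X \<le> 2 powr (real_of_int k * a)" if "x \<notin> \<Omega> (k - L)"
              proof -
                have "V x \<le> 2 powr (2 * real_of_int (k - L))" using that by (simp add: \<Omega>_def)
                then have "?X \<le> 2 powr (real_of_int L * a) * (2 powr (2 * real_of_int (k - L))) powr (a / 2)"
                  using V a by (intro mult_left_mono powr_mono2) auto
                also have "\<dots> = 2 powr (real_of_int k * a)"
                  by (simp add: powr_powr algebra_simps flip: powr_add)
                finally show ?thesis .
              qed
              moreover have "2 powr (s - real_of_int k * a) = 2 powr s * 2 powr (- (real_of_int k * a))" by (simp flip: powr_add)
              ultimately show "2 powr (s - real_of_int k * a) * ((2 * V x) powr s * indicator (- \<Omega> (k - L)) x)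
                \<le> (2 powr s * (2 * V x) powr s) * (2 powr (- (real_of_int k * a)) * indicator {k. ?X \<le> 2 powr (real_of_int k * a)} k)"
                by (auto simp: indicator_def)
            qed
            also have "\<dots> \<le> (2 powr s * (2 * V x) powr s) * (geo a / ?X)"
              unfolding sum_distrib_left[symmetric] using V by (intro mult_left_mono geo_sum_inverse_le a K) auto
            also have "\<dots> = (4 powr s * geo a * 2 powr (- (real_of_int L * a))) * V x powr (r / 2)"
            proof -
              have e1: "V x powr (r / 2) = V x powr s / V x powr (a / 2)" by (simp add: a_def diff_divide_distrib flip: powr_diff)
              have e2: "(2 * V x) powr s = 2 powr s * V x powr s" by (rule powr_mult)
              have e3: "(4::real) powr s = 2 powr s * 2 powr s" by (simp flip: powr_mult)
              have e4: "2 powr (- (real_of_int L * a)) = 1 / 2 powr (real_of_int L * a)" by (rule powr_minus_divide)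
              have "y * (y * v) * (z / (l * w)) = y * y * z * (1 / l) * (v / w)" for y v z l w :: real
                by (simp add: divide_inverse ac_simps)
              then show ?thesis unfolding e1 e2 e3 e4 .
            qed
            finally show ?thesis .
          qed (simp add: sum_nonneg)
          then have "ennreal (\<Sum>k\<in>K. 2 powr (s - real_of_int k * a) * ((2 * V x) powr s * indicator (- \<Omega> (k - L)) x))
            \<le> ennreal ((4 powr s * geo a * 2 powr (- (real_of_int L * a))) * V x powr (r / 2))" by (rule ennreal_leI)
          also have "\<dots> = ennreal (4 powr s * geo a * 2 powr (- (real_of_int L * a))) * ennreal (V x powr (r / 2))"
            using geo_pos[OF a] by (intro ennreal_mult) auto
          finally show "ennreal (\<Sum>k\<in>K. 2 powr (s - real_of_int k * a) * ((2 * V x) powr s * indicator (- \<Omega> (k - L)) x)) \<le> \<dots>" .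
        qed simp
        also have "\<dots> = ennreal (Cs * (4 powr s * geo a * 2 powr (- (real_of_int L * a)))) * ?IV"
          using Cs geo_pos[OF a] by (subst nn_integral_cmult) (auto simp: ennreal_mult mult.assoc)
        finally show ?thesis by (simp add: ac_simps)
      qed
      have PT: "(\<Sum>k\<in>K. ennreal (2 powr (real_of_int k * r)) * emeasure lborel (Tk k)) \<le> ennreal C3 * ?IT"
      proof -
        have "(\<Sum>k\<in>K. ennreal (2 powr (real_of_int k * r)) * emeasure lborel (Tk k))
          = (\<integral>\<^sup>+x. ennreal (\<Sum>k\<in>K. 2 powr (real_of_int k * r) * indicator (Tk k) x) \<partial>lborel)"
          by (rule nn_integral_weighted_sets) auto
        also have "\<dots> \<le> (\<integral>\<^sup>+x. ennreal C3 * ennreal (T x powr (q / 2)) \<partial>lborel)"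
        proof (intro nn_integral_mono)
          fix x
          let ?X = "(1 / c0) powr (q / 2) * T x powr (q / 2)"
          have "(\<Sum>k\<in>K. 2 powr (real_of_int k * r) * indicator (Tk k) x)
            \<le> (\<Sum>k\<in>K. 2 powr (real_of_int k * r) * indicator {k. 2 powr (real_of_int k * r) \<le> ?X} k)"
          proof (intro sum_mono mult_left_mono)
            fix k
            have "2 powr (real_of_int k * r) \<le> ?X" if "x \<in> Tk k"
            proof -
              have "2 powr (2 * real_of_int k * (\<alpha> + 1)) \<le> 1 / c0 * T x" using that c0 by (simp add: Tk_def field_simps)
              then have "(2 powr (2 * real_of_int k * (\<alpha> + 1))) powr (q / 2) \<le> (1 / c0 * T x) powr (q / 2)"
                using q by (intro powr_mono2) auto
              \<comment> \<open>The relation \<open>q * (\<alpha> + 1) = r\<close> is what makes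
                \<open>r\<close> come out as the exponent of the level.\<close>
              also have "(2 powr (2 * real_of_int k * (\<alpha> + 1))) powr (q / 2) = 2 powr (real_of_int k * r)"
              proof -
                have "2 * real_of_int k * (\<alpha> + 1) * (q / 2) = real_of_int k * (q * (\<alpha> + 1))" by (simp add: field_simps)
                then show ?thesis by (simp only: powr_powr qr)
              qed
              finally show ?thesis by (simp only: powr_mult)
            qed
            then show "indicator (Tk k) x \<le> (indicator {k. 2 powr (real_of_int k * r) \<le> ?X} k :: real)"
              by (auto simp: indicator_def)
          qed auto
          also have "\<dots> \<le> geo r * ?X" by (rule geo_sum_le[OF r K]) simp
          finally have "ennreal (\<Sum>k\<in>K. 2 powr (real_of_int k * r) * indicator (Tk k) x) \<le> ennreal (C3 * T x powr (q / 2))"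
            by (intro ennreal_leI) (simp add: C3_def ac_simps)
          also have "\<dots> = ennreal C3 * ennreal (T x powr (q / 2))" using C3 by (intro ennreal_mult) auto
          finally show "ennreal (\<Sum>k\<in>K. 2 powr (real_of_int k * r) * indicator (Tk k) x) \<le> \<dots>" .
        qed
        also have "\<dots> = ennreal C3 * ?IT" by (rule nn_integral_cmult) measurable
        finally show ?thesis .
      qed
      have "(\<Sum>k\<in>K. ennreal (2 powr (real_of_int k * r)) * emeasure lborel (\<Omega> k))
        \<le> (\<Sum>k\<in>K. ennreal (2 powr (real_of_int k * r)) * emeasure lborel (E (k - L)) + ennreal (2 powr (real_of_int k * r)) * emeasure lborel (Bd k)
            + ennreal (2 powr (real_of_int k * r)) * emeasure lborel (Tk k))"
      proof (intro sum_mono)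
        fix k assume k: "k \<in> K"
        note [measurable] = Emeas[OF k]
        have "emeasure lborel (\<Omega> k) \<le> emeasure lborel (E (k - L) \<union> Bd k \<union> Tk k)"
          by (intro emeasure_mono cover k) auto
        also have "\<dots> \<le> emeasure lborel (E (k - L) \<union> Bd k) + emeasure lborel (Tk k)"
          by (rule emeasure_subadditive) auto
        also have "\<dots> \<le> emeasure lborel (E (k - L)) + emeasure lborel (Bd k) + emeasure lborel (Tk k)"
          by (intro add_right_mono emeasure_subadditive) auto
        finally have "ennreal (2 powr (real_of_int k * r)) * emeasure lborel (\<Omega> k) \<le> ennreal (2 powr (real_of_int k * r)) * \<dots>"
          by (rule mult_left_mono) simp
        then show "ennreal (2 powr (real_of_int k * r)) * emeasure lborel (\<Omega> k)
          \<le> ennreal (2 powr (real_of_int k * r)) * emeasure lborel (E (k - L)) + ennreal (2 powr (real_of_int k * r)) * emeasure lborel (Bd k)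
            + ennreal (2 powr (real_of_int k * r)) * emeasure lborel (Tk k)"
          by (simp only: distrib_left)
      qed
      also have "\<dots> \<le> ennreal (\<delta> * (2 powr (real_of_int L * r) * geo r)) * ?IV + ennreal (4 powr s * Cs * geo a * 2 powr (- (real_of_int L * a))) * ?IV + ennreal C3 * ?IT"
        unfolding sum.distrib by (intro add_mono PE PB PT)
      finally have "?IV \<le> ennreal (2 powr r) * (ennreal (\<delta> * (2 powr (real_of_int L * r) * geo r)) * ?IV + ennreal (4 powr s * Cs * geo a * 2 powr (- (real_of_int L * a))) * ?IV + ennreal C3 * ?IT)"
        using order_trans[OF IV] mult_left_mono by (metis (no_types, lifting) zero_le)
      also have "\<dots> = (ennreal (2 powr r) * ennreal (\<delta> * (2 powr (real_of_int L * r) * geo r))) * ?IV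
          + (ennreal (2 powr r) * ennreal (4 powr s * Cs * geo a * 2 powr (- (real_of_int L * a)))) * ?IV + ennreal (2 powr r) * (ennreal C3 * ?IT)"
        by (simp only: distrib_left mult.assoc)
      also have "ennreal (2 powr r) * ennreal (\<delta> * (2 powr (real_of_int L * r) * geo r)) = ennreal (1 / 4)"
        by (subst ennreal_mult''[symmetric]) (simp_all only: \<delta>(2), use \<delta>(1) geo_pos[OF r] in simp)
      also have "ennreal (2 powr r) * ennreal (4 powr s * Cs * geo a * 2 powr (- (real_of_int L * a))) = ennreal (D * 2 powr (- (real_of_int L * a)))"
        using Cs geo_pos[OF a] by (simp add: D_def mult.assoc flip: ennreal_mult)
      also have "ennreal (1 / 4) * ?IV + ennreal (D * 2 powr (- (real_of_int L * a))) * ?IV + ennreal (2 powr r) * (ennreal C3 * ?IT)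
        \<le> ennreal (1 / 4) * ?IV + ennreal (1 / 4) * ?IV + ennreal (2 powr r) * (ennreal C3 * ?IT)"
        by (intro add_mono mult_right_mono ennreal_leI L) auto
      also have "\<dots> = ennreal (2 powr r) * (ennreal C3 * ?IT) + ennreal (1 / 2) * ?IV"
      proof -
        have "ennreal (1 / 4) * ?IV + ennreal (1 / 4) * ?IV = (ennreal (1 / 4) + ennreal (1 / 4)) * ?IV" by (simp only: distrib_right)
        also have "ennreal (1 / 4) + ennreal (1 / 4) = ennreal (1 / 2)" by (simp flip: ennreal_plus)
        finally show ?thesis by (simp only: add.commute)
      qed
      \<comment> \<open>The two quarters of \<open>?IV\<close> are absorbed; \<open>?IV\<close> is
        finite because \<open>F\<close> is.\<close>
      finally have "?IV \<le> 2 * (ennreal (2 powr r) * (ennreal C3 * ?IT))"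
        using rsum_powr_finite[OF F, of "\<lambda>R. (g R)\<^sup>2" "r / 2"] r by (intro ennreal_absorb_half) (auto simp: V_def)
      then show "rint F (\<lambda>R. (g R)\<^sup>2) (r / 2)
        \<le> ennreal (2 * (2 powr r * C3)) * rint F (\<lambda>R. (g R)\<^sup>2 * (\<tau> R)\<^sup>2) (q / 2)"
        using C3 by (simp add: V_def T_def ennreal_mult mult.assoc)
    qed
  qed
qed

text \<open>A choice of signs is encoded by the set \<sigma> of indices with sign plus, so that
  averaging over signs is a sum over \<open>Pow K\<close>.\<close>

definition signed_sum :: "int set \<Rightarrow> (int \<Rightarrow> real) \<Rightarrow> int set \<Rightarrow> real" where
  "signed_sum K c \<sigma> = (\<Sum>k\<in>K. (if k \<in> \<sigma> then 1 else -1) * c k)"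

text \<open>Flipping the sign of the term \<open>c k\<close> moves the sum by \<open>2 \<bar>c k\<bar>\<close>, so one of the two sums is large.\<close>

lemma signed_sum_ge_half:
  assumes K: "finite K" and k: "k \<in> K"
  shows "2 ^ card K \<le> 2 * card {\<sigma>\<in>Pow K. \<bar>c k\<bar> \<le> \<bar>signed_sum K c \<sigma>\<bar>}"
proof -
  let ?A = "{\<sigma>\<in>Pow K. \<bar>c k\<bar> \<le> \<bar>signed_sum K c \<sigma>\<bar>}"
  define flip where "flip \<sigma> = (if k \<in> \<sigma> then \<sigma> - {k} else insert k \<sigma>)" for \<sigma>
  have flip_flip: "flip (flip \<sigma>) = \<sigma>" for \<sigma> by (auto simp: flip_def)
  have rest: "signed_sum K c \<sigma> = (if k \<in> \<sigma> then 1 else -1) * c k + (\<Sum>j\<in>K - {k}. (if j \<in> \<sigma> then 1 else -1) * c j)" for \<sigma>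
    unfolding signed_sum_def using K k by (subst sum.remove[of _ k]) auto
  have diff: "\<bar>signed_sum K c \<sigma> - signed_sum K c (flip \<sigma>)\<bar> = 2 * \<bar>c k\<bar>" for \<sigma>
  proof -
    have "(\<Sum>j\<in>K - {k}. (if j \<in> flip \<sigma> then 1 else -1) * c j) = (\<Sum>j\<in>K - {k}. (if j \<in> \<sigma> then 1 else -1) * c j)"
      by (intro sum.cong) (auto simp: flip_def)
    then show ?thesis by (simp add: rest flip_def)
  qed
  have "Pow K \<subseteq> ?A \<union> flip ` ?A"
  proof
    fix \<sigma> assume \<sigma>: "\<sigma> \<in> Pow K"
    show "\<sigma> \<in> ?A \<union> flip ` ?A"
    proof (cases "\<sigma> \<in> ?A")
      case False
      then have "\<bar>signed_sum K c \<sigma>\<bar> < \<bar>c k\<bar>" using \<sigma> by simp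
      then have "\<bar>c k\<bar> \<le> \<bar>signed_sum K c (flip \<sigma>)\<bar>" using diff[of \<sigma>] by linarith
      moreover have "flip \<sigma> \<in> Pow K" using \<sigma> k by (auto simp: flip_def)
      ultimately have "flip \<sigma> \<in> ?A" by simp
      then have "\<sigma> \<in> flip ` ?A" by (rule image_eqI[rotated]) (simp only: flip_flip)
      then show ?thesis by (rule UnI2)
    qed simp
  qed
  note cover = this
  have fin: "finite ?A" by (rule finite_subset[of _ "Pow K"]) (use K in auto)
  have "card (Pow K) \<le> card (?A \<union> flip ` ?A)" by (rule card_mono[OF finite_UnI[OF fin finite_imageI[OF fin]] cover])
  also have "\<dots> \<le> card ?A + card (flip ` ?A)" by (rule card_Un_le)
  also have "\<dots> \<le> card ?A + card ?A" by (intro add_left_mono card_image_le fin)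
  finally show ?thesis using K by (simp add: card_Pow)
qed

text \<open>Let \<open>T\<close> be the full sum and \<open>Y\<close> the partial one for a given
  \<sigma>. As \<open>Y \<le> T\<close> and \<rho> \<le> 1, \<open>Y powr \<rho>\<close> is at least
  \<open>Y * T powr (\<rho> - 1)\<close>, which is linear in \<open>Y\<close>, and \<open>Y\<close>
  is at least \<open>T / 2\<close> on average.\<close>

lemma average_powr_ge_half:
  fixes t :: "'r \<Rightarrow> real"
  assumes F: "finite F" and S: "finite S" and t: "\<And>R. R \<in> F \<Longrightarrow> 0 \<le> t R" and \<rho>: "0 < \<rho>" "\<rho> \<le> 1"
    and half: "\<And>R. R \<in> F \<Longrightarrow> card S \<le> 2 * card {\<sigma>\<in>S. P \<sigma> R}"
  shows "real (card S) * (\<Sum>R\<in>F. t R) powr \<rho> \<le> 2 * (\<Sum>\<sigma>\<in>S. (\<Sum>R\<in>F. if P \<sigma> R then t R else 0) powr \<rho>)"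
proof (cases "(\<Sum>R\<in>F. t R) = 0")
  case False
  let ?T = "\<Sum>R\<in>F. t R" and ?Y = "\<lambda>\<sigma>. \<Sum>R\<in>F. if P \<sigma> R then t R else 0"
  have T: "0 < ?T" using False t by (metis less_eq_real_def sum_nonneg)
  have Y: "0 \<le> ?Y \<sigma>" "?Y \<sigma> \<le> ?T" for \<sigma> using t by (auto intro!: sum_nonneg sum_mono)
  have "?Y \<sigma> * ?T powr (\<rho> - 1) \<le> ?Y \<sigma> powr \<rho>" for \<sigma>
  proof (cases "?Y \<sigma> = 0")
    case False
    then have pos: "0 < ?Y \<sigma>" using Y(1)[of \<sigma>] by simp
    have "?T powr (\<rho> - 1) \<le> ?Y \<sigma> powr (\<rho> - 1)" using \<rho> pos Y(2) by (intro powr_mono2') auto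
    then have "?Y \<sigma> * ?T powr (\<rho> - 1) \<le> ?Y \<sigma> * ?Y \<sigma> powr (\<rho> - 1)" by (rule mult_left_mono[OF _ Y(1)])
    also have "\<dots> = ?Y \<sigma> powr \<rho>" using pos powr_add[of "?Y \<sigma>" 1 "\<rho> - 1"] by simp
    finally show ?thesis .
  qed simp
  then have "(\<Sum>\<sigma>\<in>S. ?Y \<sigma> * ?T powr (\<rho> - 1)) \<le> (\<Sum>\<sigma>\<in>S. ?Y \<sigma> powr \<rho>)" by (rule sum_mono)
  then have le: "(\<Sum>\<sigma>\<in>S. ?Y \<sigma>) * ?T powr (\<rho> - 1) \<le> (\<Sum>\<sigma>\<in>S. ?Y \<sigma> powr \<rho>)" by (simp only: sum_distrib_right)
  have "(\<Sum>\<sigma>\<in>S. ?Y \<sigma>) = (\<Sum>R\<in>F. \<Sum>\<sigma>\<in>S. if P \<sigma> R then t R else 0)" by (rule sum.swap)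
  also have "\<dots> = (\<Sum>R\<in>F. real (card {\<sigma>\<in>S. P \<sigma> R}) * t R)"
    using S by (simp add: sum.inter_filter[symmetric])
  finally have eq: "(\<Sum>\<sigma>\<in>S. ?Y \<sigma>) = (\<Sum>R\<in>F. real (card {\<sigma>\<in>S. P \<sigma> R}) * t R)" .
  have "real (card S) * ?T = (\<Sum>R\<in>F. real (card S) * t R)" by (rule sum_distrib_left)
  also have "\<dots> \<le> (\<Sum>R\<in>F. 2 * real (card {\<sigma>\<in>S. P \<sigma> R}) * t R)"
  proof (intro sum_mono mult_right_mono t)
    fix R assume "R \<in> F"
    from half[OF this] show "real (card S) \<le> 2 * real (card {\<sigma>\<in>S. P \<sigma> R})" by linarith
  qed
  also have "\<dots> = 2 * (\<Sum>\<sigma>\<in>S. ?Y \<sigma>)" unfolding eq by (simp add: sum_distrib_left mult.assoc)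
  finally have "real (card S) * ?T * ?T powr (\<rho> - 1) \<le> 2 * (\<Sum>\<sigma>\<in>S. ?Y \<sigma>) * ?T powr (\<rho> - 1)"
    by (rule mult_right_mono) simp
  also have "\<dots> \<le> 2 * (\<Sum>\<sigma>\<in>S. ?Y \<sigma> powr \<rho>)" using le by simp
  also have "real (card S) * ?T * ?T powr (\<rho> - 1) = real (card S) * ?T powr \<rho>"
    using T powr_add[of ?T 1 "\<rho> - 1"] by simp
  finally show ?thesis .
next
  case True
  then show ?thesis by (simp add: sum_nonneg)
qed

text \<open>After division by \<open>x + y\<close> both numbers lie between 0 and 1, where a power
  with exponent at most 1 only increases.\<close>

lemma powr_subadd:
  assumes "0 \<le> x" "0 \<le> y" "0 < p" "p \<le> 1"
  shows "(x + y) powr p \<le> x powr p + y powr (p::real)"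
proof (cases "x + y = 0")
  case False
  with assms have s: "0 < x + y" by simp
  have le: "z / (x + y) \<le> (z / (x + y)) powr p" if "0 \<le> z" "z \<le> x + y" for z
  proof (cases "z = 0")
    case False
    then have "0 < z / (x + y)" "z / (x + y) \<le> 1" using that s by auto
    then have "(z / (x + y)) powr 1 \<le> (z / (x + y)) powr p" using assms by (intro powr_mono') auto
    then show ?thesis using powr_one[of "z / (x + y)"] \<open>0 < z / (x + y)\<close> by linarith
  qed simp
  have "1 = x / (x + y) + y / (x + y)" using s by (simp flip: add_divide_distrib)
  also have "\<dots> \<le> (x / (x + y)) powr p + (y / (x + y)) powr p" using assms by (intro add_mono le) auto
  also have "\<dots> = (x powr p + y powr p) / (x + y) powr p" using assms by (simp add: powr_divide add_divide_distrib)
  finally show ?thesis using s by (simp add: field_simps)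
qed (use assms in auto)

lemma epowr_subadd: "0 < p \<Longrightarrow> p \<le> 1 \<Longrightarrow> epowr (x + y) p \<le> epowr x p + epowr y p"
proof (cases x; cases y)
  fix a b assume "0 < p" "p \<le> 1" "0 \<le> a" "x = ennreal a" "0 \<le> b" "y = ennreal b"
  then show ?thesis
    using powr_subadd[of a b p] by (simp add: epowr_ennreal ennreal_leI flip: ennreal_plus)
qed auto

lemma epowr_sum_le:
  assumes "0 < p" "p \<le> 1" shows "epowr (\<Sum>k\<in>K. x k) p \<le> (\<Sum>k\<in>K. epowr (x k) p)"
proof (induction K rule: infinite_finite_induct)
  case (insert k K)
  then show ?case using epowr_subadd[OF assms, of "x k" "\<Sum>k\<in>K. x k"] by (auto intro: order_trans add_left_mono)
qed auto

lemma max_d_sum_le: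
  assumes "\<And>k. k \<in> K \<Longrightarrow> integrable lborel (f k)"
  shows "max_d (\<lambda>x. \<Sum>k\<in>K. c k * f k x) x \<le> (\<Sum>k\<in>K. ennreal \<bar>c k\<bar> * max_d (f k) x)"
  unfolding max_d_def[of "\<lambda>x. \<Sum>k\<in>K. c k * f k x"]
proof (rule SUP_least)
  fix R assume R: "R \<in> {R. x \<in> rect R}"
  have "avg (\<lambda>x. \<Sum>k\<in>K. c k * f k x) R = (\<Sum>k\<in>K. c k * avg (f k) R)"
    using assms by (subst avg_sum) (auto simp: avg_scale)
  then have "\<bar>avg (\<lambda>x. \<Sum>k\<in>K. c k * f k x) R\<bar> \<le> (\<Sum>k\<in>K. \<bar>c k\<bar> * \<bar>avg (f k) R\<bar>)"
    by (simp add: sum_abs[THEN order_trans] flip: abs_mult)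
  then have "ennreal \<bar>avg (\<lambda>x. \<Sum>k\<in>K. c k * f k x) R\<bar> \<le> ennreal (\<Sum>k\<in>K. \<bar>c k\<bar> * \<bar>avg (f k) R\<bar>)" by (rule ennreal_leI)
  also have "\<dots> = (\<Sum>k\<in>K. ennreal \<bar>c k\<bar> * ennreal \<bar>avg (f k) R\<bar>)"
    by (subst sum_ennreal[symmetric]) (auto simp: ennreal_mult)
  also have "\<dots> \<le> (\<Sum>k\<in>K. ennreal \<bar>c k\<bar> * max_d (f k) x)"
    using R by (intro sum_mono mult_left_mono abs_avg_le_max_d) auto
  finally show "ennreal \<bar>avg (\<lambda>x. \<Sum>k\<in>K. c k * f k x) R\<bar> \<le> (\<Sum>k\<in>K. ennreal \<bar>c k\<bar> * max_d (f k) x)" .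
qed

text \<open>The single function \<open>V powr (\<alpha> / 2)\<close> serves all levels: it is
  nonnegative, at least \<open>2 powr (k * \<alpha>)\<close> on the level set, and its
  \<open>p\<close>-th power has integral \<open>b\<close> because \<open>\<alpha> = r / p\<close>.
  Its average over \<open>R\<close> is taken as \<open>\<tau> R\<close>.\<close>

lemma level_test_gt_1:
  assumes p: "1 < p" and q: "0 < q" and r: "0 < r" and \<alpha>: "\<alpha> = r / p"
    and F: "finite F" and A: "0 < A" and op: "paraprod_opnorm p q g \<le> ennreal A"
    and b: "0 < b" and IV: "rint F (\<lambda>R. (g R)\<^sup>2) (r / 2) = ennreal b"
  shows "\<exists>\<tau>. (\<forall>k. \<forall>R\<in>F. rect_measure R \<le> 2 * measure lborel (rect R \<inter> (sq_level F g k)) \<longrightarrow>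
           2 powr (real_of_int k * \<alpha>) / 4 \<le> \<tau> R) \<and>
      rint F (\<lambda>R. (g R)\<^sup>2 * (\<tau> R)\<^sup>2) (q / 2) \<le> ennreal (A powr q * ((2 powr p * p / (p - 1))\<^sup>2 * b) powr (q / p))"
proof -
  define V where "V = rsum F (\<lambda>R. (g R)\<^sup>2)"
  have V0: "0 \<le> V x" for x unfolding V_def by (rule rsum_nonneg) auto
  obtain N where "\<And>F' w. F' \<subseteq> F \<Longrightarrow> fstep (lev2 N) (rsum F' w)" using fstep_rsum[OF F] by blast
  then have fsV: "fstep (lev2 N) V" unfolding V_def by simp
  define f where "f x = V x powr (\<alpha> / 2)" for x
  have fsf: "fstep (lev2 N) f"
    unfolding f_def by (rule fstep_comp[OF fsV, of "\<lambda>v. v powr (\<alpha> / 2)"]) simp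
  have int: "integrable lborel f" by (rule fstep_lev2_integrable[OF fsf])
  have [measurable]: "f \<in> borel_measurable borel" using int by simp
  have Mf: "pint p (max_d f) \<le> ennreal ((2 powr p * p / (p - 1))\<^sup>2 * b)"
  proof -
    have "pint p (max_d f) \<le> pint p (smax (\<lambda>y. ennreal \<bar>f y\<bar>))"
      using p by (intro nn_integral_mono epowr_mono max_d_le_smax) auto
    also have "\<dots> \<le> ennreal ((2 powr p * p / (p - 1))\<^sup>2) * (\<integral>\<^sup>+x. epowr (ennreal \<bar>f x\<bar>) p \<partial>lborel)"
      by (rule smax_strong_type[OF _ p]) measurable
    also have "(\<integral>\<^sup>+x. epowr (ennreal \<bar>f x\<bar>) p \<partial>lborel) = ennreal b"
      unfolding IV[symmetric] V_def[symmetric] f_def using p by (simp add: epowr_ennreal powr_powr \<alpha>)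
    also have "ennreal ((2 powr p * p / (p - 1))\<^sup>2) * ennreal b = ennreal ((2 powr p * p / (p - 1))\<^sup>2 * b)"
      using b by (intro ennreal_mult[symmetric]) auto
    finally show ?thesis .
  qed
  have Cb: "0 < (2 powr p * p / (p - 1))\<^sup>2 * b" using p b by simp
  have T: "rint F (\<lambda>R. (g R)\<^sup>2 * (avg f R)\<^sup>2) (q / 2) \<le> ennreal (A powr q * ((2 powr p * p / (p - 1))\<^sup>2 * b) powr (q / p))"
    using p A by (intro paraprod_opnorm_test[OF _ q Cb _ op locally_integrable_if_integrable[OF int] Mf F]) auto
  have lev: "2 powr (real_of_int k * \<alpha>) / 4 \<le> avg f R"
    if R: "rect_measure R \<le> 2 * measure lborel (rect R \<inter> {x. 2 powr (2 * real_of_int k) < V x})" for k R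
  proof -
    let ?\<Omega> = "{x. 2 powr (2 * real_of_int k) < V x}" and ?y = "2 powr (real_of_int k * \<alpha>)"
    have fs\<Omega>: "fstep (lev2 N) (indicator ?\<Omega>)" by (intro fstep_superlevel fsV) auto
    have \<Omega>_meas: "?\<Omega> \<in> sets borel" using fmeasurableD[OF fstep_lev2_fmeasurable[OF fs\<Omega>]] by (simp only: sets_lborel)
    have int\<Omega>: "integrable lborel (\<lambda>x. ?y * indicator ?\<Omega> x)" by (intro integrable_mult_right fstep_lev2_integrable[OF fs\<Omega>])
    have "?y / 4 \<le> ?y * (measure lborel (rect R \<inter> ?\<Omega>) / rect_measure R)"
    proof -
      have "1 / 4 * rect_measure R \<le> measure lborel (rect R \<inter> ?\<Omega>)" using R rect_measure_pos(1)[of R] by linarith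
      then have "1 / 4 \<le> measure lborel (rect R \<inter> ?\<Omega>) / rect_measure R" by (subst pos_le_divide_eq) auto
      then have "?y * (1 / 4) \<le> ?y * (measure lborel (rect R \<inter> ?\<Omega>) / rect_measure R)" by (rule mult_left_mono) simp
      then show ?thesis by simp
    qed
    also have "\<dots> = avg (\<lambda>x. ?y * indicator ?\<Omega> x) R" by (simp only: avg_scale avg_indicator[OF \<Omega>_meas])
    also have "\<dots> \<le> avg f R"
      unfolding avg_def
    proof (intro divide_right_mono set_integral_mono)
      show "set_integrable lborel (rect R) (\<lambda>x. ?y * indicator ?\<Omega> x)" "set_integrable lborel (rect R) f"
        unfolding set_integrable_def by (intro integrable_mult_indicator int\<Omega> int; simp)+
      fix x
      have "?y \<le> f x" if "x \<in> ?\<Omega>"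
      proof -
        have "?y = (2 powr (2 * real_of_int k)) powr (\<alpha> / 2)" by (simp add: powr_powr)
        also have "\<dots> \<le> V x powr (\<alpha> / 2)" using that r p by (intro powr_mono2) (auto simp: \<alpha>)
        finally show ?thesis by (simp add: f_def)
      qed
      then show "?y * indicator ?\<Omega> x \<le> f x" by (auto simp: indicator_def f_def)
    qed simp
    finally show ?thesis .
  qed
  show ?thesis
    using T lev unfolding V_def by blast
qed

text \<open>
  The test functions of the different levels are combined with all choices of signs, which prevents
  cancellation of the averages on half of the choices.
\<close>

lemma level_test_le_1:
  assumes p: "0 < p" "p \<le> 1" and q: "0 < q" "q \<le> 2" and r: "0 < r" and \<alpha>: "\<alpha> = r / p"
    and F: "finite F" and K: "finite K" and A: "0 < A" and op: "paraprod_opnorm p q g \<le> ennreal A"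
    and b: "0 < b" and IV: "rint F (\<lambda>R. (g R)\<^sup>2) (r / 2) = ennreal b"
    and C0: "0 < C0" and test: "\<And>N \<Omega>. fstep (lev2 N) (indicator \<Omega>) \<Longrightarrow> \<exists>f E. test_pair p C0 \<delta> \<Omega> f E"
  shows "\<exists>\<tau> E. level_adapted \<delta> \<alpha> F g K \<tau> E \<and>
      rint F (\<lambda>R. (g R)\<^sup>2 * (\<tau> R)\<^sup>2) (q / 2) \<le> ennreal (2 * (A powr q * (C0 * geo r * b) powr (q / p)))"
proof -
  define V where "V = rsum F (\<lambda>R. (g R)\<^sup>2)"
  have V0: "0 \<le> V x" for x unfolding V_def by (rule rsum_nonneg) auto
  have [measurable]: "V \<in> borel_measurable borel" unfolding V_def by measurable
  obtain N where "\<And>F' w. F' \<subseteq> F \<Longrightarrow> fstep (lev2 N) (rsum F' w)" using fstep_rsum[OF F] by blast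
  then have fsV: "fstep (lev2 N) V" unfolding V_def by simp
  define \<Omega> where "\<Omega> k = {x. 2 powr (2 * real_of_int k) < V x}" for k
  have fs\<Omega>: "fstep (lev2 N) (indicator (\<Omega> k))" for k unfolding \<Omega>_def by (intro fstep_superlevel fsV) auto
  have [measurable]: "\<Omega> k \<in> sets borel" for k using fmeasurableD[OF fstep_lev2_fmeasurable[OF fs\<Omega>]] by simp
  have em\<Omega>: "emeasure lborel (\<Omega> k) = ennreal (measure lborel (\<Omega> k))" for k
    by (rule emeasure_eq_measure2[OF fstep_lev2_fmeasurable[OF fs\<Omega>]])
  have "\<exists>f E. \<forall>k. test_pair p C0 \<delta> (\<Omega> k) (f k) (E k)" using test[OF fs\<Omega>] by metis
  then obtain f E where tp: "\<And>k. test_pair p C0 \<delta> (\<Omega> k) (f k) (E k)" by blast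
  have int: "integrable lborel (f k)" and Mf: "pint p (max_d (f k)) \<le> ennreal (C0 * measure lborel (\<Omega> k))"
    and E: "E k \<in> sets borel" "emeasure lborel (E k) \<le> ennreal (\<delta> * measure lborel (\<Omega> k))"
    and good: "\<And>R. rect_measure R \<le> 2 * measure lborel (rect R \<inter> \<Omega> k) \<Longrightarrow> 1 / 4 \<le> \<bar>avg (f k) R\<bar> \<or> rect R \<subseteq> E k" for k
    using tp[of k] unfolding test_pair_def by blast+
  define c where "c k = 2 powr (real_of_int k * \<alpha>)" for k
  \<comment> \<open>The largest size certified on \<open>R\<close> by the test function of some
    level; the \<open>0\<close> covers rectangles without such a level.\<close>
  define \<tau> where "\<tau> R = Max (insert 0 ((\<lambda>k. c k / 4) ` {k\<in>K. 1 / 4 \<le> \<bar>avg (f k) R\<bar>}))" for R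
  have \<tau>fin: "finite (insert 0 ((\<lambda>k. c k / 4) ` {k\<in>K. 1 / 4 \<le> \<bar>avg (f k) R\<bar>}))" for R using K by simp
  have \<tau>ge: "c k / 4 \<le> \<tau> R" if "k \<in> K" "1 / 4 \<le> \<bar>avg (f k) R\<bar>" for k R
    unfolding \<tau>_def using that by (intro Max_ge \<tau>fin) auto
  have \<tau>0: "0 \<le> \<tau> R" for R unfolding \<tau>_def by (intro Max_ge \<tau>fin) auto
  define fs where "fs \<sigma> x = (\<Sum>k\<in>K. ((if k \<in> \<sigma> then 1 else -1) * c k) * f k x)" for \<sigma> x
  have avg_fs: "avg (fs \<sigma>) R = signed_sum K (\<lambda>k. c k * avg (f k) R) \<sigma>" for \<sigma> R
    unfolding fs_def signed_sum_def using int by (subst avg_sum) (auto simp: avg_scale mult.assoc)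
  have int_fs: "integrable lborel (fs \<sigma>)" for \<sigma>
    unfolding fs_def using int by (intro Bochner_Integration.integrable_sum integrable_mult_right)
  have many: "card (Pow K) \<le> 2 * card {\<sigma>\<in>Pow K. \<tau> R \<le> \<bar>avg (fs \<sigma>) R\<bar>}" for R
  proof -
    have "\<tau> R \<in> insert 0 ((\<lambda>k. c k / 4) ` {k\<in>K. 1 / 4 \<le> \<bar>avg (f k) R\<bar>})"
      unfolding \<tau>_def by (intro Max_in \<tau>fin) auto
    then consider "\<tau> R = 0" | k where "k \<in> K" "1 / 4 \<le> \<bar>avg (f k) R\<bar>" "\<tau> R = c k / 4" by blast
    then show ?thesis
    proof cases
      case 1
      then have "{\<sigma>\<in>Pow K. \<tau> R \<le> \<bar>avg (fs \<sigma>) R\<bar>} = Pow K" by auto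
      then show ?thesis by simp
    next
      case 2
      have "c k * (1 / 4) \<le> c k * \<bar>avg (f k) R\<bar>" using 2 by (intro mult_left_mono) (auto simp: c_def)
      also have "\<dots> = \<bar>c k * avg (f k) R\<bar>" by (simp add: abs_mult c_def)
      finally have \<tau>le: "\<tau> R \<le> \<bar>c k * avg (f k) R\<bar>" using 2(3) by linarith
      have "card (Pow K) \<le> 2 * card {\<sigma>\<in>Pow K. \<bar>c k * avg (f k) R\<bar> \<le> \<bar>signed_sum K (\<lambda>k. c k * avg (f k) R) \<sigma>\<bar>}"
        using signed_sum_ge_half[OF K 2(1), of "\<lambda>k. c k * avg (f k) R"] K by (simp add: card_Pow)
      also have "\<dots> \<le> 2 * card {\<sigma>\<in>Pow K. \<tau> R \<le> \<bar>avg (fs \<sigma>) R\<bar>}"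
        using K \<tau>le unfolding avg_fs by (intro mult_left_mono card_mono) auto
      finally show ?thesis .
    qed
  qed
  \<comment> \<open>For \<open>p \<le> 1\<close> the \<open>p\<close>-th power is subadditive, so
    the levels simply add up; the measures of the level sets, weighted by
    \<open>2 powr (k * r)\<close>, sum to at most \<open>geo r * b\<close>.\<close>
  have Mfs: "pint p (max_d (fs \<sigma>)) \<le> ennreal (C0 * geo r * b)" for \<sigma>
  proof -
    have cp: "c k powr p = 2 powr (real_of_int k * r)" for k using p by (simp add: c_def powr_powr \<alpha>)
    have "pint p (max_d (fs \<sigma>)) \<le> (\<integral>\<^sup>+x. (\<Sum>k\<in>K. ennreal (2 powr (real_of_int k * r)) * epowr (max_d (f k) x) p) \<partial>lborel)"
    proof (intro nn_integral_mono)
      fix x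
      have "max_d (fs \<sigma>) x \<le> (\<Sum>k\<in>K. ennreal \<bar>(if k \<in> \<sigma> then 1 else -1) * c k\<bar> * max_d (f k) x)"
        unfolding fs_def by (intro max_d_sum_le int)
      also have "\<dots> = (\<Sum>k\<in>K. ennreal (c k) * max_d (f k) x)"
        by (intro sum.cong) (auto simp: c_def abs_mult)
      finally have "epowr (max_d (fs \<sigma>) x) p \<le> epowr (\<Sum>k\<in>K. ennreal (c k) * max_d (f k) x) p" using p by (intro epowr_mono) auto
      also have "\<dots> \<le> (\<Sum>k\<in>K. epowr (ennreal (c k) * max_d (f k) x) p)" by (rule epowr_sum_le[OF p])
      also have "\<dots> = (\<Sum>k\<in>K. ennreal (2 powr (real_of_int k * r)) * epowr (max_d (f k) x) p)"
        by (simp add: epowr_mult epowr_ennreal cp[symmetric]) (simp add: c_def epowr_ennreal)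
      finally show "epowr (max_d (fs \<sigma>) x) p \<le> (\<Sum>k\<in>K. ennreal (2 powr (real_of_int k * r)) * epowr (max_d (f k) x) p)" .
    qed
    also have "\<dots> = (\<Sum>k\<in>K. ennreal (2 powr (real_of_int k * r)) * pint p (max_d (f k)))"
      by (simp add: nn_integral_sum nn_integral_cmult)
    also have "\<dots> \<le> (\<Sum>k\<in>K. ennreal (2 powr (real_of_int k * r)) * (ennreal C0 * emeasure lborel (\<Omega> k)))"
      using Mf C0 by (intro sum_mono mult_left_mono) (auto simp: em\<Omega> ennreal_mult)
    also have "\<dots> = ennreal C0 * (\<Sum>k\<in>K. ennreal (2 powr (real_of_int k * r)) * emeasure lborel (\<Omega> k))"
      by (simp add: sum_distrib_left ac_simps)
    also have "\<dots> = ennreal C0 * (\<integral>\<^sup>+x. ennreal (\<Sum>k\<in>K. 2 powr (real_of_int k * r) * indicator (\<Omega> k) x) \<partial>lborel)"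
      by (subst nn_integral_weighted_sets) auto
    also have "\<dots> \<le> ennreal C0 * (\<integral>\<^sup>+x. ennreal (geo r) * ennreal (V x powr (r / 2)) \<partial>lborel)"
    proof (intro mult_left_mono nn_integral_mono)
      fix x
      have "(\<Sum>k\<in>K. 2 powr (real_of_int k * r) * indicator (\<Omega> k) x)
        \<le> (\<Sum>k\<in>K. 2 powr (real_of_int k * r) * indicator {k. 2 powr (real_of_int k * r) \<le> V x powr (r / 2)} k)"
      proof (intro sum_mono mult_left_mono)
        fix k
        have "2 powr (real_of_int k * r) \<le> V x powr (r / 2)" if "x \<in> \<Omega> k"
        proof -
          have "2 powr (real_of_int k * r) = (2 powr (2 * real_of_int k)) powr (r / 2)" by (simp add: powr_powr)
          also have "\<dots> \<le> V x powr (r / 2)" using that r by (intro powr_mono2) (auto simp: \<Omega>_def)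
          finally show ?thesis .
        qed
        then show "indicator (\<Omega> k) x \<le> (indicator {k. 2 powr (real_of_int k * r) \<le> V x powr (r / 2)} k :: real)"
          by (auto simp: indicator_def)
      qed auto
      also have "\<dots> \<le> geo r * V x powr (r / 2)" by (rule geo_sum_le[OF r K]) simp
      finally have "ennreal (\<Sum>k\<in>K. 2 powr (real_of_int k * r) * indicator (\<Omega> k) x) \<le> ennreal (geo r * V x powr (r / 2))" by (rule ennreal_leI)
      also have "\<dots> = ennreal (geo r) * ennreal (V x powr (r / 2))" using geo_pos[OF r] by (intro ennreal_mult) auto
      finally show "ennreal (\<Sum>k\<in>K. 2 powr (real_of_int k * r) * indicator (\<Omega> k) x) \<le> \<dots>" .
    qed simp
    also have "\<dots> = ennreal C0 * (ennreal (geo r) * ennreal b)"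
      unfolding IV[symmetric] V_def[symmetric] by (subst nn_integral_cmult) auto
    also have "\<dots> = ennreal (C0 * geo r * b)"
      using C0 geo_pos[OF r] b by (simp add: ennreal_mult mult.assoc)
    finally show ?thesis .
  qed
  define T where "T = rsum F (\<lambda>R. (g R)\<^sup>2 * (\<tau> R)\<^sup>2)"
  have [measurable]: "T \<in> borel_measurable borel" unfolding T_def by measurable
  have Cb: "0 < C0 * geo r * b" using C0 geo_pos[OF r] b by simp
  let ?B = "A powr q * (C0 * geo r * b) powr (q / p)" and ?n = "real (card (Pow K))"
  have n: "0 < ?n" using K by (simp add: card_Pow)
  \<comment> \<open>Half of the sign choices respect the bound on each rectangle, and
    \<open>q / 2 \<le> 1\<close> allows averaging over them inside the power.\<close>
  have pw: "?n * T x powr (q / 2) \<le> 2 * (\<Sum>\<sigma>\<in>Pow K. rsum F (\<lambda>R. (g R)\<^sup>2 * (avg (fs \<sigma>) R)\<^sup>2) x powr (q / 2))" for x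
  proof -
    let ?t = "\<lambda>R. (g R)\<^sup>2 * (\<tau> R)\<^sup>2 * indicator (rect R) x / rect_measure R"
    have "?n * T x powr (q / 2) \<le> 2 * (\<Sum>\<sigma>\<in>Pow K. (\<Sum>R\<in>F. if \<tau> R \<le> \<bar>avg (fs \<sigma>) R\<bar> then ?t R else 0) powr (q / 2))"
      unfolding T_def rsum_def using q many K by (intro average_powr_ge_half F) (auto simp: less_imp_le)
    also have "\<dots> \<le> 2 * (\<Sum>\<sigma>\<in>Pow K. rsum F (\<lambda>R. (g R)\<^sup>2 * (avg (fs \<sigma>) R)\<^sup>2) x powr (q / 2))"
    proof (intro mult_left_mono sum_mono powr_mono2)
      fix \<sigma>
      show "0 \<le> (\<Sum>R\<in>F. if \<tau> R \<le> \<bar>avg (fs \<sigma>) R\<bar> then ?t R else 0)" by (intro sum_nonneg) (auto simp: less_imp_le)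
      show "(\<Sum>R\<in>F. if \<tau> R \<le> \<bar>avg (fs \<sigma>) R\<bar> then ?t R else 0) \<le> rsum F (\<lambda>R. (g R)\<^sup>2 * (avg (fs \<sigma>) R)\<^sup>2) x"
        unfolding rsum_def
      proof (intro sum_mono)
        fix R
        show "(if \<tau> R \<le> \<bar>avg (fs \<sigma>) R\<bar> then ?t R else 0) \<le> (g R)\<^sup>2 * (avg (fs \<sigma>) R)\<^sup>2 * indicator (rect R) x / rect_measure R"
        proof (cases "\<tau> R \<le> \<bar>avg (fs \<sigma>) R\<bar>")
          case True
          then have "(\<tau> R)\<^sup>2 \<le> (avg (fs \<sigma>) R)\<^sup>2" using \<tau>0[of R] by (subst abs_le_square_iff[symmetric]) auto
          then have "?t R \<le> (g R)\<^sup>2 * (avg (fs \<sigma>) R)\<^sup>2 * indicator (rect R) x / rect_measure R"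
            by (intro divide_right_mono mult_right_mono mult_left_mono) (auto simp: less_imp_le)
          then show ?thesis using True by simp
        qed (simp add: less_imp_le)
      qed
    qed (use q in auto)
    finally show ?thesis .
  qed
  have "ennreal ?n * (\<integral>\<^sup>+x. ennreal (T x powr (q / 2)) \<partial>lborel) = (\<integral>\<^sup>+x. ennreal (?n * T x powr (q / 2)) \<partial>lborel)"
    by (subst nn_integral_cmult[symmetric]) (auto intro!: nn_integral_cong ennreal_mult[symmetric])
  also have "\<dots> \<le> (\<integral>\<^sup>+x. 2 * (\<Sum>\<sigma>\<in>Pow K. ennreal (rsum F (\<lambda>R. (g R)\<^sup>2 * (avg (fs \<sigma>) R)\<^sup>2) x powr (q / 2))) \<partial>lborel)"
  proof (intro nn_integral_mono)
    fix x
    let ?S = "\<Sum>\<sigma>\<in>Pow K. rsum F (\<lambda>R. (g R)\<^sup>2 * (avg (fs \<sigma>) R)\<^sup>2) x powr (q / 2)"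
    have "ennreal (?n * T x powr (q / 2)) \<le> ennreal (2 * ?S)" by (intro ennreal_leI pw)
    also have "\<dots> = 2 * ennreal ?S" by (subst ennreal_mult) (auto intro: sum_nonneg)
    also have "ennreal ?S = (\<Sum>\<sigma>\<in>Pow K. ennreal (rsum F (\<lambda>R. (g R)\<^sup>2 * (avg (fs \<sigma>) R)\<^sup>2) x powr (q / 2)))"
      by (rule sum_ennreal[symmetric]) simp
    finally show "ennreal (?n * T x powr (q / 2)) \<le> 2 * (\<Sum>\<sigma>\<in>Pow K. ennreal (rsum F (\<lambda>R. (g R)\<^sup>2 * (avg (fs \<sigma>) R)\<^sup>2) x powr (q / 2)))" .
  qed
  also have "\<dots> = 2 * (\<Sum>\<sigma>\<in>Pow K. rint F (\<lambda>R. (g R)\<^sup>2 * (avg (fs \<sigma>) R)\<^sup>2) (q / 2))"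
    by (simp add: nn_integral_cmult nn_integral_sum del: sum_ennreal)
  also have "\<dots> \<le> 2 * (\<Sum>\<sigma>\<in>Pow K. ennreal ?B)"
    using A by (intro mult_left_mono sum_mono paraprod_opnorm_test[OF p(1) q(1) Cb _ op locally_integrable_if_integrable[OF int_fs] Mfs F]) auto
  also have "\<dots> = ennreal ?n * ennreal (2 * ?B)"
    by (simp add: ennreal_mult ennreal_of_nat_eq_real_of_nat ac_simps)
  finally have T: "(\<integral>\<^sup>+x. ennreal (T x powr (q / 2)) \<partial>lborel) \<le> ennreal (2 * ?B)"
    using n by (subst (asm) ennreal_mult_le_mult_iff) auto
  show ?thesis
    unfolding level_adapted_def
  proof (intro exI[of _ \<tau>] exI[of _ E] conjI ballI impI)
    show "rint F (\<lambda>R. (g R)\<^sup>2 * (\<tau> R)\<^sup>2) (q / 2) \<le> ennreal (2 * ?B)"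
      using T by (simp add: T_def)
    fix k assume k: "k \<in> K"
    show "E k \<in> sets borel" by (rule E)
    show "emeasure lborel (E k) \<le> ennreal (\<delta> * measure lborel (sq_level F g k))"
      using E(2)[of k] by (simp add: \<Omega>_def V_def)
    fix R assume "R \<in> F" "rect_measure R \<le> 2 * measure lborel (rect R \<inter> (sq_level F g k))"
    then have "1 / 4 \<le> \<bar>avg (f k) R\<bar> \<or> rect R \<subseteq> E k" by (intro good) (simp add: \<Omega>_def V_def)
    then show "2 powr (real_of_int k * \<alpha>) / 4 \<le> \<tau> R \<or> rect R \<subseteq> E k" using \<tau>ge[OF k, of R] unfolding c_def by blast
  qed
qed

text \<open>Both ranges of \<open>p\<close> lead to a bound of the finite integral \<open>b\<close>
  by a constant times \<open>A powr q * b powr (q / p)\<close>. Since \<open>q < p\<close> and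
  \<open>1 - q / p = q / r\<close>, dividing by the power of \<open>b\<close> leaves
  \<open>b powr (q / r)\<close> on the left.\<close>

lemma square_fun_le_opnorm:
  assumes p: "0 < p" and q: "0 < q" and r: "0 < r" and pqr: "1 / q = 1 / p + 1 / r"
  obtains C :: real where "0 < C"
    "\<And>g A F. 0 < A \<Longrightarrow> paraprod_opnorm p q g \<le> ennreal A \<Longrightarrow> finite F \<Longrightarrow>
      rint F (\<lambda>R. (g R)\<^sup>2) (r / 2) \<le> ennreal (C * A powr r)"
proof -
  define \<alpha> where "\<alpha> = r / p"
  have \<alpha>: "0 < \<alpha>" using p r by (simp add: \<alpha>_def)
  have qr: "q * (\<alpha> + 1) = r" using p q r pqr by (simp add: \<alpha>_def field_simps)
  have qpr: "1 - q / p = q / r" using p q r pqr by (simp add: field_simps)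
  have "1 / p < 1 / q" using pqr r by simp
  then have qp: "q < p" using p q by (simp add: field_simps)
  obtain \<delta> C :: real where \<delta>: "0 < \<delta>" and C: "0 < C" and level:
    "\<And>F g. finite F \<Longrightarrow> \<exists>K. finite K \<and> (\<forall>\<tau> E.
      level_adapted \<delta> \<alpha> F g K \<tau> E \<longrightarrow>
      rint F (\<lambda>R. (g R)\<^sup>2) (r / 2)
        \<le> ennreal C * rint F (\<lambda>R. (g R)\<^sup>2 * (\<tau> R)\<^sup>2) (q / 2))"
    using level_bound[OF q r \<alpha> qr] by blast
  \<comment> \<open>The common form of both cases; the factor 2 stems from averaging over
    signs.\<close>
  have "\<exists>C2>0. \<forall>g A F b. 0 < A \<longrightarrow> paraprod_opnorm p q g \<le> ennreal A \<longrightarrow> finite F \<longrightarrow> 0 < b \<longrightarrow>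
      rint F (\<lambda>R. (g R)\<^sup>2) (r / 2) = ennreal b \<longrightarrow> b \<le> C * (2 * (A powr q * (C2 * b) powr (q / p)))"
  proof (cases "p \<le> 1")
    case True
    obtain C0 :: real where C0: "0 < C0" and test: "\<And>N \<Omega>. fstep (lev2 N) (indicator \<Omega>) \<Longrightarrow> \<exists>f E. test_pair p C0 \<delta> \<Omega> f E"
      using test_pair_exists[OF p \<delta>] by blast
    have q2: "q \<le> 2" using True qp by simp
    show ?thesis
    proof (intro exI[of _ "C0 * geo r"] conjI allI impI)
      show "0 < C0 * geo r" using C0 geo_pos[OF r] by simp
      fix g :: "drect \<Rightarrow> real" and A b :: real and F :: "drect set"
      assume A: "0 < A" and op: "paraprod_opnorm p q g \<le> ennreal A" and F: "finite F" and b: "0 < b"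
        and IV: "rint F (\<lambda>R. (g R)\<^sup>2) (r / 2) = ennreal b"
      obtain K where K: "finite K" and lev: "\<And>\<tau> E. level_adapted \<delta> \<alpha> F g K \<tau> E \<Longrightarrow>
        rint F (\<lambda>R. (g R)\<^sup>2) (r / 2)
        \<le> ennreal C * rint F (\<lambda>R. (g R)\<^sup>2 * (\<tau> R)\<^sup>2) (q / 2)"
        using level[OF F, of g] by blast
      have "\<exists>\<tau> E. level_adapted \<delta> \<alpha> F g K \<tau> E \<and>
        rint F (\<lambda>R. (g R)\<^sup>2 * (\<tau> R)\<^sup>2) (q / 2) \<le> ennreal (2 * (A powr q * (C0 * geo r * b) powr (q / p)))"
        by (rule level_test_le_1[OF p True q q2 r \<alpha>_def F K A op b IV C0]) (rule test)
      then obtain \<tau> E where adapted: "level_adapted \<delta> \<alpha> F g K \<tau> E"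
        and T: "rint F (\<lambda>R. (g R)\<^sup>2 * (\<tau> R)\<^sup>2) (q / 2) \<le> ennreal (2 * (A powr q * (C0 * geo r * b) powr (q / p)))"
        by blast
      from lev[OF adapted] have "ennreal b \<le> ennreal C * rint F (\<lambda>R. (g R)\<^sup>2 * (\<tau> R)\<^sup>2) (q / 2)"
        unfolding IV .
      also have "\<dots> \<le> ennreal C * ennreal (2 * (A powr q * (C0 * geo r * b) powr (q / p)))" by (rule mult_left_mono[OF T]) simp
      also have "\<dots> = ennreal (C * (2 * (A powr q * (C0 * geo r * b) powr (q / p))))"
        using C by (intro ennreal_mult[symmetric]) auto
      finally show "b \<le> C * (2 * (A powr q * (C0 * geo r * b) powr (q / p)))"
        using C by (subst (asm) ennreal_le_iff) auto
    qed
  next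
    case False
    then have p1: "1 < p" by simp
    let ?Cp = "(2 powr p * p / (p - 1))\<^sup>2"
    show ?thesis
    proof (intro exI[of _ ?Cp] conjI allI impI)
      show "0 < ?Cp" using p1 by simp
      fix g :: "drect \<Rightarrow> real" and A b :: real and F :: "drect set"
      assume A: "0 < A" and op: "paraprod_opnorm p q g \<le> ennreal A" and F: "finite F" and b: "0 < b"
        and IV: "rint F (\<lambda>R. (g R)\<^sup>2) (r / 2) = ennreal b"
      obtain \<tau> where \<tau>: "\<forall>k. \<forall>R\<in>F. rect_measure R \<le> 2 * measure lborel (rect R \<inter> (sq_level F g k)) \<longrightarrow>
           2 powr (real_of_int k * \<alpha>) / 4 \<le> \<tau> R"
        and T: "rint F (\<lambda>R. (g R)\<^sup>2 * (\<tau> R)\<^sup>2) (q / 2) \<le> ennreal (A powr q * (?Cp * b) powr (q / p))"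
        using level_test_gt_1[OF p1 q r \<alpha>_def F A op b IV] by blast
      obtain K where lev: "\<And>\<tau> E. level_adapted \<delta> \<alpha> F g K \<tau> E \<Longrightarrow>
        rint F (\<lambda>R. (g R)\<^sup>2) (r / 2)
        \<le> ennreal C * rint F (\<lambda>R. (g R)\<^sup>2 * (\<tau> R)\<^sup>2) (q / 2)"
        using level[OF F, of g] by blast
      \<comment> \<open>For \<open>p > 1\<close> no rectangle is lost, so the exceptional sets are
        taken empty.\<close>
      have "ennreal b \<le> ennreal C * rint F (\<lambda>R. (g R)\<^sup>2 * (\<tau> R)\<^sup>2) (q / 2)"
        unfolding IV[symmetric] by (rule lev[of \<tau> "\<lambda>_. {}"]) (use \<tau> \<delta> in \<open>auto simp: level_adapted_def\<close>)
      also have "\<dots> \<le> ennreal C * ennreal (A powr q * (?Cp * b) powr (q / p))" by (rule mult_left_mono[OF T]) simp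
      also have "\<dots> = ennreal (C * (A powr q * (?Cp * b) powr (q / p)))"
        using C by (intro ennreal_mult[symmetric]) auto
      finally have "b \<le> C * (A powr q * (?Cp * b) powr (q / p))"
        using C by (subst (asm) ennreal_le_iff) auto
      also have "\<dots> \<le> C * (2 * (A powr q * (?Cp * b) powr (q / p)))" using C by simp
      finally show "b \<le> C * (2 * (A powr q * (?Cp * b) powr (q / p)))" .
    qed
  qed
  then obtain C2 where C2: "0 < C2" and key: "\<And>g A F b. 0 < A \<Longrightarrow> paraprod_opnorm p q g \<le> ennreal A \<Longrightarrow> finite F \<Longrightarrow> 0 < b \<Longrightarrow>
      rint F (\<lambda>R. (g R)\<^sup>2) (r / 2) = ennreal b \<Longrightarrow> b \<le> C * (2 * (A powr q * (C2 * b) powr (q / p)))"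
    by blast
  define D where "D = (2 * C * C2 powr (q / p)) powr (r / q)"
  have D: "0 < D" using C C2 by (simp add: D_def)
  show ?thesis
  proof (rule that[OF D])
    fix g :: "drect \<Rightarrow> real" and A :: real and F :: "drect set"
    assume A: "0 < A" and op: "paraprod_opnorm p q g \<le> ennreal A" and F: "finite F"
    let ?I = "rint F (\<lambda>R. (g R)\<^sup>2) (r / 2)"
    have "?I < top" using r by (intro rsum_powr_finite F) auto
    then obtain b where b: "0 \<le> b" "?I = ennreal b" by (cases ?I) auto
    show "?I \<le> ennreal (D * A powr r)"
    proof (cases "b = 0")
      case False
      with b have b0: "0 < b" by simp
      have "b \<le> 2 * C * A powr q * C2 powr (q / p) * b powr (q / p)"
        using key[OF A op F b0 b(2)] by (simp add: powr_mult ac_simps)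
      then have "b / b powr (q / p) \<le> 2 * C * A powr q * C2 powr (q / p)" using b0 by (simp add: divide_le_eq)
      also have "b / b powr (q / p) = b powr (q / r)" using b0 powr_diff[of b 1 "q / p"] by (simp add: qpr)
      finally have "(b powr (q / r)) powr (r / q) \<le> (2 * C * A powr q * C2 powr (q / p)) powr (r / q)"
        using q r by (intro powr_mono2) auto
      also have "(b powr (q / r)) powr (r / q) = b" using q r b0 by (simp add: powr_powr)
      also have "(2 * C * A powr q * C2 powr (q / p)) powr (r / q) = D * A powr r"
      proof -
        have "2 * C * A powr q * C2 powr (q / p) = (2 * C * C2 powr (q / p)) * A powr q" by simp
        then show ?thesis unfolding D_def using q by (simp only: powr_mult powr_powr) simp
      qed
      finally show ?thesis using b(2) by (simp add: ennreal_leI)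
    qed (use b in simp)
  qed
qed

lemma Hdot_le_paraprod_opnorm:
  assumes "0 < p" "0 < q" and r: "0 < r" and "1 / q = 1 / p + 1 / r"
  obtains c :: real where "0 < c" "\<And>g. ennreal c * Hdot_norm r g \<le> paraprod_opnorm p q g"
proof -
  obtain C :: real where C: "0 < C" and le: "\<And>g A F. 0 < A \<Longrightarrow> paraprod_opnorm p q g \<le> ennreal A \<Longrightarrow> finite F \<Longrightarrow>
      rint F (\<lambda>R. (g R)\<^sup>2) (r / 2) \<le> ennreal (C * A powr r)"
    using square_fun_le_opnorm[OF assms] by blast
  show ?thesis
  proof (rule that[of "1 / C powr (1 / r)"])
    show "0 < 1 / C powr (1 / r)" using C by simp
    fix g
    have "Hdot_norm r g \<le> ennreal (C powr (1 / r) * A)" if A: "0 < A" "paraprod_opnorm p q g \<le> ennreal A" for A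
    proof -
      have "pint r (sq_fun g) \<le> ennreal (C * A powr r)"
        by (intro nn_integral_sq_fun_le r le A)
      also have "\<dots> = epowr (ennreal (C powr (1 / r) * A)) r"
        using C A r by (simp add: epowr_ennreal powr_mult powr_powr)
      finally show ?thesis using r by (simp add: Hdot_norm_le_iff)
    qed
    then show "ennreal (1 / C powr (1 / r)) * Hdot_norm r g \<le> paraprod_opnorm p q g"
      using C by (intro ennreal_scaled_le) auto
  qed
qed

theorem theorem3p1:
  shows "(\<forall>p q r :: real. 0 < p \<and> 0 < q \<and> 0 < r \<and> 1 / q = 1 / p + 1 / r \<longrightarrow>
           (\<exists>c C :: real. 0 < c \<and> 0 < C \<and>
              (\<forall>g :: drect \<Rightarrow> real.
                  ennreal c * Hdot_norm r g \<le> paraprod_opnorm p q g \<and>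
                  paraprod_opnorm p q g \<le> ennreal C * Hdot_norm r g)))
       \<and> (\<forall>p :: real. 0 < p \<longrightarrow>
           (\<exists>c C :: real. 0 < c \<and> 0 < C \<and>
              (\<forall>g :: drect \<Rightarrow> real.
                  ennreal c * BMO_norm g \<le> paraprod_opnorm p p g \<and>
                  paraprod_opnorm p p g \<le> ennreal C * BMO_norm g)))"
proof (intro conjI allI impI)
  fix p q r :: real
  assume "0 < p \<and> 0 < q \<and> 0 < r \<and> 1 / q = 1 / p + 1 / r"
  then have pqr: "0 < p" "0 < q" "0 < r" "1 / q = 1 / p + 1 / r" by blast+
  obtain c :: real where "0 < c" "\<And>g. ennreal c * Hdot_norm r g \<le> paraprod_opnorm p q g"
    using Hdot_le_paraprod_opnorm[OF pqr] by blast
  moreover have "0 < 2 powr (1 / q)" by simp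
  ultimately show "\<exists>c C :: real. 0 < c \<and> 0 < C \<and>
      (\<forall>g :: drect \<Rightarrow> real. ennreal c * Hdot_norm r g \<le> paraprod_opnorm p q g \<and>
        paraprod_opnorm p q g \<le> ennreal C * Hdot_norm r g)"
    using paraprod_opnorm_le_Hdot[OF pqr] by blast
next
  fix p :: real
  assume p: "0 < p"
  obtain c :: real where "0 < c" "\<And>g. ennreal c * BMO_norm g \<le> paraprod_opnorm p p g"
    using BMO_le_paraprod_opnorm[OF p] by blast
  moreover obtain C :: real where "0 < C" "\<And>g. paraprod_opnorm p p g \<le> ennreal C * BMO_norm g"
    using paraprod_opnorm_le_BMO[OF p] by blast
  ultimately show "\<exists>c C :: real. 0 < c \<and> 0 < C \<and>
      (\<forall>g :: drect \<Rightarrow> real. ennreal c * BMO_norm g \<le> paraprod_opnorm p p g \<and>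
        paraprod_opnorm p p g \<le> ennreal C * BMO_norm g)"
    by blast
qed

end
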